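(* Let $k=\mathbb{C}$, let $B$ be a finite-dimensional $k$-algebra, and let $L$ and $M$ be finitely generated $B$-modules of dimensions $n$ and $m$ respectively. Let $\overrightarrow{A_2}$ be the quiver $1\to2$. (1) The map from $\operatorname{Hom}_B(L,M)$ to $\coprod_{d\le m}\operatorname{rep}_{(m,d)}(B\overrightarrow{A_2})/GL(m,d)$ which sends a morphism $l$ to the orbit of the representation $M\twoheadrightarrow\operatorname{Coker}l$ lifts to a constructible map from $\operatorname{Hom}_B(L,M)$ to $\coprod_{d\le m}\operatorname{rep}_{(m,d)}(B\overrightarrow{A_2})$. (2) Dually, the map from $\operatorname{Hom}_B(L,M)$ to $\coprod_{d\le n}\operatorname{rep}_{(d,n)}(B\overrightarrow{A_2})/GL(d,n)$ which sends $l$ to the orbit of the representation $\operatorname{Ker}l\rightarrowtail L$ lifts to a constructible map from $\operatorname{Hom}_B(L,M)$ to $\coprod_{d\le n}\operatorname{rep}_{(d,n)}(B\overrightarrow{A_2})$.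
   Context: For a finite quiver $Q$ and $d=(d_i)_{i\in Q_0}$ non-negative integers, $\operatorname{rep}_dBQ$ is the affine variety whose points consist of a right $B$-module structure on $k^{d_i}$ (an algebra morphism $B^{\mathrm{op}}\to\operatorname{End}_k(k^{d_i})$) for each vertex $i$ and a $B$-linear map $k^{d_i}\to k^{d_j}$ for each arrow $i\to j$; $GL(d)=\prod_iGL_{d_i}(k)$ acts by base change, and $\operatorname{rep}_dBQ/GL(d)$ denotes the set of orbits. Modules are right modules. A locally closed subset is the intersection of an open and a closed subset. A map $f:X\to Y$ between algebraic varieties is constructible if $X$ can be decomposed into a finite disjoint union of locally closed subsets on each of which $f$ restricts to a morphism of algebraic varieties. $\operatorname{Hom}_B(L,M)$ is viewed as an affine space. *)

theory Defs
  imports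
    "Jordan_Normal_Form.VS_Connect"
    "Graph_Theory.Digraph"
    "HOL-Algebra.AbelCoset"
    "HOL-Analysis.Sum_Topology"
    "HOL-Library.Disjoint_Sets"
begin

section \<open>Algebraic varieties and constructible maps\<close>

text \<open>
  Varieties over the complex numbers are treated classically, as spaces with functions: a
  topological space together with, for every open set, the functions regular on it.  Regular
  functions are total HOL functions of which only the values on the open set matter.
\<close>

record 'a variety =
  zspace :: "'a topology"
  regular :: "'a set \<Rightarrow> ('a \<Rightarrow> complex) set"

inductive_set polynomial_functions :: "('a \<Rightarrow> complex) set \<Rightarrow> ('a \<Rightarrow> complex) set"
  for G :: "('a \<Rightarrow> complex) set" where
  coordinate: "g \<in> G \<Longrightarrow> g \<in> polynomial_functions G"
| const: "(\<lambda>_. c) \<in> polynomial_functions G"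
| add: "p \<in> polynomial_functions G \<Longrightarrow> q \<in> polynomial_functions G
    \<Longrightarrow> (\<lambda>x. p x + q x) \<in> polynomial_functions G"
| mult: "p \<in> polynomial_functions G \<Longrightarrow> q \<in> polynomial_functions G
    \<Longrightarrow> (\<lambda>x. p x * q x) \<in> polynomial_functions G"

definition zariski_open :: "'a set \<Rightarrow> ('a \<Rightarrow> complex) set \<Rightarrow> 'a set \<Rightarrow> bool" where
  "zariski_open X G U \<longleftrightarrow>
     (\<exists>F \<subseteq> polynomial_functions G. U = X - {x \<in> X. \<forall>p \<in> F. p x = 0})"

definition zariski :: "'a set \<Rightarrow> ('a \<Rightarrow> complex) set \<Rightarrow> 'a topology" where
  "zariski X G = topology (zariski_open X G)"

lemma istopology_zariski_open: "istopology (zariski_open X G)"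
  unfolding istopology_def
proof (rule conjI; intro allI impI)
  fix S T assume "zariski_open X G S" "zariski_open X G T"
  then obtain F H where F: "F \<subseteq> polynomial_functions G" "S = X - {x \<in> X. \<forall>p \<in> F. p x = 0}"
    and H: "H \<subseteq> polynomial_functions G" "T = X - {x \<in> X. \<forall>p \<in> H. p x = 0}"
    unfolding zariski_open_def by auto
  define K where "K = (\<lambda>(p, q) x. p x * q x) ` (F \<times> H)"
  have "K \<subseteq> polynomial_functions G"
    using F(1) H(1) unfolding K_def by (auto intro!: polynomial_functions.mult)
  moreover have "(\<forall>r \<in> K. r x = 0) \<longleftrightarrow> (\<forall>p \<in> F. p x = 0) \<or> (\<forall>q \<in> H. q x = 0)" for x
    unfolding K_def by (auto simp: split_beta)
  then have "S \<inter> T = X - {x \<in> X. \<forall>r \<in> K. r x = 0}"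
    unfolding F(2) H(2) by auto
  ultimately show "zariski_open X G (S \<inter> T)" unfolding zariski_open_def by blast
next
  fix \<K> assume "\<forall>K\<in>\<K>. zariski_open X G K"
  then have "\<forall>K\<in>\<K>. \<exists>F. F \<subseteq> polynomial_functions G \<and> K = X - {x \<in> X. \<forall>p \<in> F. p x = 0}"
    unfolding zariski_open_def by simp
  then obtain F where F: "\<forall>K\<in>\<K>. F K \<subseteq> polynomial_functions G \<and>
      K = X - {x \<in> X. \<forall>p \<in> F K. p x = 0}"
    unfolding bchoice_iff by auto
  then have "x \<in> K \<longleftrightarrow> x \<in> X \<and> \<not> (\<forall>p \<in> F K. p x = 0)" if "K \<in> \<K>" for x K
    using that by blast
  then have "\<Union>\<K> = X - {x \<in> X. \<forall>p \<in> (\<Union>K\<in>\<K>. F K). p x = 0}"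
    by auto
  moreover have "(\<Union>K\<in>\<K>. F K) \<subseteq> polynomial_functions G" using F by blast
  ultimately show "zariski_open X G (\<Union>\<K>)" unfolding zariski_open_def by blast
qed

lemma openin_zariski: "openin (zariski X G) = zariski_open X G"
  unfolding zariski_def by (simp add: istopology_zariski_open topology_inverse')

lemma topspace_zariski [simp]: "topspace (zariski X G) = X"
proof -
  have "zariski_open X G X"
    unfolding zariski_open_def
    by (rule exI[of _ "{\<lambda>_. 1}"]) (auto intro: polynomial_functions.const)
  moreover have "U \<subseteq> X" if "zariski_open X G U" for U
    using that unfolding zariski_open_def by blast
  ultimately show ?thesis unfolding topspace_def openin_zariski by blast
qed

text \<open>
  The affine variety with point set \<open>X\<close> whose coordinate ring is generated by the (restrictions to
  \<open>X\<close> of the) functions in \<open>G\<close>.  A function is regular if it is locally a quotient of polynomial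
  functions.
\<close>

definition affine_variety :: "'a set \<Rightarrow> ('a \<Rightarrow> complex) set \<Rightarrow> 'a variety" where
  "affine_variety X G = \<lparr>
     zspace = zariski X G,
     regular = (\<lambda>U. {f. \<forall>x \<in> U. \<exists>V p q. openin (zariski X G) V \<and> x \<in> V \<and>
       p \<in> polynomial_functions G \<and> q \<in> polynomial_functions G \<and>
       (\<forall>y \<in> V \<inter> U. q y \<noteq> 0 \<and> f y = p y / q y)})\<rparr>"

definition locally_closedin :: "'a topology \<Rightarrow> 'a set \<Rightarrow> bool" where
  "locally_closedin T S \<longleftrightarrow> (\<exists>U C. openin T U \<and> closedin T C \<and> S = U \<inter> C)"

text \<open>
  The structure induced on a locally closed subset: regular functions are those that locally extend
  to regular functions on open subsets of the ambient variety.
\<close>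

definition subvariety :: "'a variety \<Rightarrow> 'a set \<Rightarrow> 'a variety" where
  "subvariety X S = \<lparr>
     zspace = subtopology (zspace X) S,
     regular = (\<lambda>U. {f. \<forall>x \<in> U. \<exists>V g. openin (zspace X) V \<and> x \<in> V \<and>
       g \<in> regular X V \<and> (\<forall>y \<in> V \<inter> U. f y = g y)})\<rparr>"

definition coproduct_variety :: "'i set \<Rightarrow> ('i \<Rightarrow> 'a variety) \<Rightarrow> ('i \<times> 'a) variety" where
  "coproduct_variety I X = \<lparr>
     zspace = sum_topology (\<lambda>i. zspace (X i)) I,
     regular = (\<lambda>U. {f. \<forall>i \<in> I. (\<lambda>x. f (i, x)) \<in> regular (X i) {x. (i, x) \<in> U}})\<rparr>"

definition variety_morphism :: "'a variety \<Rightarrow> 'b variety \<Rightarrow> ('a \<Rightarrow> 'b) \<Rightarrow> bool" where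
  "variety_morphism X Y f \<longleftrightarrow>
     continuous_map (zspace X) (zspace Y) f \<and>
     (\<forall>V g. openin (zspace Y) V \<and> g \<in> regular Y V \<longrightarrow>
        g \<circ> f \<in> regular X {x \<in> topspace (zspace X). f x \<in> V})"

definition constructible_map :: "'a variety \<Rightarrow> 'b variety \<Rightarrow> ('a \<Rightarrow> 'b) \<Rightarrow> bool" where
  "constructible_map X Y f \<longleftrightarrow>
     (\<exists>\<S>. finite \<S> \<and> disjoint \<S> \<and> \<Union>\<S> = topspace (zspace X) \<and>
        (\<forall>S \<in> \<S>. locally_closedin (zspace X) S \<and> variety_morphism (subvariety X S) Y f))"

text \<open>A finite-dimensional vector space as an affine space: its coordinates are the linear forms.\<close>

definition affine_space :: "(complex, 'a) module \<Rightarrow> 'a variety" where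
  "affine_space V = affine_variety (carrier V)
     {\<xi>. (\<forall>v \<in> carrier V. \<forall>w \<in> carrier V. \<xi> (v \<oplus>\<^bsub>V\<^esub> w) = \<xi> v + \<xi> w) \<and>
         (\<forall>c. \<forall>v \<in> carrier V. \<xi> (c \<odot>\<^bsub>V\<^esub> v) = c * \<xi> v)}"


section \<open>Finite-dimensional algebras and right modules\<close>

text \<open>The multiplication of the record type \<open>module\<close> is that of the algebra; the algebra is not
  assumed to be commutative, in contrast to the locale \<open>algebra\<close>.\<close>

locale fin_dim_algebra =
  fixes B :: "(complex, 'b) module" (structure)
  assumes ring: "ring B"
    and vectorspace: "vectorspace class_ring B"
    and fin_dim: "vectorspace.fin_dim class_ring B"
    and smult_mult_left:
      "\<lbrakk>x \<in> carrier B; y \<in> carrier B\<rbrakk> \<Longrightarrow> (c \<odot> x) \<otimes> y = c \<odot> (x \<otimes> y)"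
    and smult_mult_right:
      "\<lbrakk>x \<in> carrier B; y \<in> carrier B\<rbrakk> \<Longrightarrow> x \<otimes> (c \<odot> y) = c \<odot> (x \<otimes> y)"

text \<open>As in the library, the fields \<open>mult\<close> and \<open>one\<close> carry no information in a module.\<close>

record ('b, 'x) rmodule = "(complex, 'x) module" +
  act :: "'x \<Rightarrow> 'b \<Rightarrow> 'x" (infixl \<open>\<triangleleft>\<index>\<close> 70)

locale right_module =
  fixes B :: "(complex, 'b) module" and V :: "('b, 'x) rmodule" (structure)
  assumes vectorspace: "vectorspace class_ring V"
    and act_closed: "\<lbrakk>v \<in> carrier V; b \<in> carrier B\<rbrakk> \<Longrightarrow> v \<triangleleft> b \<in> carrier V"
    and act_add_left: "\<lbrakk>v \<in> carrier V; w \<in> carrier V; b \<in> carrier B\<rbrakk>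
      \<Longrightarrow> (v \<oplus> w) \<triangleleft> b = v \<triangleleft> b \<oplus> w \<triangleleft> b"
    and act_add_right: "\<lbrakk>v \<in> carrier V; b \<in> carrier B; b' \<in> carrier B\<rbrakk>
      \<Longrightarrow> v \<triangleleft> (b \<oplus>\<^bsub>B\<^esub> b') = v \<triangleleft> b \<oplus> v \<triangleleft> b'"
    and act_smult_left: "\<lbrakk>v \<in> carrier V; b \<in> carrier B\<rbrakk> \<Longrightarrow> (c \<odot> v) \<triangleleft> b = c \<odot> (v \<triangleleft> b)"
    and act_smult_right: "\<lbrakk>v \<in> carrier V; b \<in> carrier B\<rbrakk> \<Longrightarrow> v \<triangleleft> (c \<odot>\<^bsub>B\<^esub> b) = c \<odot> (v \<triangleleft> b)"
    and act_mult: "\<lbrakk>v \<in> carrier V; b \<in> carrier B; b' \<in> carrier B\<rbrakk>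
      \<Longrightarrow> v \<triangleleft> (b \<otimes>\<^bsub>B\<^esub> b') = (v \<triangleleft> b) \<triangleleft> b'"
    and act_one: "v \<in> carrier V \<Longrightarrow> v \<triangleleft> \<one>\<^bsub>B\<^esub> = v"

definition finitely_generated :: "(complex, 'b) module \<Rightarrow> ('b, 'x) rmodule \<Rightarrow> bool" where
  "finitely_generated B V \<longleftrightarrow>
     (\<exists>A. finite A \<and> A \<subseteq> carrier V \<and>
        (\<forall>v \<in> carrier V. \<exists>\<beta> \<in> A \<rightarrow> carrier B. v = (\<Oplus>\<^bsub>V\<^esub>a\<in>A. a \<triangleleft>\<^bsub>V\<^esub> \<beta> a)))"

definition rmodule_hom ::
    "(complex, 'b) module \<Rightarrow> ('b, 'x) rmodule \<Rightarrow> ('b, 'y) rmodule \<Rightarrow> ('x \<Rightarrow> 'y) set" where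
  "rmodule_hom B V W =
     {f \<in> carrier V \<rightarrow>\<^sub>E carrier W. f \<in> LinearCombinations.module_hom class_ring V W \<and>
        (\<forall>v \<in> carrier V. \<forall>b \<in> carrier B. f (v \<triangleleft>\<^bsub>V\<^esub> b) = f v \<triangleleft>\<^bsub>W\<^esub> b)}"

definition Hom ::
    "(complex, 'b) module \<Rightarrow> ('b, 'x) rmodule \<Rightarrow> ('b, 'y) rmodule \<Rightarrow> (complex, 'x \<Rightarrow> 'y) module"
  where
  "Hom B V W = \<lparr>
     carrier = rmodule_hom B V W,
     mult = undefined,
     one = undefined,
     zero = (\<lambda>v \<in> carrier V. \<zero>\<^bsub>W\<^esub>),
     add = (\<lambda>f g. \<lambda>v \<in> carrier V. f v \<oplus>\<^bsub>W\<^esub> g v),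
     smult = (\<lambda>c f. \<lambda>v \<in> carrier V. c \<odot>\<^bsub>W\<^esub> f v)\<rparr>"

definition Ker :: "('b, 'x) rmodule \<Rightarrow> ('b, 'y) rmodule \<Rightarrow> ('x \<Rightarrow> 'y) \<Rightarrow> ('b, 'x) rmodule" where
  "Ker V W f = V\<lparr>carrier := a_kernel V W f\<rparr>"

text \<open>
  The quotient by a submodule \<open>N\<close>, whose elements are the cosets of \<open>N\<close>; scalars and algebra elements
  act on representatives, as in \<open>rcoset_mult\<close>.
\<close>

definition quotient_module :: "('b, 'x) rmodule \<Rightarrow> 'x set \<Rightarrow> ('b, 'x set) rmodule" where
  "quotient_module V N = \<lparr>
     carrier = a_rcosets\<^bsub>V\<^esub> N,
     mult = undefined,
     one = undefined,
     zero = N,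
     add = set_add V,
     smult = (\<lambda>c C. \<Union>v\<in>C. N +>\<^bsub>V\<^esub> (c \<odot>\<^bsub>V\<^esub> v)),
     act = (\<lambda>C b. \<Union>v\<in>C. N +>\<^bsub>V\<^esub> (v \<triangleleft>\<^bsub>V\<^esub> b))\<rparr>"

definition Coker :: "('b, 'x) rmodule \<Rightarrow> ('b, 'y) rmodule \<Rightarrow> ('x \<Rightarrow> 'y) \<Rightarrow> ('b, 'y set) rmodule"
  where
  "Coker V W f = quotient_module W (f ` carrier V)"

definition Coker_proj ::
    "('b, 'x) rmodule \<Rightarrow> ('b, 'y) rmodule \<Rightarrow> ('x \<Rightarrow> 'y) \<Rightarrow> 'y \<Rightarrow> 'y set" where
  "Coker_proj V W f = (\<lambda>w \<in> carrier W. f ` carrier V +>\<^bsub>W\<^esub> w)"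


section \<open>Representation varieties\<close>

text \<open>
  The right module structures on column vectors of length \<open>n\<close>, where \<open>b\<close> acts by \<open>v \<mapsto> \<rho> b *\<^sub>v v\<close>;
  since these are right actions, \<open>\<rho>\<close> reverses products.
\<close>

definition module_structures ::
    "(complex, 'b) module \<Rightarrow> nat \<Rightarrow> ('b \<Rightarrow> complex mat) set" where
  "module_structures B n =
     {\<rho> \<in> carrier B \<rightarrow>\<^sub>E carrier_mat n n.
        \<rho> \<one>\<^bsub>B\<^esub> = 1\<^sub>m n \<and>
        (\<forall>b \<in> carrier B. \<forall>b' \<in> carrier B. \<rho> (b \<oplus>\<^bsub>B\<^esub> b') = \<rho> b + \<rho> b') \<and>
        (\<forall>c. \<forall>b \<in> carrier B. \<rho> (c \<odot>\<^bsub>B\<^esub> b) = c \<cdot>\<^sub>m \<rho> b) \<and>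
        (\<forall>b \<in> carrier B. \<forall>b' \<in> carrier B. \<rho> (b \<otimes>\<^bsub>B\<^esub> b') = \<rho> b' * \<rho> b)}"

type_synonym ('v, 'a, 'b) rep_point = "('v \<Rightarrow> 'b \<Rightarrow> complex mat) \<times> ('a \<Rightarrow> complex mat)"

definition rep_points ::
    "(complex, 'b) module \<Rightarrow> ('v, 'a) pre_digraph \<Rightarrow> ('v \<Rightarrow> nat) \<Rightarrow> ('v, 'a, 'b) rep_point set"
  where
  "rep_points B Q d =
     {(\<rho>, f). \<rho> \<in> (\<Pi>\<^sub>E i\<in>verts Q. module_structures B (d i)) \<and>
        f \<in> (\<Pi>\<^sub>E a\<in>arcs Q. carrier_mat (d (head Q a)) (d (tail Q a))) \<and>
        (\<forall>a \<in> arcs Q. \<forall>b \<in> carrier B. f a * \<rho> (tail Q a) b = \<rho> (head Q a) b * f a)}"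

definition rep_coordinates ::
    "(complex, 'b) module \<Rightarrow> ('v, 'a) pre_digraph \<Rightarrow> ('v \<Rightarrow> nat) \<Rightarrow>
      (('v, 'a, 'b) rep_point \<Rightarrow> complex) set" where
  "rep_coordinates B Q d =
     {\<lambda>(\<rho>, f). \<rho> i b $$ (p, q) | i b p q. i \<in> verts Q \<and> b \<in> carrier B \<and> p < d i \<and> q < d i} \<union>
     {\<lambda>(\<rho>, f). f a $$ (p, q) | a p q. a \<in> arcs Q \<and> p < d (head Q a) \<and> q < d (tail Q a)}"

definition rep_variety ::
    "(complex, 'b) module \<Rightarrow> ('v, 'a) pre_digraph \<Rightarrow> ('v \<Rightarrow> nat) \<Rightarrow> ('v, 'a, 'b) rep_point variety"
  where
  "rep_variety B Q d = affine_variety (rep_points B Q d) (rep_coordinates B Q d)"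

abbreviation Mat_ring :: "nat \<Rightarrow> complex mat ring" where
  "Mat_ring n \<equiv> ring_mat TYPE(complex) n ()"

definition GL :: "('v, 'a) pre_digraph \<Rightarrow> ('v \<Rightarrow> nat) \<Rightarrow> ('v \<Rightarrow> complex mat) set" where
  "GL Q d = (\<Pi>\<^sub>E i\<in>verts Q. Units (Mat_ring (d i)))"

definition base_change ::
    "(complex, 'b) module \<Rightarrow> ('v, 'a) pre_digraph \<Rightarrow> ('v \<Rightarrow> nat) \<Rightarrow> ('v \<Rightarrow> complex mat) \<Rightarrow>
      ('v, 'a, 'b) rep_point \<Rightarrow> ('v, 'a, 'b) rep_point" where
  "base_change B Q d g = (\<lambda>(\<rho>, f).
     (\<lambda>i \<in> verts Q. \<lambda>b \<in> carrier B. g i * \<rho> i b * inv\<^bsub>Mat_ring (d i)\<^esub> (g i),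
      \<lambda>a \<in> arcs Q. g (head Q a) * f a * inv\<^bsub>Mat_ring (d (tail Q a))\<^esub> (g (tail Q a))))"

definition GL_orbit ::
    "(complex, 'b) module \<Rightarrow> ('v, 'a) pre_digraph \<Rightarrow> ('v \<Rightarrow> nat) \<Rightarrow>
      ('v, 'a, 'b) rep_point \<Rightarrow> ('v, 'a, 'b) rep_point set" where
  "GL_orbit B Q d x = {base_change B Q d g x | g. g \<in> GL Q d}"


section \<open>Representations of the quiver with two vertices and one arrow\<close>

definition A2 :: "(nat, unit) pre_digraph" where
  "A2 = \<lparr>verts = {1, 2}, arcs = {()}, tail = (\<lambda>_. 1), head = (\<lambda>_. 2)\<rparr>"

definition A2_dim :: "nat \<Rightarrow> nat \<Rightarrow> nat \<Rightarrow> nat" where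
  "A2_dim d e = (\<lambda>i. if i = 1 then d else e)"

definition coordinate_iso :: "('b, 'x) rmodule \<Rightarrow> nat \<Rightarrow> ('x \<Rightarrow> complex vec) \<Rightarrow> bool" where
  "coordinate_iso V n \<phi> \<longleftrightarrow>
     \<phi> \<in> LinearCombinations.module_hom class_ring V (module_vec TYPE(complex) n) \<and>
     bij_betw \<phi> (carrier V) (carrier_vec n)"

text \<open>
  The orbit of a representation \<open>F : V \<rightarrow> W\<close> in finite-dimensional right modules: all points obtained
  by identifying \<open>V\<close> and \<open>W\<close> linearly with spaces of column vectors.
\<close>

definition orbit_of_representation ::
    "(complex, 'b) module \<Rightarrow> ('b, 'x) rmodule \<Rightarrow> ('b, 'y) rmodule \<Rightarrow> ('x \<Rightarrow> 'y) \<Rightarrow>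
      (nat, unit, 'b) rep_point set" where
  "orbit_of_representation B V W F =
     (let d = vectorspace.dim class_ring V; e = vectorspace.dim class_ring W in
      {(\<rho>, f). (\<rho>, f) \<in> rep_points B A2 (A2_dim d e) \<and>
        (\<exists>\<phi> \<psi>. coordinate_iso V d \<phi> \<and> coordinate_iso W e \<psi> \<and>
          (\<forall>v \<in> carrier V. \<forall>b \<in> carrier B. \<phi> (v \<triangleleft>\<^bsub>V\<^esub> b) = \<rho> 1 b *\<^sub>v \<phi> v) \<and>
          (\<forall>w \<in> carrier W. \<forall>b \<in> carrier B. \<psi> (w \<triangleleft>\<^bsub>W\<^esub> b) = \<rho> 2 b *\<^sub>v \<psi> w) \<and>
          (\<forall>v \<in> carrier V. \<psi> (F v) = f () *\<^sub>v \<phi> v))})"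

text \<open>
  The orbits of \<open>M \<twoheadrightarrow> Coker l\<close> and \<open>Ker l \<rightarrowtail> L\<close>, tagged by the
  component of the coproduct in which they lie.
\<close>

definition coker_orbit ::
    "(complex, 'b) module \<Rightarrow> ('b, 'x) rmodule \<Rightarrow> ('b, 'y) rmodule \<Rightarrow> ('x \<Rightarrow> 'y) \<Rightarrow>
      nat \<times> (nat, unit, 'b) rep_point set" where
  "coker_orbit B L M l =
     (vectorspace.dim class_ring (Coker L M l),
      orbit_of_representation B M (Coker L M l) (Coker_proj L M l))"

definition ker_orbit ::
    "(complex, 'b) module \<Rightarrow> ('b, 'x) rmodule \<Rightarrow> ('b, 'y) rmodule \<Rightarrow> ('x \<Rightarrow> 'y) \<Rightarrow>
      nat \<times> (nat, unit, 'b) rep_point set" where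
  "ker_orbit B L M l =
     (vectorspace.dim class_ring (Ker L M l),
      orbit_of_representation B (Ker L M l) L (\<lambda>v. v))"

definition orbit_projection ::
    "(complex, 'b) module \<Rightarrow> (nat \<Rightarrow> nat \<Rightarrow> nat) \<Rightarrow> nat \<times> (nat, unit, 'b) rep_point \<Rightarrow>
      nat \<times> (nat, unit, 'b) rep_point set" where
  "orbit_projection B \<delta> = (\<lambda>(d, x). (d, GL_orbit B A2 (\<delta> d) x))"

end

theory Submission imports Defs begin

text \<open>
  In bases of \<open>L\<close> and \<open>M\<close> a homomorphism \<open>l\<close> is a matrix \<open>A\<close> whose entries are linear forms in
  \<open>l\<close>.  A point in the orbit of \<open>M \<twoheadrightarrow> Coker l\<close> is obtained from a matrix
  \<open>C\<close> of full row rank whose kernel is the column space of \<open>A\<close>: the arrow is \<open>C\<close> itself, and if \<open>E\<close> is a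
  right inverse of \<open>C\<close>, then \<open>b\<close> acts on the cokernel by \<open>C * \<rho> b * E\<close>, where \<open>\<rho>\<close> is the module
  structure of \<open>M\<close>.  So everything comes down to choosing \<open>C\<close> as a rational function of \<open>l\<close>, piece
  by piece, with \<open>E\<close> constant on each piece.

  Such a choice is provided by Cramer's rule.  By the exchange argument there is an invertible matrix
  \<open>P\<close> consisting of columns of \<open>A\<close> that span its column space and of standard unit vectors.  The rows of
  \<open>P\<inverse> = adj P / det P\<close> that belong to the unit vectors form \<open>C\<close>, and these unit vectors are the columns
  of \<open>E\<close>.  A given pattern of columns works for \<open>A\<close> if and only if the polynomial \<open>det P\<close> does not vanish
  and the polynomials that form the entries of the product of \<open>A\<close> with those rows of \<open>adj P\<close> do
  (\<open>exchange_complete_exists\<close>, \<open>exchange_complete_imp_split_cokernel\<close>).  There are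
  finitely many patterns, hence finitely many such polynomials, and whether a pattern works is constant on the
  locally closed sets on which it is prescribed which of these polynomials vanish; these sets partition
  the space of homomorphisms (\<open>constructible_split_cokernel\<close>).  On each of them \<open>C\<close> is
  a matrix of quotients of polynomials, and a map into a component of the coproduct with such
  coordinates is a morphism (\<open>rational_imp_morphism_to_component\<close>).

  The defining relations of \<open>C\<close> and \<open>E\<close>, namely \<open>C * E = 1\<close>, \<open>C * A = 0\<close> and \<open>E * C + A * U = 1\<close> for some
  \<open>U\<close>, are turned by transposition into relations saying that the columns of \<open>C\<^sup>T\<close> are a basis of the
  kernel of \<open>A\<^sup>T\<close>.  Applied to the transposed matrix of \<open>l\<close>, the same construction therefore proves the
  dual assertion.  It remains to compare orbits: two points obtained from coordinates on the same
  representation differ by the base changes between these coordinates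
  (\<open>orbit_of_representation_eq_GL_orbit\<close>).
\<close>

section \<open>Rational functions and morphisms\<close>

lemma polynomial_functions_sum:
  assumes "\<And>i. i \<in> I \<Longrightarrow> f i \<in> polynomial_functions G"
  shows "(\<lambda>x. \<Sum>i\<in>I. f i x) \<in> polynomial_functions G"
  using assms
  by (induction I rule: infinite_finite_induct)
    (simp_all add: polynomial_functions.const polynomial_functions.add)

lemma polynomial_functions_prod:
  assumes "\<And>i. i \<in> I \<Longrightarrow> f i \<in> polynomial_functions G"
  shows "(\<lambda>x. \<Prod>i\<in>I. f i x) \<in> polynomial_functions G"
  using assms
  by (induction I rule: infinite_finite_induct)
    (simp_all add: polynomial_functions.const polynomial_functions.mult)

lemma zariski_open_nonvanishing:
  assumes "p \<in> polynomial_functions G"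
  shows "openin (zariski X G) {x \<in> X. p x \<noteq> 0}"
  unfolding openin_zariski zariski_open_def
  by (rule exI[of _ "{p}"]) (use assms in auto)

lemma zariski_closed_vanishing:
  assumes "F \<subseteq> polynomial_functions G"
  shows "closedin (zariski X G) {x \<in> X. \<forall>p \<in> F. p x = 0}"
proof -
  have "openin (zariski X G) (X - {x \<in> X. \<forall>p \<in> F. p x = 0})"
    unfolding openin_zariski zariski_open_def using assms by blast
  then show ?thesis
    unfolding closedin_def by auto
qed

text \<open>
  A single quotient of polynomials has to work on all of \<open>S\<close>, which is stronger than being regular on
  \<open>S\<close>; it makes the closure under sums and products immediate.
\<close>
definition rational_on :: "('a \<Rightarrow> complex) set \<Rightarrow> 'a set \<Rightarrow> ('a \<Rightarrow> complex) \<Rightarrow> bool" where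
  "rational_on G S f \<longleftrightarrow> (\<exists>p \<in> polynomial_functions G. \<exists>q \<in> polynomial_functions G.
     \<forall>x \<in> S. q x \<noteq> 0 \<and> f x = p x / q x)"

lemma rational_on_const: "rational_on G S (\<lambda>_. c)"
  unfolding rational_on_def
  by (rule bexI[of _ "\<lambda>_. c"], rule bexI[of _ "\<lambda>_. 1"]) (auto intro: polynomial_functions.const)

lemma rational_on_add:
  assumes "rational_on G S f" "rational_on G S g"
  shows "rational_on G S (\<lambda>x. f x + g x)"
proof -
  obtain p q r s where
    "p \<in> polynomial_functions G" "q \<in> polynomial_functions G"
    "r \<in> polynomial_functions G" "s \<in> polynomial_functions G"
    and "\<forall>x \<in> S. q x \<noteq> 0 \<and> f x = p x / q x" "\<forall>x \<in> S. s x \<noteq> 0 \<and> g x = r x / s x"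
    using assms unfolding rational_on_def by blast
  moreover from this have "\<forall>x \<in> S. q x * s x \<noteq> 0 \<and>
      f x + g x = (p x * s x + r x * q x) / (q x * s x)"
    by (simp add: add_frac_eq)
  ultimately show ?thesis
    unfolding rational_on_def
    by (intro bexI[of _ "\<lambda>x. p x * s x + r x * q x"] bexI[of _ "\<lambda>x. q x * s x"]
      polynomial_functions.add polynomial_functions.mult)
qed

lemma rational_on_mult:
  assumes "rational_on G S f" "rational_on G S g"
  shows "rational_on G S (\<lambda>x. f x * g x)"
proof -
  obtain p q r s where
    "p \<in> polynomial_functions G" "q \<in> polynomial_functions G"
    "r \<in> polynomial_functions G" "s \<in> polynomial_functions G"
    and "\<forall>x \<in> S. q x \<noteq> 0 \<and> f x = p x / q x" "\<forall>x \<in> S. s x \<noteq> 0 \<and> g x = r x / s x"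
    using assms unfolding rational_on_def by blast
  moreover from this have "\<forall>x \<in> S. q x * s x \<noteq> 0 \<and> f x * g x = (p x * r x) / (q x * s x)"
    by simp
  ultimately show ?thesis
    unfolding rational_on_def
    by (intro bexI[of _ "\<lambda>x. p x * r x"] bexI[of _ "\<lambda>x. q x * s x"] polynomial_functions.mult)
qed

lemma rational_on_sum:
  assumes "\<And>i. i \<in> I \<Longrightarrow> rational_on G S (f i)"
  shows "rational_on G S (\<lambda>x. \<Sum>i\<in>I. f i x)"
  using assms
  by (induction I rule: infinite_finite_induct) (simp_all add: rational_on_const rational_on_add)

lemma rational_on_cong:
  assumes "rational_on G S f" "\<And>x. x \<in> S \<Longrightarrow> f x = g x"
  shows "rational_on G S g"
  using assms(1) unfolding rational_on_def by (auto simp: assms(2)[symmetric])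

lemma rational_on_polynomial_pullback:
  assumes "P \<in> polynomial_functions H" "\<And>c. c \<in> H \<Longrightarrow> rational_on G S (\<lambda>x. c (\<phi> x))"
  shows "rational_on G S (\<lambda>x. P (\<phi> x))"
  using assms(1)
proof induction
  case (coordinate c)
  then show ?case by (rule assms(2))
next
  case (const c)
  show ?case by (rule rational_on_const)
next
  case (add p q)
  then show ?case by (intro rational_on_add)
next
  case (mult p q)
  then show ?case by (intro rational_on_mult)
qed

lemma zspace_affine_variety [simp]: "zspace (affine_variety X G) = zariski X G"
  by (simp add: affine_variety_def)

lemma regular_affine_variety_iff:
  "f \<in> regular (affine_variety X G) U \<longleftrightarrow>
    (\<forall>x \<in> U. \<exists>V p q. openin (zariski X G) V \<and> x \<in> V \<and> p \<in> polynomial_functions G \<and>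
      q \<in> polynomial_functions G \<and> (\<forall>y \<in> V \<inter> U. q y \<noteq> 0 \<and> f y = p y / q y))"
  by (simp add: affine_variety_def)

text \<open>
  Substituting the rational coordinates into a polynomial on the target gives a quotient \<open>p / q\<close> on \<open>S\<close>
  with \<open>q\<close> nowhere zero there.  Its zeros in \<open>S\<close> are those of \<open>p\<close>, which gives continuity, and
  substituting into a quotient of polynomials gives a quotient again, which gives regularity.
\<close>
lemma rational_imp_morphism_to_component:
  assumes S: "S \<subseteq> X" and i: "i \<in> I"
    and maps: "\<And>x. x \<in> S \<Longrightarrow> \<Phi> x = (i, \<phi> x)" "\<And>x. x \<in> S \<Longrightarrow> \<phi> x \<in> Z i"
    and coords: "\<And>c. c \<in> H i \<Longrightarrow> rational_on G S (\<lambda>x. c (\<phi> x))"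
  shows "variety_morphism (subvariety (affine_variety X G) S)
           (coproduct_variety I (\<lambda>i. affine_variety (Z i) (H i))) \<Phi>"
proof -
  let ?X = "subvariety (affine_variety X G) S"
  let ?Y = "coproduct_variety I (\<lambda>i. affine_variety (Z i) (H i))"
  have zX: "zspace ?X = subtopology (zariski X G) S"
    by (simp add: subvariety_def)
  have topX: "topspace (zspace ?X) = S"
    using S by (auto simp: zX)
  have zY: "zspace ?Y = sum_topology (\<lambda>i. zariski (Z i) (H i)) I"
    by (simp add: coproduct_variety_def)
  have pull: "rational_on G S (\<lambda>x. P (\<phi> x))" if "P \<in> polynomial_functions (H i)" for P
    using that coords by (rule rational_on_polynomial_pullback)
  have preimage: "\<exists>V. openin (zariski X G) V \<and> {x \<in> S. \<phi> x \<in> U} = V \<inter> S"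
    if U: "openin (zariski (Z i) (H i)) U" for U
  proof -
    obtain F where F: "F \<subseteq> polynomial_functions (H i)"
      and U_eq: "U = Z i - {z \<in> Z i. \<forall>p \<in> F. p z = 0}"
      using U unfolding openin_zariski zariski_open_def by blast
    have "\<forall>P \<in> F. \<exists>p. p \<in> polynomial_functions G \<and> (\<forall>x \<in> S. P (\<phi> x) = 0 \<longleftrightarrow> p x = 0)"
    proof
      fix P assume "P \<in> F"
      then have "rational_on G S (\<lambda>x. P (\<phi> x))" using F pull by blast
      then obtain p q where "p \<in> polynomial_functions G"
        "\<forall>x \<in> S. q x \<noteq> 0 \<and> P (\<phi> x) = p x / q x"
        unfolding rational_on_def by blast
      then show "\<exists>p. p \<in> polynomial_functions G \<and> (\<forall>x \<in> S. P (\<phi> x) = 0 \<longleftrightarrow> p x = 0)"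
        by (intro exI[of _ p]) auto
    qed
    then obtain n where n: "\<forall>P \<in> F. n P \<in> polynomial_functions G \<and>
        (\<forall>x \<in> S. P (\<phi> x) = 0 \<longleftrightarrow> n P x = 0)"
      by metis
    let ?V = "X - {x \<in> X. \<forall>p \<in> n ` F. p x = 0}"
    have "openin (zariski X G) ?V"
      unfolding openin_zariski zariski_open_def using n by blast
    moreover have "{x \<in> S. \<phi> x \<in> U} = ?V \<inter> S"
      using S n maps(2) unfolding U_eq by auto
    ultimately show ?thesis by blast
  qed
  have component: "openin (zariski (Z i) (H i)) {z. (i, z) \<in> V}"
    if "openin (zspace ?Y) V" for V
    using that i unfolding zY openin_sum_topology by auto
  have continuous: "continuous_map (zspace ?X) (zspace ?Y) \<Phi>"
    unfolding continuous_map_def topX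
  proof (intro conjI allI impI)
    show "\<Phi> \<in> S \<rightarrow> topspace (zspace ?Y)"
      using maps i by (auto simp: zY topspace_sum_topology)
    fix V assume "openin (zspace ?Y) V"
    from preimage[OF component[OF this]] obtain W where
      "openin (zariski X G) W" "{x \<in> S. \<phi> x \<in> {z. (i, z) \<in> V}} = W \<inter> S" by blast
    moreover have "{x \<in> S. \<Phi> x \<in> V} = {x \<in> S. \<phi> x \<in> {z. (i, z) \<in> V}}"
      using maps(1) by auto
    ultimately show "openin (zspace ?X) {x \<in> S. \<Phi> x \<in> V}"
      unfolding zX openin_subtopology by auto
  qed
  have regular: "g \<circ> \<Phi> \<in> regular ?X {x \<in> S. \<Phi> x \<in> V}"
    if V: "openin (zspace ?Y) V" and g: "g \<in> regular ?Y V" for V g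
  proof -
    have gi: "(\<lambda>z. g (i, z)) \<in> regular (affine_variety (Z i) (H i)) {z. (i, z) \<in> V}"
      using g i by (simp add: coproduct_variety_def)
    have "\<exists>W h. openin (zariski X G) W \<and> x \<in> W \<and> h \<in> regular (affine_variety X G) W \<and>
        (\<forall>y \<in> W \<inter> {x \<in> S. \<Phi> x \<in> V}. (g \<circ> \<Phi>) y = h y)"
      if x: "x \<in> S" "\<Phi> x \<in> V" for x
    proof -
      have "\<phi> x \<in> {z. (i, z) \<in> V}" using x maps(1) by auto
      then obtain N P Q where N: "openin (zariski (Z i) (H i)) N" "\<phi> x \<in> N"
        and P: "P \<in> polynomial_functions (H i)" and Q: "Q \<in> polynomial_functions (H i)"
        and PQ: "\<forall>z \<in> N \<inter> {z. (i, z) \<in> V}. Q z \<noteq> 0 \<and> g (i, z) = P z / Q z"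
        using gi[unfolded regular_affine_variety_iff] by blast
      obtain W where W: "openin (zariski X G) W" "{x \<in> S. \<phi> x \<in> N} = W \<inter> S"
        using preimage[OF N(1)] by blast
      obtain p q where p: "p \<in> polynomial_functions G" and q: "q \<in> polynomial_functions G"
        and pq: "\<And>x. x \<in> S \<Longrightarrow> q x \<noteq> 0 \<and> P (\<phi> x) = p x / q x"
        using pull[OF P] unfolding rational_on_def by blast
      obtain r s where r: "r \<in> polynomial_functions G" and s: "s \<in> polynomial_functions G"
        and rs: "\<And>x. x \<in> S \<Longrightarrow> s x \<noteq> 0 \<and> Q (\<phi> x) = r x / s x"
        using pull[OF Q] unfolding rational_on_def by blast
      define a where "a = (\<lambda>x. p x * s x)"
      define b where "b = (\<lambda>x. q x * r x)"
      have a: "a \<in> polynomial_functions G" and b: "b \<in> polynomial_functions G"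
        unfolding a_def b_def using p q r s by (auto intro: polynomial_functions.mult)
      have on_S: "b y \<noteq> 0 \<and> g (\<Phi> y) = a y / b y" if "y \<in> S" "y \<in> W" "\<Phi> y \<in> V" for y
      proof -
        have "\<phi> y \<in> N" using W(2) that by blast
        then have "Q (\<phi> y) \<noteq> 0 \<and> g (\<Phi> y) = P (\<phi> y) / Q (\<phi> y)"
          using PQ maps(1) that by auto
        then show ?thesis
          using pq[OF that(1)] rs[OF that(1)] by (auto simp: a_def b_def)
      qed
      let ?W = "W \<inter> {y \<in> X. b y \<noteq> 0}"
      have "openin (zariski X G) ?W"
        using W(1) zariski_open_nonvanishing[OF b] by (rule openin_Int)
      moreover have "x \<in> ?W"
        using x S N(2) W(2) on_S by blast
      moreover have "(\<lambda>y. a y / b y) \<in> regular (affine_variety X G) ?W"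
        unfolding regular_affine_variety_iff using \<open>openin (zariski X G) ?W\<close> a b by blast
      ultimately show ?thesis using on_S by (intro exI[of _ ?W] exI[of _ "\<lambda>y. a y / b y"]) auto
    qed
    then show ?thesis
      unfolding subvariety_def by simp
  qed
  show ?thesis
    unfolding variety_morphism_def topX
    by (intro conjI allI impI continuous) (simp add: regular)
qed

text \<open>
  The strata of \<open>F\<close> are the atoms of the Boolean algebra of sets generated by the zero sets of its
  members, except that a stratum may be empty.
\<close>
definition stratum :: "'a set \<Rightarrow> ('a \<Rightarrow> complex) set \<Rightarrow> ('a \<Rightarrow> complex) set \<Rightarrow> 'a set" where
  "stratum X F T = {x \<in> X. {f \<in> F. f x \<noteq> 0} = T}"

lemma strata_partition:
  assumes "finite F"
  shows "finite (stratum X F ` Pow F)" "disjoint (stratum X F ` Pow F)" "\<Union>(stratum X F ` Pow F) = X"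
proof -
  show "finite (stratum X F ` Pow F)" using assms by simp
  have "T = T'" if "stratum X F T \<inter> stratum X F T' \<noteq> {}" for T T'
    using that unfolding stratum_def by blast
  then show "disjoint (stratum X F ` Pow F)"
    by (intro disjointI) auto
  have "x \<in> stratum X F {f \<in> F. f x \<noteq> 0}" if "x \<in> X" for x
    using that by (simp add: stratum_def)
  then show "\<Union>(stratum X F ` Pow F) = X"
    by (intro equalityI subsetI UN_I[of "{f \<in> F. f _ \<noteq> 0}"]) (auto simp: stratum_def)
qed

text \<open>
  That no member of the finite set \<open>T\<close> vanishes at a point is an open condition on the point, since it says
  that their product does not vanish there.
\<close>
lemma locally_closedin_stratum:
  assumes "finite F" "F \<subseteq> polynomial_functions G" "T \<subseteq> F"
  shows "locally_closedin (zariski X G) (stratum X F T)"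
proof -
  have "finite T" using assms finite_subset by blast
  have "openin (zariski X G) {x \<in> X. (\<Prod>f\<in>T. f x) \<noteq> 0}"
    using assms by (intro zariski_open_nonvanishing polynomial_functions_prod) auto
  moreover have "closedin (zariski X G) {x \<in> X. \<forall>f \<in> F - T. f x = 0}"
    using assms by (intro zariski_closed_vanishing) auto
  moreover have "stratum X F T = {x \<in> X. (\<Prod>f\<in>T. f x) \<noteq> 0} \<inter> {x \<in> X. \<forall>f \<in> F - T. f x = 0}"
    using \<open>finite T\<close> assms(3) unfolding stratum_def by auto
  ultimately show ?thesis unfolding locally_closedin_def by blast
qed

section \<open>Splitting the cokernel of a matrix of polynomials\<close>

text \<open>
  The matrix \<open>P\<close> of the exchange argument.  A pattern \<open>h\<close> sends the index of a column to a number below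
  \<open>n + m\<close>: numbers below \<open>n\<close> name a column of \<open>A\<close>, and \<open>n + i\<close> names the \<open>i\<close>-th standard unit vector.
\<close>
definition exchange_mat :: "nat \<Rightarrow> nat \<Rightarrow> (nat \<Rightarrow> nat) \<Rightarrow> complex mat \<Rightarrow> complex mat" where
  "exchange_mat m n h A =
     mat m m (\<lambda>(i, j). if h j < n then A $$ (i, h j) else if i = h j - n then 1 else 0)"

lemma exchange_mat_carrier [simp]: "exchange_mat m n h A \<in> carrier_mat m m"
  by (simp add: exchange_mat_def)

text \<open>
  The sum is an entry of \<open>adj P * A\<close>.  That it vanishes in the rows of the unit vectors means that the
  columns of \<open>A\<close> are combinations of the columns of \<open>P\<close> taken from \<open>A\<close>; the denominator \<open>det P\<close> is left
  out in order to have polynomial conditions.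
\<close>
definition exchange_complete :: "nat \<Rightarrow> nat \<Rightarrow> (nat \<Rightarrow> nat) \<Rightarrow> complex mat \<Rightarrow> bool" where
  "exchange_complete m n h A \<longleftrightarrow> det (exchange_mat m n h A) \<noteq> 0 \<and>
     (\<forall>j<m. n \<le> h j \<longrightarrow> (\<forall>c<n. (\<Sum>k<m. adj_mat (exchange_mat m n h A) $$ (j, k) * A $$ (k, c)) = 0))"

lemma mult_mat_index_sum:
  assumes "A \<in> carrier_mat p q" "B \<in> carrier_mat q r" "i < p" "j < r"
  shows "(A * B) $$ (i, j) = (\<Sum>k<q. A $$ (i, k) * B $$ (k, j))"
  using assms by (auto simp: scalar_prod_def atLeast0LessThan intro!: sum.cong)

lemma mult_mat_vec_index_sum:
  assumes "A \<in> carrier_mat p q" "v \<in> carrier_vec q" "i < p"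
  shows "(A *\<^sub>v v) $ i = (\<Sum>k<q. A $$ (i, k) * v $ k)"
  using assms by (auto simp: scalar_prod_def atLeast0LessThan intro!: sum.cong)

text \<open>
  Cramer's rule without its coordinates.
\<close>
lemma adj_mat_solves:
  fixes P :: "complex mat"
  assumes P: "P \<in> carrier_mat m m" and v: "v \<in> carrier_vec m" and det: "det P \<noteq> 0"
  shows "P *\<^sub>v ((1 / det P) \<cdot>\<^sub>v (adj_mat P *\<^sub>v v)) = v"
proof -
  have adj: "adj_mat P \<in> carrier_mat m m" using adj_mat(1)[OF P] .
  have "P *\<^sub>v (adj_mat P *\<^sub>v v) = (P * adj_mat P) *\<^sub>v v"
    using assoc_mult_mat_vec[OF P adj v] by simp
  also have "\<dots> = det P \<cdot>\<^sub>v v"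
    unfolding adj_mat(2)[OF P] using v by (intro eq_vecI) auto
  finally show ?thesis
    using mult_mat_vec[OF P mult_mat_vec_carrier[OF adj v]] det by (simp add: smult_smult_assoc)
qed

text \<open>
  Among the patterns with \<open>det P \<noteq> 0\<close> (the identity matrix is one) take one that uses as many columns of
  \<open>A\<close> as possible.  If an entry of \<open>adj P * A\<close> in the row of a unit vector were nonzero, then by Cramer's rule
  replacing this unit vector by the corresponding column of \<open>A\<close> would keep the determinant nonzero,
  against maximality.
\<close>
lemma exchange_complete_exists:
  assumes A: "A \<in> carrier_mat m n"
  shows "\<exists>h \<in> {..<m} \<rightarrow>\<^sub>E {..<n + m}. exchange_complete m n h A"
proof -
  let ?P = "\<lambda>h. exchange_mat m n h A"
  let ?J = "\<lambda>h. {j. j < m \<and> h j < n}"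
  define H where "H = {h \<in> {..<m} \<rightarrow>\<^sub>E {..<n + m}. det (?P h) \<noteq> 0}"
  have "?P (\<lambda>j \<in> {..<m}. n + j) = 1\<^sub>m m"
    by (rule eq_matI) (auto simp: exchange_mat_def)
  then have "(\<lambda>j \<in> {..<m}. n + j) \<in> H"
    by (auto simp: H_def)
  moreover have "finite H"
    unfolding H_def by (simp add: finite_PiE)
  ultimately have "Max ((\<lambda>h. card (?J h)) ` H) \<in> (\<lambda>h. card (?J h)) ` H"
    by (intro Max_in) auto
  then obtain h where h: "h \<in> H" and h_Max: "card (?J h) = Max ((\<lambda>h. card (?J h)) ` H)"
    by auto
  have h_max: "card (?J h') \<le> card (?J h)" if "h' \<in> H" for h'
    unfolding h_Max using \<open>finite H\<close> that by (intro Max_ge) auto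
  have P: "?P h \<in> carrier_mat m m" by simp
  have det: "det (?P h) \<noteq> 0" using h by (simp add: H_def)
  have "(\<Sum>k<m. adj_mat (?P h) $$ (j, k) * A $$ (k, c)) = 0"
    if j: "j < m" "n \<le> h j" and c: "c < n" for j c
  proof (rule ccontr)
    assume nz: "(\<Sum>k<m. adj_mat (?P h) $$ (j, k) * A $$ (k, c)) \<noteq> 0"
    let ?h = "h(j := c)"
    let ?x = "(1 / det (?P h)) \<cdot>\<^sub>v (adj_mat (?P h) *\<^sub>v col A c)"
    have adj: "adj_mat (?P h) \<in> carrier_mat m m" using adj_mat(1)[OF P] .
    have colA: "col A c \<in> carrier_vec m" using A c by simp
    have x: "?x \<in> carrier_vec m" using adj colA by simp
    \<comment> \<open>The coordinates of the new column with respect to the columns of \<open>P\<close>.\<close>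
    have Px: "?P h *\<^sub>v ?x = col A c"
      by (rule adj_mat_solves[OF P colA det])
    have "?P ?h = replace_col (?P h) (col A c) j"
      using A c j by (intro eq_matI) (auto simp: exchange_mat_def replace_col_def)
    then have "det (?P ?h) = ?x $ j * det (?P h)"
      using cramer_lemma_mat[OF P x j(1)] Px by simp
    also have "\<dots> = (adj_mat (?P h) *\<^sub>v col A c) $ j"
      using det j adj by simp
    also have "\<dots> = (\<Sum>k<m. adj_mat (?P h) $$ (j, k) * A $$ (k, c))"
      using A c by (subst mult_mat_vec_index_sum[OF adj colA j(1)]) (auto intro!: sum.cong)
    finally have "det (?P ?h) \<noteq> 0" using nz by simp
    moreover have "?h \<in> {..<m} \<rightarrow>\<^sub>E {..<n + m}"
      using h j c by (auto simp: H_def PiE_def extensional_def)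
    ultimately have "?h \<in> H"
      unfolding H_def mem_Collect_eq by (intro conjI)
    then have "card (?J ?h) \<le> card (?J h)" by (rule h_max)
    moreover have "j \<in> ?J ?h - ?J h" "?J h \<subseteq> ?J ?h"
      using j c by auto
    then have "?J h \<subset> ?J ?h" by blast
    then have "card (?J h) < card (?J ?h)"
      by (intro psubset_card_mono) auto
    ultimately show False by simp
  qed
  then have "exchange_complete m n h A"
    using det by (simp add: exchange_complete_def)
  moreover have "h \<in> {..<m} \<rightarrow>\<^sub>E {..<n + m}"
    using h by (simp add: H_def)
  ultimately show ?thesis by (rule bexI)
qed

text \<open>
  Besides saying that \<open>C\<close> is a cokernel of \<open>A\<close> with right inverse \<open>E\<close>, this records the homotopy \<open>U\<close> that
  witnesses exactness.  Being equational, the relations can be transposed: then they say that \<open>C\<^sup>T\<close> is a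
  kernel of \<open>A\<^sup>T\<close> with left inverse \<open>E\<^sup>T\<close>.
\<close>
definition split_cokernel :: "complex mat \<Rightarrow> complex mat \<Rightarrow> complex mat \<Rightarrow> bool" where
  "split_cokernel A C E \<longleftrightarrow> dim_col C = dim_row A \<and> E \<in> carrier_mat (dim_row A) (dim_row C) \<and>
     C * E = 1\<^sub>m (dim_row C) \<and> C * A = 0\<^sub>m (dim_row C) (dim_col A) \<and>
     (\<exists>U \<in> carrier_mat (dim_col A) (dim_row A). E * C + A * U = 1\<^sub>m (dim_row A))"

lemma split_cokernelD:
  assumes "split_cokernel A C E" "A \<in> carrier_mat m n"
  shows "C \<in> carrier_mat (dim_row C) m" "E \<in> carrier_mat m (dim_row C)"
    "C * E = 1\<^sub>m (dim_row C)" "C * A = 0\<^sub>m (dim_row C) n"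
    "\<exists>U \<in> carrier_mat n m. E * C + A * U = 1\<^sub>m m"
  using assms by (auto simp: split_cokernel_def)

definition unit_slots :: "nat \<Rightarrow> nat \<Rightarrow> (nat \<Rightarrow> nat) \<Rightarrow> nat list" where
  "unit_slots m n h = sorted_list_of_set {j. j < m \<and> n \<le> h j}"

lemma set_unit_slots: "set (unit_slots m n h) = {j. j < m \<and> n \<le> h j}"
  by (simp add: unit_slots_def)

lemma distinct_unit_slots: "distinct (unit_slots m n h)"
  by (simp add: unit_slots_def)

lemma length_unit_slots: "length (unit_slots m n h) \<le> m"
proof -
  have "card {j. j < m \<and> n \<le> h j} \<le> card {..<m}"
    by (rule card_mono) auto
  then show ?thesis by (simp add: unit_slots_def)
qed

definition coker_mat :: "nat \<Rightarrow> nat \<Rightarrow> (nat \<Rightarrow> nat) \<Rightarrow> complex mat \<Rightarrow> complex mat" where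
  "coker_mat m n h A = mat (length (unit_slots m n h)) m
     (\<lambda>(i, k). adj_mat (exchange_mat m n h A) $$ (unit_slots m n h ! i, k) /
        det (exchange_mat m n h A))"

definition coker_section :: "nat \<Rightarrow> nat \<Rightarrow> (nat \<Rightarrow> nat) \<Rightarrow> complex mat" where
  "coker_section m n h = mat m (length (unit_slots m n h))
     (\<lambda>(k, i). if k = h (unit_slots m n h ! i) - n then 1 else 0)"

text \<open>
  Let \<open>Q\<close> be the inverse of \<open>P\<close>.  Splitting the sum \<open>1 = P * Q\<close> over the columns of \<open>P\<close> into those that are
  unit vectors and those that come from \<open>A\<close> gives \<open>E * C + A * U\<close>, while \<open>C * E = 1\<close> is part of
  \<open>Q * P = 1\<close> and \<open>C * A = 0\<close> is the completeness of the pattern.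
\<close>
lemma exchange_complete_imp_split_cokernel:
  assumes A: "A \<in> carrier_mat m n" and h: "h \<in> {..<m} \<rightarrow>\<^sub>E {..<n + m}"
    and complete: "exchange_complete m n h A"
  shows "split_cokernel A (coker_mat m n h A) (coker_section m n h)"
proof -
  let ?C = "coker_mat m n h A" and ?E = "coker_section m n h"
  define P where "P = exchange_mat m n h A"
  define e where "e = (\<lambda>i. unit_slots m n h ! i)"
  define d where "d = length (unit_slots m n h)"
  have P: "P \<in> carrier_mat m m" by (simp add: P_def)
  have adj: "adj_mat P \<in> carrier_mat m m" using adj_mat(1)[OF P] .
  have det: "det P \<noteq> 0" using complete by (simp add: exchange_complete_def P_def)
  have e: "e i < m" "n \<le> h (e i)" if "i < d" for i
    using nth_mem[of i "unit_slots m n h"] that by (auto simp: set_unit_slots e_def d_def)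
  have e_inj: "e i = e i' \<longleftrightarrow> i = i'" if "i < d" "i' < d" for i i'
    using that nth_eq_iff_index_eq[OF distinct_unit_slots] by (simp add: e_def d_def)
  have C: "?C \<in> carrier_mat d m" and E: "?E \<in> carrier_mat m d"
    by (simp_all add: coker_mat_def coker_section_def d_def)
  have C_index: "?C $$ (i, k) = adj_mat P $$ (e i, k) / det P" if "i < d" "k < m" for i k
    using that by (simp add: coker_mat_def d_def P_def e_def)
  have E_index: "?E $$ (k, i) = P $$ (k, e i)" if "i < d" "k < m" for i k
    using that e[OF that(1)]
    by (simp add: coker_section_def d_def P_def e_def exchange_mat_def)
  have CE: "?C * ?E = 1\<^sub>m d"
  proof (rule eq_matI)
    fix i i' assume "i < dim_row (1\<^sub>m d :: complex mat)" "i' < dim_col (1\<^sub>m d :: complex mat)"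
    then have i: "i < d" and i': "i' < d" by auto
    have "(?C * ?E) $$ (i, i') = (\<Sum>k<m. adj_mat P $$ (e i, k) / det P * P $$ (k, e i'))"
      using i i' by (subst mult_mat_index_sum[OF C E]) (simp_all add: C_index E_index)
    also have "\<dots> = (adj_mat P * P) $$ (e i, e i') / det P"
      using e i i' by (subst mult_mat_index_sum[OF adj P]) (simp_all add: sum_divide_distrib)
    also have "\<dots> = 1\<^sub>m d $$ (i, i')"
      using adj_mat(3)[OF P] det i i' e e_inj[OF i i'] by simp
    finally show "(?C * ?E) $$ (i, i') = 1\<^sub>m d $$ (i, i')" .
  qed (use C E in auto)
  have CA: "?C * A = 0\<^sub>m d n"
  proof (rule eq_matI)
    fix i c assume "i < dim_row (0\<^sub>m d n :: complex mat)" "c < dim_col (0\<^sub>m d n :: complex mat)"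
    then have i: "i < d" and c: "c < n" by auto
    have "(?C * A) $$ (i, c) = (\<Sum>k<m. adj_mat P $$ (e i, k) * A $$ (k, c)) / det P"
      using i c by (subst mult_mat_index_sum[OF C A]) (simp_all add: C_index sum_divide_distrib)
    also have "\<dots> = 0"
      using complete e[OF i] c by (simp add: exchange_complete_def P_def)
    finally show "(?C * A) $$ (i, c) = 0\<^sub>m d n $$ (i, c)" using i c by simp
  qed (use C A in auto)
  define U where "U = mat n m (\<lambda>(c, k). \<Sum>j | j < m \<and> h j = c. adj_mat P $$ (j, k) / det P)"
  have U: "U \<in> carrier_mat n m" by (simp add: U_def)
  have "?E * ?C + A * U = 1\<^sub>m m"
  proof (rule eq_matI)
    fix i k assume "i < dim_row (1\<^sub>m m :: complex mat)" "k < dim_col (1\<^sub>m m :: complex mat)"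
    then have i: "i < m" and k: "k < m" by auto
    let ?t = "\<lambda>j. P $$ (i, j) * (adj_mat P $$ (j, k) / det P)"
    have "(?E * ?C) $$ (i, k) = (\<Sum>i'<d. ?t (e i'))"
      using i k by (subst mult_mat_index_sum[OF E C]) (simp_all add: C_index E_index)
    also have "\<dots> = (\<Sum>j | j < m \<and> \<not> h j < n. ?t j)"
    proof (rule sum.reindex_bij_betw)
      show "bij_betw e {..<d} {j. j < m \<and> \<not> h j < n}"
        using bij_betw_nth[OF distinct_unit_slots refl refl, of m n h]
        by (simp add: e_def d_def set_unit_slots not_less)
    qed
    finally have EC: "(?E * ?C) $$ (i, k) = (\<Sum>j | j < m \<and> \<not> h j < n. ?t j)" .
    have "(A * U) $$ (i, k) =
        (\<Sum>c<n. \<Sum>j \<in> {j \<in> {j. j < m \<and> h j < n}. h j = c}. ?t j)"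
      using i k by (subst mult_mat_index_sum[OF A U])
        (auto simp: U_def P_def exchange_mat_def sum_distrib_left intro!: sum.cong)
    also have "\<dots> = (\<Sum>j | j < m \<and> h j < n. ?t j)"
      by (intro sum.group) auto
    finally have "(?E * ?C + A * U) $$ (i, k) =
        (\<Sum>j | j < m \<and> h j < n. ?t j) + (\<Sum>j | j < m \<and> \<not> h j < n. ?t j)"
      using i k E C A U EC by simp
    also have "\<dots> = (\<Sum>j<m. ?t j)"
      by (subst sum.union_disjoint[symmetric]) (auto intro!: sum.cong)
    also have "\<dots> = (P * adj_mat P) $$ (i, k) / det P"
      using i k by (subst mult_mat_index_sum[OF P adj]) (simp_all add: sum_divide_distrib)
    also have "\<dots> = 1\<^sub>m m $$ (i, k)"
      using adj_mat(2)[OF P] det i k by simp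
    finally show "(?E * ?C + A * U) $$ (i, k) = 1\<^sub>m m $$ (i, k)" .
  qed (use E C A U in auto)
  then show ?thesis
    unfolding split_cokernel_def using A C E CE CA U by auto
qed

lemma polynomial_functions_det:
  assumes "\<And>x. M x \<in> carrier_mat k k"
    and "\<And>i j. i < k \<Longrightarrow> j < k \<Longrightarrow> (\<lambda>x. M x $$ (i, j)) \<in> polynomial_functions G"
  shows "(\<lambda>x. det (M x)) \<in> polynomial_functions G"
proof -
  have "(\<lambda>x. \<Sum>p | p permutes {0..<k}. signof p * (\<Prod>i\<in>{0..<k}. M x $$ (i, p i)))
      \<in> polynomial_functions G"
    by (intro polynomial_functions_sum polynomial_functions.mult polynomial_functions.const
        polynomial_functions_prod assms(2)) (auto simp: permutes_in_image)
  then show ?thesis by (simp add: det_def'[OF assms(1)])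
qed

lemma polynomial_functions_adj_mat:
  assumes M: "\<And>x. M x \<in> carrier_mat k k"
    and entries: "\<And>i j. i < k \<Longrightarrow> j < k \<Longrightarrow> (\<lambda>x. M x $$ (i, j)) \<in> polynomial_functions G"
    and ij: "i < k" "j < k"
  shows "(\<lambda>x. adj_mat (M x) $$ (i, j)) \<in> polynomial_functions G"
proof -
  have dims: "dim_row (M x) = k" "dim_col (M x) = k" for x using M[of x] by auto
  have "(\<lambda>x. mat_delete (M x) j i $$ (a, b)) \<in> polynomial_functions G"
    if "a < k - 1" "b < k - 1" for a b
    using that dims by (simp add: mat_delete_def) (intro conjI impI entries; simp)
  then have "(\<lambda>x. det (mat_delete (M x) j i)) \<in> polynomial_functions G"
    using M by (intro polynomial_functions_det[of _ "k - 1"] mat_delete_carrier) auto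
  then have "(\<lambda>x. (-1) ^ (j + i) * det (mat_delete (M x) j i)) \<in> polynomial_functions G"
    by (intro polynomial_functions.mult polynomial_functions.const)
  then show ?thesis
    using ij by (simp add: adj_mat_def dims cofactor_def)
qed

text \<open>
  Whether a pattern is complete for \<open>A x\<close> depends only on the vanishing at \<open>x\<close> of finitely many
  polynomials, so the pattern can be chosen as a function of the stratum.  The size of \<open>C\<close> and the matrix
  \<open>E\<close> depend on the pattern alone, and only the entries of \<open>C\<close> vary, as cofactors of \<open>P\<close> over \<open>det P\<close>.
\<close>
lemma constructible_split_cokernel:
  fixes A :: "'a \<Rightarrow> complex mat"
  assumes A: "\<And>x. x \<in> X \<Longrightarrow> A x \<in> carrier_mat m n"
    and entries: "\<And>i j. i < m \<Longrightarrow> j < n \<Longrightarrow> (\<lambda>x. A x $$ (i, j)) \<in> polynomial_functions G"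
  obtains \<S> C E where
    "finite \<S>" "disjoint \<S>" "\<Union>\<S> = X" "\<And>S. S \<in> \<S> \<Longrightarrow> locally_closedin (zariski X G) S"
    "\<And>x. x \<in> X \<Longrightarrow> split_cokernel (A x) (C x) (E x)" "\<And>x. x \<in> X \<Longrightarrow> dim_row (C x) \<le> m"
    "\<And>S x y. S \<in> \<S> \<Longrightarrow> x \<in> S \<Longrightarrow> y \<in> S \<Longrightarrow> dim_row (C x) = dim_row (C y) \<and> E x = E y"
    "\<And>S x i j. S \<in> \<S> \<Longrightarrow> x \<in> S \<Longrightarrow> i < dim_row (C x) \<Longrightarrow> j < m \<Longrightarrow>
       rational_on G S (\<lambda>y. C y $$ (i, j))"
proof -
  let ?P = "\<lambda>h x. exchange_mat m n h (A x)"
  define H where "H = {..<m} \<rightarrow>\<^sub>E {..<n + m}"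
  define \<delta> where "\<delta> = (\<lambda>h x. det (?P h x))"
  define \<epsilon> where "\<epsilon> = (\<lambda>h j c x. \<Sum>k<m. adj_mat (?P h x) $$ (j, k) * A x $$ (k, c))"
  define F where "F = \<delta> ` H \<union> (\<lambda>(h, j, c). \<epsilon> h j c) ` (H \<times> {..<m} \<times> {..<n})"
  have "finite H" by (simp add: H_def finite_PiE)
  then have F_finite: "finite F" by (simp add: F_def)
  have P_poly: "(\<lambda>x. ?P h x $$ (i, j)) \<in> polynomial_functions G" if "i < m" "j < m" for h i j
    using that entries
    by (cases "h j < n") (auto simp: exchange_mat_def intro: polynomial_functions.const)
  have \<delta>_poly: "\<delta> h \<in> polynomial_functions G" for h
    unfolding \<delta>_def by (rule polynomial_functions_det[of _ m]) (auto intro: P_poly)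
  have adj_poly: "(\<lambda>x. adj_mat (?P h x) $$ (i, j)) \<in> polynomial_functions G"
    if "i < m" "j < m" for h i j
    using that by (intro polynomial_functions_adj_mat[of _ m]) (auto intro: P_poly)
  have \<epsilon>_poly: "\<epsilon> h j c \<in> polynomial_functions G" if "j < m" "c < n" for h j c
    unfolding \<epsilon>_def using that
    by (intro polynomial_functions_sum polynomial_functions.mult adj_poly entries) auto
  have F_poly: "F \<subseteq> polynomial_functions G"
    using \<delta>_poly \<epsilon>_poly by (auto simp: F_def)
  define \<tau> where "\<tau> = (\<lambda>x. {f \<in> F. f x \<noteq> 0})"
  define good where "good = (\<lambda>h T. h \<in> H \<and> \<delta> h \<in> T \<and> (\<forall>j<m. n \<le> h j \<longrightarrow> (\<forall>c<n. \<epsilon> h j c \<notin> T)))"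
  have good_iff: "good h (\<tau> x) \<longleftrightarrow> h \<in> H \<and> exchange_complete m n h (A x)" for h x
  proof (cases "h \<in> H")
    case True
    then have "\<delta> h \<in> F" "\<And>j c. j < m \<Longrightarrow> c < n \<Longrightarrow> \<epsilon> h j c \<in> F"
      unfolding F_def by force+
    then show ?thesis
      using True by (simp add: good_def \<tau>_def exchange_complete_def flip: \<delta>_def \<epsilon>_def)
        (simp add: \<delta>_def \<epsilon>_def)
  qed (simp add: good_def)
  define \<eta> where "\<eta> = (\<lambda>x. SOME h. good h (\<tau> x))"
  have \<eta>: "\<eta> x \<in> H" "exchange_complete m n (\<eta> x) (A x)" if "x \<in> X" for x
  proof -
    have "\<exists>h. good h (\<tau> x)"
      using exchange_complete_exists[OF A[OF that]] good_iff unfolding H_def by blast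
    then have "good (\<eta> x) (\<tau> x)" unfolding \<eta>_def by (rule someI_ex)
    then show "\<eta> x \<in> H" "exchange_complete m n (\<eta> x) (A x)" by (simp_all add: good_iff)
  qed
  have \<eta>_const: "\<eta> x = \<eta> y" if "S \<in> stratum X F ` Pow F" "x \<in> S" "y \<in> S" for S x y
    using that by (auto simp: \<eta>_def \<tau>_def stratum_def)
  have in_X: "x \<in> X" if "S \<in> stratum X F ` Pow F" "x \<in> S" for S x
    using that by (auto simp: stratum_def)
  have dim_C: "dim_row (coker_mat m n h B) = length (unit_slots m n h)" for h B
    by (simp add: coker_mat_def)
  show thesis
  proof (rule that[of "stratum X F ` Pow F" "\<lambda>x. coker_mat m n (\<eta> x) (A x)"
        "\<lambda>x. coker_section m n (\<eta> x)"])
    show "finite (stratum X F ` Pow F)" "disjoint (stratum X F ` Pow F)" "\<Union>(stratum X F ` Pow F) = X"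
      using strata_partition[OF F_finite] by auto
    show "locally_closedin (zariski X G) S" if "S \<in> stratum X F ` Pow F" for S
      using that locally_closedin_stratum[OF F_finite F_poly] by auto
    show "split_cokernel (A x) (coker_mat m n (\<eta> x) (A x)) (coker_section m n (\<eta> x))"
      if "x \<in> X" for x
      using \<eta>[OF that] A[OF that] by (intro exchange_complete_imp_split_cokernel) (auto simp: H_def)
    show "dim_row (coker_mat m n (\<eta> x) (A x)) \<le> m" if "x \<in> X" for x
      by (simp add: dim_C length_unit_slots)
    show "dim_row (coker_mat m n (\<eta> x) (A x)) = dim_row (coker_mat m n (\<eta> y) (A y)) \<and>
        coker_section m n (\<eta> x) = coker_section m n (\<eta> y)"
      if "S \<in> stratum X F ` Pow F" "x \<in> S" "y \<in> S" for S x y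
      using \<eta>_const[OF that] by (simp add: dim_C)
    show "rational_on G S (\<lambda>y. coker_mat m n (\<eta> y) (A y) $$ (i, j))"
      if S: "S \<in> stratum X F ` Pow F" "x \<in> S" and i: "i < dim_row (coker_mat m n (\<eta> x) (A x))"
        and j: "j < m" for S x i j
      unfolding rational_on_def
    proof (rule bexI[of _ "\<lambda>y. adj_mat (?P (\<eta> x) y) $$ (unit_slots m n (\<eta> x) ! i, j)"],
        rule bexI[of _ "\<delta> (\<eta> x)"], rule ballI)
      let ?s = "unit_slots m n (\<eta> x) ! i"
      have "?s \<in> set (unit_slots m n (\<eta> x))" using i by (simp add: dim_C)
      then have "?s < m" by (simp add: set_unit_slots)
      then show "(\<lambda>y. adj_mat (?P (\<eta> x) y) $$ (?s, j)) \<in> polynomial_functions G"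
        using j by (rule adj_poly)
      show "\<delta> (\<eta> x) \<in> polynomial_functions G" by (rule \<delta>_poly)
      fix y assume y: "y \<in> S"
      have "\<eta> y = \<eta> x" using \<eta>_const[OF S(1) y S(2)] .
      then show "\<delta> (\<eta> x) y \<noteq> 0 \<and> coker_mat m n (\<eta> y) (A y) $$ (i, j) =
          adj_mat (?P (\<eta> x) y) $$ (?s, j) / \<delta> (\<eta> x) y"
        using \<eta>(2)[OF in_X[OF S(1) y]] i j
        by (auto simp: exchange_complete_def \<delta>_def coker_mat_def)
    qed
  qed
qed

section \<open>Linear maps in coordinates\<close>

abbreviation linear_maps where
  "linear_maps V W \<equiv> LinearCombinations.module_hom class_ring V W"

abbreviation column_space :: "nat \<Rightarrow> (complex, complex vec) module" where
  "column_space n \<equiv> module_vec TYPE(complex) n"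

lemma linear_maps_iff:
  "f \<in> linear_maps V W \<longleftrightarrow> (\<forall>v \<in> carrier V. f v \<in> carrier W) \<and>
     (\<forall>v \<in> carrier V. \<forall>w \<in> carrier V. f (v \<oplus>\<^bsub>V\<^esub> w) = f v \<oplus>\<^bsub>W\<^esub> f w) \<and>
     (\<forall>c. \<forall>v \<in> carrier V. f (c \<odot>\<^bsub>V\<^esub> v) = c \<odot>\<^bsub>W\<^esub> f v)"
  by (auto simp: LinearCombinations.module_hom_def)

lemma mat_eq_on_vecI:
  fixes A A' :: "complex mat"
  assumes A: "A \<in> carrier_mat p q" and A': "A' \<in> carrier_mat p q"
    and eq: "\<And>v. v \<in> carrier_vec q \<Longrightarrow> A *\<^sub>v v = A' *\<^sub>v v"
  shows "A = A'"
proof (rule eq_matI)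
  fix i j assume "i < dim_row A'" "j < dim_col A'"
  then have ij: "i < p" "j < q" using A' by auto
  have "(C *\<^sub>v unit_vec q j) $ i = C $$ (i, j)" if "C \<in> carrier_mat p q" for C :: "complex mat"
    using that ij by simp
  then show "A $$ (i, j) = A' $$ (i, j)"
    using eq[of "unit_vec q j"] A A' by (metis unit_vec_carrier)
qed (use A A' in auto)

text \<open>
  Induction on the number of leading coordinates outside of which the vector vanishes.
\<close>
lemma linear_on_columns_eq_mat:
  fixes f :: "complex vec \<Rightarrow> complex vec"
  assumes f: "f \<in> linear_maps (column_space n) (column_space m)" and v: "v \<in> carrier_vec n"
  shows "f v = mat m n (\<lambda>(i, j). f (unit_vec n j) $ i) *\<^sub>v v"
proof -
  let ?A = "mat m n (\<lambda>(i, j). f (unit_vec n j) $ i)"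
  have closed: "f v \<in> carrier_vec m" and add: "f (v + w) = f v + f w"
    and smult: "f (c \<cdot>\<^sub>v v) = c \<cdot>\<^sub>v f v"
    if "v \<in> carrier_vec n" "w \<in> carrier_vec n" for v w c
    using f that by (auto simp: linear_maps_iff module_vec_simps)
  have A: "?A \<in> carrier_mat m n" by simp
  have unit: "f (unit_vec n j) = ?A *\<^sub>v unit_vec n j" if "j < n" for j
    using that closed[OF unit_vec_carrier unit_vec_carrier] by (intro eq_vecI) auto
  have "f v = ?A *\<^sub>v v" if "v \<in> carrier_vec n" "k \<le> n" "\<And>i. k \<le> i \<Longrightarrow> i < n \<Longrightarrow> v $ i = 0" for k v
    using that
  proof (induction k arbitrary: v)
    case 0
    then have v: "v = 0 \<cdot>\<^sub>v v" by (intro eq_vecI) auto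
    have "f v = 0 \<cdot>\<^sub>v f v" "?A *\<^sub>v v = 0 \<cdot>\<^sub>v (?A *\<^sub>v v)"
      by (subst v, rule smult, use 0 in auto) (subst v, rule mult_mat_vec[OF A], use 0 in auto)
    moreover have "0 \<cdot>\<^sub>v f v = 0 \<cdot>\<^sub>v (?A *\<^sub>v v)"
      using closed[of v v] 0(1) by (intro eq_vecI) auto
    ultimately show ?case by metis
  next
    case (Suc k)
    define w where "w = vec n (\<lambda>i. if i = k then 0 else v $ i)"
    have w: "w \<in> carrier_vec n" by (simp add: w_def)
    have e: "v $ k \<cdot>\<^sub>v unit_vec n k \<in> carrier_vec n" by simp
    have v: "v = w + v $ k \<cdot>\<^sub>v unit_vec n k"
      using Suc.prems by (intro eq_vecI) (auto simp: w_def)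
    have "f w = ?A *\<^sub>v w"
      using Suc.prems by (intro Suc.IH) (auto simp: w_def)
    moreover have "f (v $ k \<cdot>\<^sub>v unit_vec n k) = ?A *\<^sub>v (v $ k \<cdot>\<^sub>v unit_vec n k)"
      using unit[of k] Suc.prems mult_mat_vec[OF A unit_vec_carrier]
        smult[OF unit_vec_carrier unit_vec_carrier] by simp
    ultimately have "f (w + v $ k \<cdot>\<^sub>v unit_vec n k) = ?A *\<^sub>v (w + v $ k \<cdot>\<^sub>v unit_vec n k)"
      using add[OF w e] mult_add_distrib_mat_vec[OF A w e] by simp
    then show ?case using v by simp
  qed
  from this[of v n] v show ?thesis by simp
qed

lemma linear_map_zero:
  fixes V :: "('b, 'x) rmodule"
  assumes V: "vectorspace class_ring V" and f: "f \<in> linear_maps V (column_space n)"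
  shows "f \<zero>\<^bsub>V\<^esub> = 0\<^sub>v n"
proof -
  interpret V: vectorspace class_ring V by (rule V)
  have closed: "f \<zero>\<^bsub>V\<^esub> \<in> carrier_vec n"
    and smult: "f (0 \<odot>\<^bsub>V\<^esub> \<zero>\<^bsub>V\<^esub>) = 0 \<cdot>\<^sub>v f \<zero>\<^bsub>V\<^esub>"
    using f V.zero_closed unfolding linear_maps_iff module_vec_simps by blast+
  have "0 \<odot>\<^bsub>V\<^esub> \<zero>\<^bsub>V\<^esub> = \<zero>\<^bsub>V\<^esub>"
    using V.smult_l_null[of "\<zero>\<^bsub>V\<^esub>"] by simp
  then have "f \<zero>\<^bsub>V\<^esub> = 0 \<cdot>\<^sub>v f \<zero>\<^bsub>V\<^esub>" using smult by simp
  also have "\<dots> = 0\<^sub>v n" using closed by (intro eq_vecI) auto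
  finally show ?thesis .
qed

lemma inverse_linear_map:
  assumes "vectorspace class_ring V" "f \<in> linear_maps V W" "bij_betw f (carrier V) (carrier W)"
  shows "inv_into (carrier V) f \<in> linear_maps W V"
proof -
  interpret V: vectorspace class_ring V by (rule assms(1))
  let ?g = "inv_into (carrier V) f"
  have f: "f v \<in> carrier W" "f (v \<oplus>\<^bsub>V\<^esub> w) = f v \<oplus>\<^bsub>W\<^esub> f w" "f (c \<odot>\<^bsub>V\<^esub> v) = c \<odot>\<^bsub>W\<^esub> f v"
    if "v \<in> carrier V" "w \<in> carrier V" for v w c
    using assms(2) that by (auto simp: linear_maps_iff)
  have gf: "?g (f v) = v" if "v \<in> carrier V" for v
    using assms(3) that by (simp add: bij_betw_inv_into_left)
  have W: "\<exists>v \<in> carrier V. w = f v" if "w \<in> carrier W" for w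
    using assms(3) that by (auto simp: bij_betw_def)
  show ?thesis
    unfolding linear_maps_iff
  proof (intro conjI ballI allI)
    fix w assume "w \<in> carrier W"
    then obtain v where v: "v \<in> carrier V" "w = f v" using W by blast
    then show "?g w \<in> carrier V" by (simp add: gf)
    fix c show "?g (c \<odot>\<^bsub>W\<^esub> w) = c \<odot>\<^bsub>V\<^esub> ?g w"
      using v gf[of "c \<odot>\<^bsub>V\<^esub> v"] by (simp add: gf f)
  next
    fix w w' assume "w \<in> carrier W" "w' \<in> carrier W"
    then obtain v v' where v: "v \<in> carrier V" "w = f v" "v' \<in> carrier V" "w' = f v'"
      using W by blast
    then show "?g (w \<oplus>\<^bsub>W\<^esub> w') = ?g w \<oplus>\<^bsub>V\<^esub> ?g w'"
      using gf[of "v \<oplus>\<^bsub>V\<^esub> v'"] by (simp add: gf f)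
  qed
qed

text \<open>
  The matrix of \<open>F\<close> with respect to the coordinates \<open>\<phi>\<close> and \<open>\<psi>\<close>.
\<close>
definition coord_matrix ::
    "('b, 'x) rmodule \<Rightarrow> nat \<Rightarrow> ('x \<Rightarrow> complex vec) \<Rightarrow> nat \<Rightarrow> ('y \<Rightarrow> complex vec) \<Rightarrow>
      ('x \<Rightarrow> 'y) \<Rightarrow> complex mat" where
  "coord_matrix V n \<phi> m \<psi> F =
     mat m n (\<lambda>(i, j). \<psi> (F (inv_into (carrier V) \<phi> (unit_vec n j))) $ i)"

lemma coord_matrix_carrier [simp]: "coord_matrix V n \<phi> m \<psi> F \<in> carrier_mat m n"
  by (simp add: coord_matrix_def)

lemma coord_matrix_mult_vec:
  assumes V: "vectorspace class_ring V" and \<phi>: "coordinate_iso V n \<phi>"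
    and F: "F \<in> linear_maps V W" and \<psi>: "\<psi> \<in> linear_maps W (column_space m)"
    and v: "v \<in> carrier V"
  shows "coord_matrix V n \<phi> m \<psi> F *\<^sub>v \<phi> v = \<psi> (F v)"
proof -
  let ?g = "inv_into (carrier V) \<phi>"
  have bij: "bij_betw \<phi> (carrier V) (carrier_vec n)"
    and lin: "\<phi> \<in> linear_maps V (column_space n)"
    using \<phi> by (auto simp: coordinate_iso_def)
  have g: "?g \<in> linear_maps (column_space n) V"
    using inverse_linear_map[OF V lin] bij by (simp add: module_vec_simps)
  have "(\<lambda>x. \<psi> (F (?g x))) \<in> linear_maps (column_space n) (column_space m)"
    using g F \<psi> by (simp add: linear_maps_iff)
  from linear_on_columns_eq_mat[OF this, of "\<phi> v"] show ?thesis
    using bij v by (simp add: coord_matrix_def bij_betw_inv_into_left bij_betwE)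
qed

lemma dim_eq_coordinate_iso:
  assumes V: "vectorspace class_ring V" and \<phi>: "coordinate_iso V n \<phi>"
  shows "vectorspace.dim class_ring V = n"
proof -
  let ?g = "inv_into (carrier V) \<phi>"
  interpret C: vec_space "TYPE(complex)" n .
  have bij: "bij_betw \<phi> (carrier V) (carrier_vec n)"
    and lin: "\<phi> \<in> linear_maps V (column_space n)"
    using \<phi> by (auto simp: coordinate_iso_def)
  have g: "?g \<in> linear_maps (column_space n) V"
    using inverse_linear_map[OF V lin] bij by (simp add: module_vec_simps)
  have g_bij: "bij_betw ?g (carrier_vec n) (carrier V)"
    using bij by (rule bij_betw_inv_into)
  interpret g: linear_map class_ring "column_space n" V ?g
    using V g vec_vs[of n, where 'a=complex]
    by (auto simp: linear_map_def mod_hom_def mod_hom_axioms_def vectorspace_def)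
  show ?thesis
    using g.dim_eq g_bij C.fin_dim C.dim_is_n by (simp add: bij_betw_def module_vec_simps)
qed

text \<open>
  The axioms are transported along the bijection with the space of column vectors.  This is how
  quotients and kernels, which are given as bare records, are recognized as vector spaces.
\<close>
lemma vectorspace_coordinate_iso:
  fixes V :: "('b, 'x) rmodule"
  assumes \<phi>: "coordinate_iso V n \<phi>"
    and zero: "\<zero>\<^bsub>V\<^esub> \<in> carrier V" "\<phi> \<zero>\<^bsub>V\<^esub> = 0\<^sub>v n"
    and add: "\<And>v w. v \<in> carrier V \<Longrightarrow> w \<in> carrier V \<Longrightarrow> v \<oplus>\<^bsub>V\<^esub> w \<in> carrier V"
    and smult: "\<And>c v. v \<in> carrier V \<Longrightarrow> c \<odot>\<^bsub>V\<^esub> v \<in> carrier V"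
  shows "vectorspace class_ring V"
proof -
  have bij: "bij_betw \<phi> (carrier V) (carrier_vec n)"
    using \<phi> by (auto simp: coordinate_iso_def)
  then have eqI: "v = w" if "\<phi> v = \<phi> w" "v \<in> carrier V" "w \<in> carrier V" for v w
    using that by (auto simp: bij_betw_def inj_on_def)
  have \<phi>_closed: "\<phi> v \<in> carrier_vec n" if "v \<in> carrier V" for v
    using bij that by (auto simp: bij_betw_def)
  have lin: "\<phi> (v \<oplus>\<^bsub>V\<^esub> w) = \<phi> v + \<phi> w" "\<phi> (c \<odot>\<^bsub>V\<^esub> v) = c \<cdot>\<^sub>v \<phi> v"
    if "v \<in> carrier V" "w \<in> carrier V" for v w c
    using \<phi> that by (auto simp: coordinate_iso_def linear_maps_iff module_vec_simps)
  show ?thesis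
  proof (rule vs_criteria)
    show "field (class_ring :: complex ring)" by (rule class_field)
    show "\<forall>v\<in>carrier V. \<exists>neg_v\<in>carrier V. v \<oplus>\<^bsub>V\<^esub> neg_v = \<zero>\<^bsub>V\<^esub>"
    proof
      fix v assume v: "v \<in> carrier V"
      have "\<phi> (v \<oplus>\<^bsub>V\<^esub> (-1) \<odot>\<^bsub>V\<^esub> v) = \<phi> \<zero>\<^bsub>V\<^esub>"
        using v smult \<phi>_closed[OF v] by (simp add: lin zero) (intro eq_vecI; auto)
      then have "v \<oplus>\<^bsub>V\<^esub> (-1) \<odot>\<^bsub>V\<^esub> v = \<zero>\<^bsub>V\<^esub>"
        using v smult add zero(1) by (intro eqI) auto
      then show "\<exists>neg_v\<in>carrier V. v \<oplus>\<^bsub>V\<^esub> neg_v = \<zero>\<^bsub>V\<^esub>"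
        using v smult by blast
    qed
  next
    show "\<forall>v w. v \<in> carrier V \<and> w \<in> carrier V \<longrightarrow> v \<oplus>\<^bsub>V\<^esub> w = w \<oplus>\<^bsub>V\<^esub> v"
      by (auto intro!: eqI add simp: lin \<phi>_closed comm_add_vec[of _ n])
    show "\<forall>v w x. v \<in> carrier V \<and> w \<in> carrier V \<and> x \<in> carrier V \<longrightarrow>
        v \<oplus>\<^bsub>V\<^esub> w \<oplus>\<^bsub>V\<^esub> x = v \<oplus>\<^bsub>V\<^esub> (w \<oplus>\<^bsub>V\<^esub> x)"
      by (auto intro!: eqI add simp: lin add \<phi>_closed assoc_add_vec[of _ n])
    show "\<forall>v\<in>carrier V. v \<oplus>\<^bsub>V\<^esub> \<zero>\<^bsub>V\<^esub> = v"
      by (auto intro!: eqI add simp: lin zero \<phi>_closed)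
    show "\<forall>a b v. a \<in> carrier class_ring \<and> b \<in> carrier class_ring \<and> v \<in> carrier V \<longrightarrow>
        (a \<otimes>\<^bsub>class_ring\<^esub> b) \<odot>\<^bsub>V\<^esub> v = a \<odot>\<^bsub>V\<^esub> (b \<odot>\<^bsub>V\<^esub> v)"
      by (auto intro!: eqI smult simp: lin smult smult_smult_assoc)
    show "\<forall>v\<in>carrier V. \<one>\<^bsub>class_ring\<^esub> \<odot>\<^bsub>V\<^esub> v = v"
      by (auto intro!: eqI smult simp: lin)
    show "\<forall>a b v. a \<in> carrier class_ring \<and> b \<in> carrier class_ring \<and> v \<in> carrier V \<longrightarrow>
        (a \<oplus>\<^bsub>class_ring\<^esub> b) \<odot>\<^bsub>V\<^esub> v = a \<odot>\<^bsub>V\<^esub> v \<oplus>\<^bsub>V\<^esub> b \<odot>\<^bsub>V\<^esub> v"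
      by (auto intro!: eqI smult add simp: lin smult add_smult_distrib_vec)
    show "\<forall>a v w. a \<in> carrier class_ring \<and> v \<in> carrier V \<and> w \<in> carrier V \<longrightarrow>
        a \<odot>\<^bsub>V\<^esub> (v \<oplus>\<^bsub>V\<^esub> w) = a \<odot>\<^bsub>V\<^esub> v \<oplus>\<^bsub>V\<^esub> a \<odot>\<^bsub>V\<^esub> w"
      by (auto intro!: eqI smult add simp: lin smult add \<phi>_closed smult_add_distrib_vec[of _ n])
  qed (use zero add smult in auto)
qed

lemma coordinate_iso_exists:
  assumes "vectorspace class_ring V" "vectorspace.fin_dim class_ring V"
  shows "\<exists>\<phi>. coordinate_iso V (vectorspace.dim class_ring V) \<phi>"
proof -
  interpret V: vectorspace class_ring V by (rule assms(1))
  let ?n = V.dim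
  obtain \<beta> where \<beta>: "finite \<beta>" "V.basis \<beta>" using V.finite_basis_exists assms(2) by blast
  then have \<beta>_sub: "\<beta> \<subseteq> carrier V" by (simp add: V.basis_def)
  have "card \<beta> = ?n" using V.dim_basis[OF \<beta>] by simp
  then obtain e where e: "bij_betw e \<beta> {..<?n}"
    using ex_bij_betw_finite_nat[OF \<beta>(1)] by (metis atLeast0LessThan)
  \<comment> \<open>The parametrization by a basis; its inverse gives the coordinates.\<close>
  define T where "T = (\<lambda>x :: complex vec. V.lincomb (\<lambda>b. x $ e b) \<beta>)"
  have e_lt: "e b < ?n" if "b \<in> \<beta>" for b
    using e that by (auto simp: bij_betw_def)
  have coeffs: "(\<exists>!a. a \<in> \<beta> \<rightarrow>\<^sub>E carrier class_ring \<and> V.lincomb a \<beta> = v)" if "v \<in> carrier V" for v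
    using V.basis_criterion[OF \<beta>(1) \<beta>_sub] \<beta>(2) that by blast
  have lincomb_cong: "V.lincomb a \<beta> = V.lincomb a' \<beta>" if "\<And>b. b \<in> \<beta> \<Longrightarrow> a b = a' b" for a a'
    using that \<beta>_sub by (intro V.lincomb_cong) auto
  have T_closed: "T x \<in> carrier V" for x
    unfolding T_def using \<beta>_sub by (intro V.lincomb_closed) auto
  have T_lin: "T \<in> linear_maps (column_space ?n) V"
    unfolding linear_maps_iff module_vec_simps
  proof (intro conjI ballI allI T_closed)
    fix x y :: "complex vec" assume x: "x \<in> carrier_vec ?n" and y: "y \<in> carrier_vec ?n"
    have "T (x + y) = V.lincomb (\<lambda>b. x $ e b \<oplus>\<^bsub>class_ring\<^esub> y $ e b) \<beta>"
      unfolding T_def using e_lt x y by (intro lincomb_cong) auto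
    also have "\<dots> = T x \<oplus>\<^bsub>V\<^esub> T y"
      unfolding T_def using \<beta> \<beta>_sub by (intro V.lincomb_sum) auto
    finally show "T (x + y) = T x \<oplus>\<^bsub>V\<^esub> T y" .
  next
    fix c and x :: "complex vec" assume x: "x \<in> carrier_vec ?n"
    have "T (c \<cdot>\<^sub>v x) = V.lincomb (\<lambda>b. c \<otimes>\<^bsub>class_ring\<^esub> x $ e b) \<beta>"
      unfolding T_def using e_lt x by (intro lincomb_cong) auto
    also have "\<dots> = c \<odot>\<^bsub>V\<^esub> T x"
      unfolding T_def using \<beta>_sub by (intro V.lincomb_smult) auto
    finally show "T (c \<cdot>\<^sub>v x) = c \<odot>\<^bsub>V\<^esub> T x" .
  qed
  have T_restrict: "T x = V.lincomb (\<lambda>b \<in> \<beta>. x $ e b) \<beta>" for x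
    unfolding T_def by (rule lincomb_cong) simp
  have "inj_on T (carrier_vec ?n)"
  proof (rule inj_onI)
    fix x y assume x: "x \<in> carrier_vec ?n" and y: "y \<in> carrier_vec ?n" and T: "T x = T y"
    have "(\<lambda>b \<in> \<beta>. x $ e b) = (\<lambda>b \<in> \<beta>. y $ e b)"
      using coeffs[OF T_closed[of y]] T T_restrict[of x] T_restrict[of y]
      by (metis (no_types, lifting) UNIV_I partial_object.select_convs(1) restrict_PiE_iff)
    from fun_cong[OF this] have coeff: "x $ e b = y $ e b" if "b \<in> \<beta>" for b
      using that by (metis restrict_apply')
    show "x = y"
    proof (rule eq_vecI)
      fix i assume "i < dim_vec y"
      then have "i \<in> e ` \<beta>" using e y by (simp add: bij_betw_def)
      then show "x $ i = y $ i" using coeff by blast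
    qed (use x y in simp)
  qed
  moreover have "carrier V \<subseteq> T ` carrier_vec ?n"
  proof
    fix v assume "v \<in> carrier V"
    then obtain a where a: "V.lincomb a \<beta> = v" using coeffs by blast
    let ?x = "vec ?n (\<lambda>i. a (inv_into \<beta> e i))"
    have "T ?x = v"
      unfolding a[symmetric] T_def using e e_lt
      by (intro lincomb_cong) (simp add: bij_betw_def)
    then show "v \<in> T ` carrier_vec ?n" by (intro image_eqI[of _ _ ?x]) auto
  qed
  ultimately have T_bij: "bij_betw T (carrier_vec ?n) (carrier V)"
    using T_closed by (auto simp: bij_betw_def)
  have "inv_into (carrier_vec ?n) T \<in> linear_maps V (column_space ?n)"
    using inverse_linear_map[OF vec_vs T_lin] T_bij by (simp add: module_vec_simps)
  then have "coordinate_iso V ?n (inv_into (carrier_vec ?n) T)"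
    using T_bij by (simp add: coordinate_iso_def bij_betw_inv_into)
  then show ?thesis by blast
qed

text \<open>
  If \<open>A\<close> generates the module and \<open>\<beta>\<close> spans the algebra, then the products of members of \<open>A\<close> and \<open>\<beta>\<close>
  span the module.  This makes the dimension, defined as a least cardinality, the size of a basis.
\<close>
lemma finitely_generated_fin_dim:
  assumes B: "fin_dim_algebra B" and V: "right_module B V" and gen: "finitely_generated B V"
  shows "vectorspace.fin_dim class_ring V"
proof -
  interpret B: fin_dim_algebra B by (rule B)
  interpret M: right_module B V by (rule V)
  interpret BV: vectorspace class_ring B by (rule B.vectorspace)
  interpret V: vectorspace class_ring V by (rule M.vectorspace)
  obtain \<beta> where \<beta>: "finite \<beta>" "\<beta> \<subseteq> carrier B" "BV.span \<beta> = carrier B"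
    using B.fin_dim unfolding BV.fin_dim_def by blast
  obtain A where A: "finite A" "A \<subseteq> carrier V"
    and A_gen: "\<And>v. v \<in> carrier V \<Longrightarrow> \<exists>\<alpha> \<in> A \<rightarrow> carrier B. v = (\<Oplus>\<^bsub>V\<^esub>a\<in>A. a \<triangleleft>\<^bsub>V\<^esub> \<alpha> a)"
    using gen unfolding finitely_generated_def by blast
  define S where "S = (\<lambda>(a, b). a \<triangleleft>\<^bsub>V\<^esub> b) ` (A \<times> \<beta>)"
  have "a \<triangleleft>\<^bsub>V\<^esub> b \<in> carrier V" if "a \<in> A" "b \<in> \<beta>" for a b
    using that A(2) \<beta>(2) M.act_closed by blast
  then have S: "finite S" "S \<subseteq> carrier V"
    using A(1) \<beta>(1) by (auto simp: S_def)
  interpret W: submodule class_ring "V.span S" V by (rule V.span_is_submodule[OF S(2)])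
  have act_in: "a \<triangleleft>\<^bsub>V\<^esub> b \<in> V.span S" if a: "a \<in> A" and b: "b \<in> carrier B" for a b
  proof -
    have aV: "a \<in> carrier V" using a A by blast
    \<comment> \<open>Linearity of the action in the algebra makes this a subspace, and it contains \<open>\<beta>\<close>.\<close>
    let ?N = "{b \<in> carrier B. a \<triangleleft>\<^bsub>V\<^esub> b \<in> V.span S}"
    have zero: "a \<triangleleft>\<^bsub>V\<^esub> \<zero>\<^bsub>B\<^esub> = \<zero>\<^bsub>V\<^esub>"
      using M.act_smult_right[OF aV, of "\<zero>\<^bsub>B\<^esub>" 0] M.act_closed[OF aV, of "\<zero>\<^bsub>B\<^esub>"]
        BV.smult_l_null[of "\<zero>\<^bsub>B\<^esub>"] V.smult_l_null[of "a \<triangleleft>\<^bsub>V\<^esub> \<zero>\<^bsub>B\<^esub>"] by simp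
    have "submodule class_ring ?N B"
    proof (rule submodule.intro)
      show "Module.module class_ring B" by (rule BV.module_axioms)
    qed (use zero aV in \<open>auto simp: M.act_add_right M.act_smult_right\<close>)
    moreover have "\<beta> \<subseteq> ?N"
      using a \<beta>(2) V.in_own_span[OF S(2)] by (auto simp: S_def)
    ultimately have "BV.span \<beta> \<subseteq> ?N" by (intro BV.span_is_subset)
    then show ?thesis using \<beta>(3) b by blast
  qed
  have sum_in: "(\<Oplus>\<^bsub>V\<^esub>a\<in>A'. a \<triangleleft>\<^bsub>V\<^esub> \<alpha> a) \<in> V.span S"
    if "finite A'" "A' \<subseteq> A" "\<alpha> \<in> A \<rightarrow> carrier B" for A' \<alpha>
    using that
  proof (induction A')
    case (insert a A')
    have "(\<lambda>a. a \<triangleleft>\<^bsub>V\<^esub> \<alpha> a) \<in> A' \<rightarrow> carrier V" "a \<triangleleft>\<^bsub>V\<^esub> \<alpha> a \<in> carrier V"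
      using insert.prems A by (auto intro!: M.act_closed)
    then have "(\<Oplus>\<^bsub>V\<^esub>a\<in>insert a A'. a \<triangleleft>\<^bsub>V\<^esub> \<alpha> a) = a \<triangleleft>\<^bsub>V\<^esub> \<alpha> a \<oplus>\<^bsub>V\<^esub> (\<Oplus>\<^bsub>V\<^esub>a\<in>A'. a \<triangleleft>\<^bsub>V\<^esub> \<alpha> a)"
      using insert.hyps by (intro V.finsum_insert)
    then show ?case
      using insert by (auto intro!: W.m_closed act_in)
  qed simp
  have "V.span S = carrier V"
  proof
    show "V.span S \<subseteq> carrier V" by (rule W.subset)
    show "carrier V \<subseteq> V.span S"
    proof
      fix v assume "v \<in> carrier V"
      then show "v \<in> V.span S" using A_gen[of v] sum_in[OF A(1) order_refl] by blast
    qed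
  qed
  then show ?thesis
    unfolding V.fin_dim_def using S by blast
qed

section \<open>Module structures and orbits\<close>

lemma conj_mult_conj:
  fixes A :: "complex mat"
  assumes a: "a \<in> carrier_mat p r" and A: "A \<in> carrier_mat r q" and h: "h \<in> carrier_mat q q"
    and g: "g \<in> carrier_mat q q" and B: "B \<in> carrier_mat q s" and c: "c \<in> carrier_mat s t"
    and hg: "h * g = 1\<^sub>m q"
  shows "(a * A * h) * (g * B * c) = a * (A * B) * c"
proof -
  have "h * (g * B * c) = h * (g * (B * c))"
    by (simp only: assoc_mult_mat[OF g B c])
  also have "\<dots> = h * g * (B * c)"
    by (rule assoc_mult_mat[OF h g mult_carrier_mat[OF B c], symmetric])
  also have "\<dots> = B * c"
    unfolding hg by (rule left_mult_one_mat[OF mult_carrier_mat[OF B c]])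
  finally have cancel: "h * (g * B * c) = B * c" .
  have "(a * A * h) * (g * B * c) = a * A * (h * (g * B * c))"
    by (rule assoc_mult_mat[OF mult_carrier_mat[OF a A] h
        mult_carrier_mat[OF mult_carrier_mat[OF g B] c]])
  also have "\<dots> = a * A * B * c"
    unfolding cancel by (rule assoc_mult_mat[OF mult_carrier_mat[OF a A] B c, symmetric])
  also have "\<dots> = a * (A * B) * c"
    by (simp only: assoc_mult_mat[OF a A B])
  finally show ?thesis .
qed

lemma Units_Mat_ringD:
  assumes "g \<in> Units (Mat_ring n)"
  shows "g \<in> carrier_mat n n" "inv\<^bsub>Mat_ring n\<^esub> g \<in> carrier_mat n n"
    "g * inv\<^bsub>Mat_ring n\<^esub> g = 1\<^sub>m n" "inv\<^bsub>Mat_ring n\<^esub> g * g = 1\<^sub>m n"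
proof -
  interpret ring "Mat_ring n" by (rule ring_mat)
  show "g \<in> carrier_mat n n" "inv\<^bsub>Mat_ring n\<^esub> g \<in> carrier_mat n n"
    "g * inv\<^bsub>Mat_ring n\<^esub> g = 1\<^sub>m n" "inv\<^bsub>Mat_ring n\<^esub> g * g = 1\<^sub>m n"
    using Units_closed[OF assms] Units_inv_closed[OF assms] Units_r_inv[OF assms]
      Units_l_inv[OF assms] by (simp_all add: ring_mat_simps)
qed

lemma Units_Mat_ringI:
  assumes "g \<in> carrier_mat n n" "h \<in> carrier_mat n n" "g * h = 1\<^sub>m n" "h * g = 1\<^sub>m n"
  shows "g \<in> Units (Mat_ring n)" "inv\<^bsub>Mat_ring n\<^esub> g = h"
proof -
  interpret ring "Mat_ring n" by (rule ring_mat)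
  show g: "g \<in> Units (Mat_ring n)"
    using assms unfolding Units_def by (auto simp: ring_mat_simps)
  show "inv\<^bsub>Mat_ring n\<^esub> g = h"
    using assms by (intro inv_char) (simp_all add: ring_mat_simps)
qed

text \<open>
  Each of the relations between the matrices \<open>\<rho> b\<close> can be tested on vectors \<open>\<kappa> v\<close>, where it is an axiom
  of the module.  With \<open>\<kappa>\<close> not required to be injective, the lemma covers the cokernel, as an image
  of \<open>M\<close>, without making the quotient into a module first.
\<close>
lemma module_structures_of_linear_image:
  assumes B: "fin_dim_algebra B" and V: "right_module B V"
    and \<kappa>: "\<kappa> \<in> linear_maps V (column_space n)" and surj: "\<kappa> ` carrier V = carrier_vec n"
    and \<rho>: "\<rho> \<in> carrier B \<rightarrow>\<^sub>E carrier_mat n n"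
    and act: "\<And>v b. v \<in> carrier V \<Longrightarrow> b \<in> carrier B \<Longrightarrow> \<kappa> (v \<triangleleft>\<^bsub>V\<^esub> b) = \<rho> b *\<^sub>v \<kappa> v"
  shows "\<rho> \<in> module_structures B n"
proof -
  interpret B: ring B using B by (rule fin_dim_algebra.ring)
  interpret BV: vectorspace class_ring B using B by (rule fin_dim_algebra.vectorspace)
  interpret V: right_module B V by (rule V)
  have \<rho>_mat: "\<rho> b \<in> carrier_mat n n" if "b \<in> carrier B" for b
    using \<rho> that by auto
  have \<kappa>_closed: "\<kappa> v \<in> carrier_vec n" and \<kappa>_add: "\<kappa> (v \<oplus>\<^bsub>V\<^esub> w) = \<kappa> v + \<kappa> w"
    and \<kappa>_smult: "\<kappa> (c \<odot>\<^bsub>V\<^esub> v) = c \<cdot>\<^sub>v \<kappa> v"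
    if "v \<in> carrier V" "w \<in> carrier V" for v w c
    using \<kappa> that by (auto simp: linear_maps_iff module_vec_simps)
  have eqI: "A = A'" if "A \<in> carrier_mat n n" "A' \<in> carrier_mat n n"
    "\<And>v. v \<in> carrier V \<Longrightarrow> A *\<^sub>v \<kappa> v = A' *\<^sub>v \<kappa> v" for A A'
    using that surj by (intro mat_eq_on_vecI[of _ n n]) (auto simp flip: surj)
  have smult_closed: "c \<odot>\<^bsub>B\<^esub> b \<in> carrier B" if "b \<in> carrier B" for c b
    using BV.smult_closed[of c b] that by simp
  show ?thesis
    unfolding module_structures_def mem_Collect_eq
  proof (intro conjI ballI allI \<rho>)
    show "\<rho> \<one>\<^bsub>B\<^esub> = 1\<^sub>m n"
      by (rule eqI) (auto simp: \<rho>_mat V.act_one \<kappa>_closed simp flip: act)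
  next
    fix b b' assume b: "b \<in> carrier B" "b' \<in> carrier B"
    show "\<rho> (b \<oplus>\<^bsub>B\<^esub> b') = \<rho> b + \<rho> b'"
      using b by (intro eqI)
        (auto simp: \<rho>_mat \<kappa>_closed add_mult_distrib_mat_vec[of _ n n] V.act_add_right \<kappa>_add
          V.act_closed simp flip: act)
    show "\<rho> (b \<otimes>\<^bsub>B\<^esub> b') = \<rho> b' * \<rho> b"
      using b by (intro eqI)
        (auto simp: \<rho>_mat \<kappa>_closed assoc_mult_mat_vec[of _ n n _ n] V.act_mult
          V.act_closed mult_carrier_mat[of _ n n _ n] simp flip: act)
  next
    fix c :: complex and b assume b: "b \<in> carrier B"
    have "(c \<cdot>\<^sub>m A) *\<^sub>v x = c \<cdot>\<^sub>v (A *\<^sub>v x)"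
      if "A \<in> carrier_mat n n" "x \<in> carrier_vec n" for A x
      using that by (intro eq_vecI) (auto intro!: smult_scalar_prod_distrib[of _ n])
    then show "\<rho> (c \<odot>\<^bsub>B\<^esub> b) = c \<cdot>\<^sub>m \<rho> b"
      using b by (intro eqI)
        (auto simp: \<rho>_mat \<kappa>_closed smult_closed V.act_smult_right \<kappa>_smult V.act_closed simp flip: act)
  qed
qed

lemma module_structures_conj:
  assumes B: "fin_dim_algebra B" and \<rho>: "\<rho> \<in> module_structures B n"
    and g: "g \<in> carrier_mat n n" and h: "h \<in> carrier_mat n n"
    and gh: "g * h = 1\<^sub>m n" and hg: "h * g = 1\<^sub>m n"
  shows "(\<lambda>b \<in> carrier B. g * \<rho> b * h) \<in> module_structures B n"
proof -
  interpret B: ring B using B by (rule fin_dim_algebra.ring)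
  interpret BV: vectorspace class_ring B using B by (rule fin_dim_algebra.vectorspace)
  have mat: "\<rho> b \<in> carrier_mat n n" if "b \<in> carrier B" for b
    using \<rho> that by (auto simp: module_structures_def)
  have hom: "\<rho> \<one>\<^bsub>B\<^esub> = 1\<^sub>m n"
    "\<And>b b'. b \<in> carrier B \<Longrightarrow> b' \<in> carrier B \<Longrightarrow> \<rho> (b \<oplus>\<^bsub>B\<^esub> b') = \<rho> b + \<rho> b'"
    "\<And>c b. b \<in> carrier B \<Longrightarrow> \<rho> (c \<odot>\<^bsub>B\<^esub> b) = c \<cdot>\<^sub>m \<rho> b"
    "\<And>b b'. b \<in> carrier B \<Longrightarrow> b' \<in> carrier B \<Longrightarrow> \<rho> (b \<otimes>\<^bsub>B\<^esub> b') = \<rho> b' * \<rho> b"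
    using \<rho> by (auto simp: module_structures_def)
  have smult_closed: "c \<odot>\<^bsub>B\<^esub> b \<in> carrier B" if "b \<in> carrier B" for c b
    using BV.smult_closed[of c b] that by simp
  show ?thesis
    unfolding module_structures_def mem_Collect_eq
  proof (intro conjI ballI allI)
    show "(\<lambda>b \<in> carrier B. g * \<rho> b * h) \<in> carrier B \<rightarrow>\<^sub>E carrier_mat n n"
      using g h mat by auto
    show "(\<lambda>b \<in> carrier B. g * \<rho> b * h) \<one>\<^bsub>B\<^esub> = 1\<^sub>m n"
      using g gh by (simp add: hom)
  next
    fix b b' assume b: "b \<in> carrier B" "b' \<in> carrier B"
    show "(\<lambda>b \<in> carrier B. g * \<rho> b * h) (b \<oplus>\<^bsub>B\<^esub> b') =
        (\<lambda>b \<in> carrier B. g * \<rho> b * h) b + (\<lambda>b \<in> carrier B. g * \<rho> b * h) b'"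
      using b mult_add_distrib_mat[OF g mat mat]
        add_mult_distrib_mat[OF mult_carrier_mat[OF g mat] mult_carrier_mat[OF g mat] h]
      by (simp add: hom)
    show "(\<lambda>b \<in> carrier B. g * \<rho> b * h) (b \<otimes>\<^bsub>B\<^esub> b') =
        (\<lambda>b \<in> carrier B. g * \<rho> b * h) b' * (\<lambda>b \<in> carrier B. g * \<rho> b * h) b"
      using b conj_mult_conj[OF g mat h g mat h hg] by (simp add: hom)
  next
    fix c :: complex and b assume b: "b \<in> carrier B"
    show "(\<lambda>b \<in> carrier B. g * \<rho> b * h) (c \<odot>\<^bsub>B\<^esub> b) = c \<cdot>\<^sub>m (\<lambda>b \<in> carrier B. g * \<rho> b * h) b"
      using b g h mat[OF b] smult_closed[OF b]
      by (simp add: hom mult_smult_distrib[of _ n n _ n] mult_smult_assoc_mat[of _ n n _ n])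
  qed
qed

lemma rep_points_A2_iff:
  "(\<rho>, f) \<in> rep_points B A2 (A2_dim d e) \<longleftrightarrow> \<rho> \<in> extensional {1, 2} \<and>
     \<rho> 1 \<in> module_structures B d \<and> \<rho> 2 \<in> module_structures B e \<and> f () \<in> carrier_mat e d \<and>
     (\<forall>b \<in> carrier B. f () * \<rho> 1 b = \<rho> 2 b * f ())"
  by (auto simp: rep_points_def A2_def A2_dim_def PiE_iff extensional_def)

lemma GL_A2_iff:
  "g \<in> GL A2 (A2_dim d e) \<longleftrightarrow>
     g \<in> extensional {1, 2} \<and> g 1 \<in> Units (Mat_ring d) \<and> g 2 \<in> Units (Mat_ring e)"
  by (auto simp: GL_def A2_def A2_dim_def PiE_iff)

text \<open>
  The function on the single arrow does not need to be restricted, since \<open>unit\<close> has only one element.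
\<close>
lemma base_change_A2:
  "base_change B A2 (A2_dim d e) g (\<rho>, f) =
     (\<lambda>i \<in> {1, 2}. \<lambda>b \<in> carrier B. g i * \<rho> i b * inv\<^bsub>Mat_ring (A2_dim d e i)\<^esub> (g i),
      \<lambda>a. g 2 * f () * inv\<^bsub>Mat_ring d\<^esub> (g 1))"
  by (auto simp: base_change_def A2_def A2_dim_def fun_eq_iff)

lemma coordinate_iso_change:
  assumes V: "vectorspace class_ring V"
    and \<phi>: "coordinate_iso V n \<phi>" and \<phi>': "coordinate_iso V n \<phi>'"
  defines "g \<equiv> coord_matrix V n \<phi> n \<phi>' (\<lambda>v. v)"
    and "h \<equiv> coord_matrix V n \<phi>' n \<phi> (\<lambda>v. v)"
  shows "g \<in> Units (Mat_ring n)" "inv\<^bsub>Mat_ring n\<^esub> g = h"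
    "v \<in> carrier V \<Longrightarrow> g *\<^sub>v \<phi> v = \<phi>' v" "v \<in> carrier V \<Longrightarrow> h *\<^sub>v \<phi>' v = \<phi> v"
proof -
  have lin: "\<phi> \<in> linear_maps V (column_space n)" "\<phi>' \<in> linear_maps V (column_space n)"
    and range: "\<phi> ` carrier V = carrier_vec n" "\<phi>' ` carrier V = carrier_vec n"
    using \<phi> \<phi>' by (auto simp: coordinate_iso_def bij_betw_def)
  have id: "(\<lambda>v. v) \<in> linear_maps V V" by (simp add: linear_maps_iff)
  have g: "g *\<^sub>v \<phi> v = \<phi>' v" and h: "h *\<^sub>v \<phi>' v = \<phi> v" if "v \<in> carrier V" for v
    unfolding g_def h_def
    using coord_matrix_mult_vec[OF V \<phi> id lin(2) that] coord_matrix_mult_vec[OF V \<phi>' id lin(1) that]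
    by simp_all
  then show "v \<in> carrier V \<Longrightarrow> g *\<^sub>v \<phi> v = \<phi>' v" "v \<in> carrier V \<Longrightarrow> h *\<^sub>v \<phi>' v = \<phi> v" by auto
  have gc: "g \<in> carrier_mat n n" and hc: "h \<in> carrier_mat n n" by (simp_all add: g_def h_def)
  have "g * h = 1\<^sub>m n"
  proof (rule mat_eq_on_vecI[of _ n n])
    fix x :: "complex vec" assume "x \<in> carrier_vec n"
    then obtain v where v: "v \<in> carrier V" "x = \<phi>' v" using range(2) by blast
    have "(g * h) *\<^sub>v x = g *\<^sub>v (h *\<^sub>v x)"
      using gc hc \<open>x \<in> carrier_vec n\<close> by (rule assoc_mult_mat_vec)
    then show "(g * h) *\<^sub>v x = 1\<^sub>m n *\<^sub>v x"
      using v g h \<open>x \<in> carrier_vec n\<close> by simp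
  qed (use gc hc in auto)
  moreover have "h * g = 1\<^sub>m n"
  proof (rule mat_eq_on_vecI[of _ n n])
    fix x :: "complex vec" assume "x \<in> carrier_vec n"
    then obtain v where v: "v \<in> carrier V" "x = \<phi> v" using range(1) by blast
    have "(h * g) *\<^sub>v x = h *\<^sub>v (g *\<^sub>v x)"
      using hc gc \<open>x \<in> carrier_vec n\<close> by (rule assoc_mult_mat_vec)
    then show "(h * g) *\<^sub>v x = 1\<^sub>m n *\<^sub>v x"
      using v g h \<open>x \<in> carrier_vec n\<close> by simp
  qed (use gc hc in auto)
  ultimately show "g \<in> Units (Mat_ring n)" "inv\<^bsub>Mat_ring n\<^esub> g = h"
    using Units_Mat_ringI gc hc by blast+
qed

lemma coordinate_iso_mult:
  assumes \<phi>: "coordinate_iso V n \<phi>" and g: "g \<in> Units (Mat_ring n)"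
  shows "coordinate_iso V n (\<lambda>v. g *\<^sub>v \<phi> v)"
proof -
  let ?h = "inv\<^bsub>Mat_ring n\<^esub> g"
  note g = Units_Mat_ringD[OF g]
  have lin: "\<phi> \<in> linear_maps V (column_space n)" and bij: "bij_betw \<phi> (carrier V) (carrier_vec n)"
    using \<phi> by (auto simp: coordinate_iso_def)
  have "(\<lambda>v. g *\<^sub>v \<phi> v) \<in> linear_maps V (column_space n)"
    using lin g(1) by (auto simp: linear_maps_iff module_vec_simps
        mult_add_distrib_mat_vec[of _ n n] mult_mat_vec[of _ n n])
  moreover have "bij_betw ((*\<^sub>v) g) (carrier_vec n) (carrier_vec n)"
  proof (rule bij_betwI[where g = "(*\<^sub>v) ?h"])
    fix x :: "complex vec" assume x: "x \<in> carrier_vec n"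
    show "?h *\<^sub>v (g *\<^sub>v x) = x"
      using assoc_mult_mat_vec[OF g(2,1) x] g(4) x by simp
    show "g *\<^sub>v (?h *\<^sub>v x) = x"
      using assoc_mult_mat_vec[OF g(1,2) x] g(3) x by simp
  qed (use g in auto)
  then have "bij_betw (\<lambda>v. g *\<^sub>v \<phi> v) (carrier V) (carrier_vec n)"
    using bij_betw_trans[OF bij] by (simp add: comp_def)
  ultimately show ?thesis by (simp add: coordinate_iso_def)
qed

text \<open>
  If \<open>A\<close> takes the coordinates \<open>\<phi> v\<close> to \<open>\<psi> w\<close>, then \<open>g * A * h\<close> takes the coordinates changed by
  the inverse \<open>a\<close> of \<open>h\<close> to those changed by \<open>g\<close>.  All comparisons of a point with its base change are instances.
\<close>
lemma conj_intertwines: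
  fixes A :: "complex mat"
  assumes vw: "\<phi> v = x" "\<psi> w = A *\<^sub>v x" and x: "x \<in> carrier_vec n" and A: "A \<in> carrier_mat m n"
    and g: "g \<in> carrier_mat m m" and a: "a \<in> carrier_mat n n" and h: "h \<in> carrier_mat n n"
    and ha: "h * a = 1\<^sub>m n"
  shows "g *\<^sub>v \<psi> w = (g * A * h) *\<^sub>v (a *\<^sub>v \<phi> v)"
proof -
  have ax: "a *\<^sub>v x \<in> carrier_vec n" using a x by simp
  have "(g * A * h) *\<^sub>v (a *\<^sub>v x) = (g * A) *\<^sub>v (h *\<^sub>v (a *\<^sub>v x))"
    by (rule assoc_mult_mat_vec[OF mult_carrier_mat[OF g A] h ax])
  also have "h *\<^sub>v (a *\<^sub>v x) = x"
    using assoc_mult_mat_vec[OF h a x] ha x by simp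
  also have "(g * A) *\<^sub>v x = g *\<^sub>v (A *\<^sub>v x)" by (rule assoc_mult_mat_vec[OF g A x])
  finally show ?thesis by (simp add: vw)
qed

text \<open>
  The matrices of a point are determined by the coordinates that produce it.  Hence two such
  points differ by the base change between their coordinates; conversely a base change of the point is
  the point produced by the changed coordinates.
\<close>
lemma orbit_of_representation_eq_GL_orbit:
  fixes V :: "('b, 'x) rmodule" and W :: "('b, 'y) rmodule"
  assumes B: "fin_dim_algebra B"
    and V: "vectorspace class_ring V" and W: "vectorspace class_ring W"
    and V_act: "\<And>v b. v \<in> carrier V \<Longrightarrow> b \<in> carrier B \<Longrightarrow> v \<triangleleft>\<^bsub>V\<^esub> b \<in> carrier V"
    and W_act: "\<And>w b. w \<in> carrier W \<Longrightarrow> b \<in> carrier B \<Longrightarrow> w \<triangleleft>\<^bsub>W\<^esub> b \<in> carrier W"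
    and F: "\<And>v. v \<in> carrier V \<Longrightarrow> F v \<in> carrier W"
    and point: "(\<rho>, f) \<in> rep_points B A2 (A2_dim d e)"
    and \<phi>: "coordinate_iso V d \<phi>" and \<psi>: "coordinate_iso W e \<psi>"
    and \<phi>_act: "\<And>v b. v \<in> carrier V \<Longrightarrow> b \<in> carrier B \<Longrightarrow> \<phi> (v \<triangleleft>\<^bsub>V\<^esub> b) = \<rho> 1 b *\<^sub>v \<phi> v"
    and \<psi>_act: "\<And>w b. w \<in> carrier W \<Longrightarrow> b \<in> carrier B \<Longrightarrow> \<psi> (w \<triangleleft>\<^bsub>W\<^esub> b) = \<rho> 2 b *\<^sub>v \<psi> w"
    and \<psi>_F: "\<And>v. v \<in> carrier V \<Longrightarrow> \<psi> (F v) = f () *\<^sub>v \<phi> v"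
  shows "orbit_of_representation B V W F = GL_orbit B A2 (A2_dim d e) (\<rho>, f)"
proof (intro equalityI subsetI)
  have dims: "vectorspace.dim class_ring V = d" "vectorspace.dim class_ring W = e"
    using dim_eq_coordinate_iso V W \<phi> \<psi> by blast+
  have range: "\<phi>' ` carrier V = carrier_vec d" if "coordinate_iso V d \<phi>'" for \<phi>'
    using that by (auto simp: coordinate_iso_def bij_betw_def)
  have range': "\<psi>' ` carrier W = carrier_vec e" if "coordinate_iso W e \<psi>'" for \<psi>'
    using that by (auto simp: coordinate_iso_def bij_betw_def)
  have mats: "\<rho> 1 b \<in> carrier_mat d d" "\<rho> 2 b \<in> carrier_mat e e" if "b \<in> carrier B" for b
    using point that by (auto simp: rep_points_A2_iff module_structures_def)
  have f: "f () \<in> carrier_mat e d" using point by (simp add: rep_points_A2_iff)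
  {
    fix x assume "x \<in> orbit_of_representation B V W F"
    then obtain \<rho>' f' \<phi>' \<psi>' where x: "x = (\<rho>', f')"
      and point': "(\<rho>', f') \<in> rep_points B A2 (A2_dim d e)"
      and \<phi>': "coordinate_iso V d \<phi>'" and \<psi>': "coordinate_iso W e \<psi>'"
      and \<phi>'_act: "\<And>v b. v \<in> carrier V \<Longrightarrow> b \<in> carrier B \<Longrightarrow> \<phi>' (v \<triangleleft>\<^bsub>V\<^esub> b) = \<rho>' 1 b *\<^sub>v \<phi>' v"
      and \<psi>'_act: "\<And>w b. w \<in> carrier W \<Longrightarrow> b \<in> carrier B \<Longrightarrow> \<psi>' (w \<triangleleft>\<^bsub>W\<^esub> b) = \<rho>' 2 b *\<^sub>v \<psi>' w"
      and \<psi>'_F: "\<And>v. v \<in> carrier V \<Longrightarrow> \<psi>' (F v) = f' () *\<^sub>v \<phi>' v"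
      by (auto simp: orbit_of_representation_def dims)
    let ?g = "coord_matrix V d \<phi> d \<phi>' (\<lambda>v. v)" and ?k = "coord_matrix W e \<psi> e \<psi>' (\<lambda>w. w)"
    note g = coordinate_iso_change[OF V \<phi> \<phi>'] and k = coordinate_iso_change[OF W \<psi> \<psi>']
    note gD = Units_Mat_ringD[OF g(1)] and kD = Units_Mat_ringD[OF k(1)]
    have mats': "\<rho>' 1 b \<in> carrier_mat d d" "\<rho>' 2 b \<in> carrier_mat e e" if "b \<in> carrier B" for b
      using point' that by (auto simp: rep_points_A2_iff module_structures_def)
    have f': "f' () \<in> carrier_mat e d" using point' by (simp add: rep_points_A2_iff)
    have \<rho>1: "\<rho>' 1 b = ?g * \<rho> 1 b * inv\<^bsub>Mat_ring d\<^esub> ?g" if b: "b \<in> carrier B" for b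
    proof (rule mat_eq_on_vecI[of _ d d])
      fix y :: "complex vec" assume "y \<in> carrier_vec d"
      then obtain v where v: "v \<in> carrier V" "y = \<phi>' v" using range[OF \<phi>'] by blast
      have "\<phi> v \<in> carrier_vec d" using range[OF \<phi>] v by blast
      from conj_intertwines[of \<phi> v _ \<phi> "v \<triangleleft>\<^bsub>V\<^esub> b", OF refl \<phi>_act[OF v(1) b] this mats(1)[OF b] gD(1,1,2,4)]
      show "\<rho>' 1 b *\<^sub>v y = (?g * \<rho> 1 b * inv\<^bsub>Mat_ring d\<^esub> ?g) *\<^sub>v y"
        using v b g(3) V_act \<phi>'_act by simp
    qed (rule mats'(1)[OF b] mult_carrier_mat[OF mult_carrier_mat[OF gD(1) mats(1)[OF b]] gD(2)])+
    have \<rho>2: "\<rho>' 2 b = ?k * \<rho> 2 b * inv\<^bsub>Mat_ring e\<^esub> ?k" if b: "b \<in> carrier B" for b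
    proof (rule mat_eq_on_vecI[of _ e e])
      fix y :: "complex vec" assume "y \<in> carrier_vec e"
      then obtain w where w: "w \<in> carrier W" "y = \<psi>' w" using range'[OF \<psi>'] by blast
      have "\<psi> w \<in> carrier_vec e" using range'[OF \<psi>] w by blast
      from conj_intertwines[of \<psi> w _ \<psi> "w \<triangleleft>\<^bsub>W\<^esub> b", OF refl \<psi>_act[OF w(1) b] this mats(2)[OF b] kD(1,1,2,4)]
      show "\<rho>' 2 b *\<^sub>v y = (?k * \<rho> 2 b * inv\<^bsub>Mat_ring e\<^esub> ?k) *\<^sub>v y"
        using w b k(3) W_act \<psi>'_act by simp
    qed (rule mats'(2)[OF b] mult_carrier_mat[OF mult_carrier_mat[OF kD(1) mats(2)[OF b]] kD(2)])+
    have f'_eq: "f' () = ?k * f () * inv\<^bsub>Mat_ring d\<^esub> ?g"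
    proof (rule mat_eq_on_vecI[of _ e d])
      fix y :: "complex vec" assume "y \<in> carrier_vec d"
      then obtain v where v: "v \<in> carrier V" "y = \<phi>' v" using range[OF \<phi>'] by blast
      have "\<phi> v \<in> carrier_vec d" using range[OF \<phi>] v by blast
      from conj_intertwines[of \<phi> v _ \<psi> "F v", OF refl \<psi>_F[OF v(1)] this f kD(1) gD(1,2,4)]
      show "f' () *\<^sub>v y = (?k * f () * inv\<^bsub>Mat_ring d\<^esub> ?g) *\<^sub>v y"
        using v g(3) k(3) F \<psi>'_F by simp
    qed (rule f' mult_carrier_mat[OF mult_carrier_mat[OF kD(1) f] gD(2)])+
    let ?G = "\<lambda>i \<in> {1, 2 :: nat}. if i = 1 then ?g else ?k"
    have "?G \<in> GL A2 (A2_dim d e)" using g(1) k(1) by (simp add: GL_A2_iff)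
    moreover have "x = base_change B A2 (A2_dim d e) ?G (\<rho>, f)"
    proof -
      have ext: "\<rho>' i \<in> extensional (carrier B)" if "i \<in> {1, 2}" for i
        using point' that by (auto simp: rep_points_A2_iff module_structures_def PiE_def)
      have "\<rho>' i = (\<lambda>i \<in> {1, 2}. \<lambda>b \<in> carrier B. ?G i * \<rho> i b *
          inv\<^bsub>Mat_ring (A2_dim d e i)\<^esub> (?G i)) i" for i
      proof (cases "i \<in> {1, 2}")
        case True
        then show ?thesis
          using \<rho>1 \<rho>2 by (intro extensionalityI[OF ext]) (auto simp: A2_dim_def)
      next
        case False
        then show ?thesis
          using point' by (simp add: rep_points_A2_iff extensional_def)
      qed
      moreover have "f' = (\<lambda>a. ?G 2 * f () * inv\<^bsub>Mat_ring d\<^esub> (?G 1))"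
        using f'_eq by (simp add: fun_eq_iff)
      ultimately show ?thesis unfolding x base_change_A2 by blast
    qed
    ultimately show "x \<in> GL_orbit B A2 (A2_dim d e) (\<rho>, f)"
      unfolding GL_orbit_def by blast
  }
  {
    fix x assume "x \<in> GL_orbit B A2 (A2_dim d e) (\<rho>, f)"
    then obtain g where g: "g \<in> GL A2 (A2_dim d e)"
      and x: "x = base_change B A2 (A2_dim d e) g (\<rho>, f)"
      unfolding GL_orbit_def by blast
    have g1: "g 1 \<in> Units (Mat_ring d)" and g2: "g 2 \<in> Units (Mat_ring e)"
      using g by (auto simp: GL_A2_iff)
    note g1D = Units_Mat_ringD[OF g1] and g2D = Units_Mat_ringD[OF g2]
    let ?h1 = "inv\<^bsub>Mat_ring d\<^esub> (g 1)" and ?h2 = "inv\<^bsub>Mat_ring e\<^esub> (g 2)"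
    define \<rho>' where
      "\<rho>' = (\<lambda>i \<in> {1, 2}. \<lambda>b \<in> carrier B. g i * \<rho> i b * inv\<^bsub>Mat_ring (A2_dim d e i)\<^esub> (g i))"
    define f' where "f' = (\<lambda>a :: unit. g 2 * f () * ?h1)"
    have x': "x = (\<rho>', f')" unfolding x base_change_A2 \<rho>'_def f'_def ..
    have \<rho>'1: "\<rho>' 1 = (\<lambda>b \<in> carrier B. g 1 * \<rho> 1 b * ?h1)"
      and \<rho>'2: "\<rho>' 2 = (\<lambda>b \<in> carrier B. g 2 * \<rho> 2 b * ?h2)"
      by (simp_all add: \<rho>'_def A2_dim_def)
    have "(\<rho>', f') \<in> rep_points B A2 (A2_dim d e)"
      unfolding rep_points_A2_iff
    proof (intro conjI ballI)
      show "\<rho>' \<in> extensional {1, 2}" by (simp add: \<rho>'_def)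
      show "\<rho>' 1 \<in> module_structures B d"
        unfolding \<rho>'1 using point g1D
        by (intro module_structures_conj B) (simp_all add: rep_points_A2_iff)
      show "\<rho>' 2 \<in> module_structures B e"
        unfolding \<rho>'2 using point g2D
        by (intro module_structures_conj B) (simp_all add: rep_points_A2_iff)
      show "f' () \<in> carrier_mat e d" using f g1D g2D by (simp add: f'_def)
      fix b assume b: "b \<in> carrier B"
      have "f' () * \<rho>' 1 b = g 2 * (f () * \<rho> 1 b) * ?h1"
        unfolding f'_def \<rho>'1 using b conj_mult_conj[OF g2D(1) f g1D(2,1) mats(1)[OF b] g1D(2,4)] by simp
      also have "f () * \<rho> 1 b = \<rho> 2 b * f ()"
        using point b by (simp add: rep_points_A2_iff)
      also have "g 2 * (\<rho> 2 b * f ()) * ?h1 = \<rho>' 2 b * f' ()"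
        unfolding f'_def \<rho>'2 using b conj_mult_conj[OF g2D(1) mats(2)[OF b] g2D(2,1) f g1D(2) g2D(4)] by simp
      finally show "f' () * \<rho>' 1 b = \<rho>' 2 b * f' ()" .
    qed
    moreover have "coordinate_iso V d (\<lambda>v. g 1 *\<^sub>v \<phi> v)" "coordinate_iso W e (\<lambda>w. g 2 *\<^sub>v \<psi> w)"
      using coordinate_iso_mult \<phi> \<psi> g1 g2 by blast+
    moreover have "g 1 *\<^sub>v \<phi> (v \<triangleleft>\<^bsub>V\<^esub> b) = \<rho>' 1 b *\<^sub>v (g 1 *\<^sub>v \<phi> v)"
      if v: "v \<in> carrier V" and b: "b \<in> carrier B" for v b
    proof -
      have "\<phi> v \<in> carrier_vec d" using range[OF \<phi>] v by blast
      from conj_intertwines[of \<phi> v _ \<phi> "v \<triangleleft>\<^bsub>V\<^esub> b", OF refl \<phi>_act[OF v b] this mats(1)[OF b] g1D(1,1,2,4)]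
      show ?thesis unfolding \<rho>'1 using b by simp
    qed
    moreover have "g 2 *\<^sub>v \<psi> (w \<triangleleft>\<^bsub>W\<^esub> b) = \<rho>' 2 b *\<^sub>v (g 2 *\<^sub>v \<psi> w)"
      if w: "w \<in> carrier W" and b: "b \<in> carrier B" for w b
    proof -
      have "\<psi> w \<in> carrier_vec e" using range'[OF \<psi>] w by blast
      from conj_intertwines[of \<psi> w _ \<psi> "w \<triangleleft>\<^bsub>W\<^esub> b", OF refl \<psi>_act[OF w b] this mats(2)[OF b] g2D(1,1,2,4)]
      show ?thesis unfolding \<rho>'2 using b by simp
    qed
    moreover have "g 2 *\<^sub>v \<psi> (F v) = f' () *\<^sub>v (g 1 *\<^sub>v \<phi> v)" if v: "v \<in> carrier V" for v
    proof -
      have "\<phi> v \<in> carrier_vec d" using range[OF \<phi>] v by blast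
      from conj_intertwines[of \<phi> v _ \<psi> "F v", OF refl \<psi>_F[OF v] this f g2D(1) g1D(1,2,4)]
      show ?thesis unfolding f'_def .
    qed
    ultimately show "x \<in> orbit_of_representation B V W F"
      unfolding x' orbit_of_representation_def dims Let_def mem_Collect_eq case_prod_conv
      by (intro conjI exI[of _ "\<lambda>v. g 1 *\<^sub>v \<phi> v"] exI[of _ "\<lambda>w. g 2 *\<^sub>v \<psi> w"] ballI) blast+
  }
qed

lemma vec_add_right_cancel:
  fixes x y z :: "complex vec"
  assumes "x + z = y + z" "x \<in> carrier_vec n" "y \<in> carrier_vec n" "z \<in> carrier_vec n"
  shows "x = y"
proof (rule eq_vecI)
  fix i assume "i < dim_vec y"
  then have "(x + z) $ i = x $ i + z $ i" "(y + z) $ i = y $ i + z $ i" using assms(2-4) by auto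
  then show "x $ i = y $ i" using assms(1) by simp
qed (use assms in auto)

section \<open>Coordinates on quotients and kernels\<close>

lemma coset_eq_fibre:
  fixes W :: "('b, 'y) rmodule"
  assumes W: "vectorspace class_ring W" and \<kappa>: "\<kappa> \<in> linear_maps W (column_space d)"
    and w: "w \<in> carrier W"
  shows "{v \<in> carrier W. \<kappa> v = 0\<^sub>v d} +>\<^bsub>W\<^esub> w = {v \<in> carrier W. \<kappa> v = \<kappa> w}"
proof -
  interpret W: vectorspace class_ring W by (rule W)
  have \<kappa>_closed: "\<kappa> v \<in> carrier_vec d" if "v \<in> carrier W" for v
    using \<kappa> that by (auto simp: linear_maps_iff module_vec_simps)
  have \<kappa>_add: "\<kappa> (v \<oplus>\<^bsub>W\<^esub> v') = \<kappa> v + \<kappa> v'" if "v \<in> carrier W" "v' \<in> carrier W" for v v'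
    using \<kappa> that by (auto simp: linear_maps_iff module_vec_simps)
  have "v \<in> {v \<in> carrier W. \<kappa> v = 0\<^sub>v d} +>\<^bsub>W\<^esub> w" if v: "v \<in> carrier W" "\<kappa> v = \<kappa> w" for v
  proof -
    let ?u = "v \<ominus>\<^bsub>W\<^esub> w"
    have u: "?u \<in> carrier W" "v = ?u \<oplus>\<^bsub>W\<^esub> w"
      using v(1) w by (simp_all add: W.M.minus_eq W.M.add.m_assoc W.M.l_neg)
    have "\<kappa> ?u + \<kappa> w = 0\<^sub>v d + \<kappa> w"
      using \<kappa>_add[OF u(1) w] u(2) v(2) \<kappa>_closed[OF w] by simp
    then have "\<kappa> ?u = 0\<^sub>v d"
      by (rule vec_add_right_cancel[OF _ \<kappa>_closed[OF u(1)] zero_carrier_vec \<kappa>_closed[OF w]])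
    then show ?thesis
      using u by (auto simp: a_r_coset_def')
  qed
  moreover have "v \<in> carrier W \<and> \<kappa> v = \<kappa> w"
    if "v \<in> {v \<in> carrier W. \<kappa> v = 0\<^sub>v d} +>\<^bsub>W\<^esub> w" for v
    using that w \<kappa>_closed by (auto simp: a_r_coset_def' \<kappa>_add)
  ultimately show ?thesis by blast
qed

text \<open>
  The first isomorphism theorem for the quotient by the kernel of \<open>\<kappa>\<close>.  The cosets are the fibres of \<open>\<kappa>\<close>, so
  \<open>\<kappa>\<close> induces the coordinates, and the operations on representatives are well defined since \<open>\<kappa>\<close>
  is compatible with them.
\<close>
lemma quotient_coordinates:
  fixes W :: "('b, 'y) rmodule"
  assumes W: "right_module B W" and \<kappa>: "\<kappa> \<in> linear_maps W (column_space d)"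
    and surj: "\<kappa> ` carrier W = carrier_vec d"
    and \<sigma>: "\<And>b. b \<in> carrier B \<Longrightarrow> \<sigma> b \<in> carrier_mat d d"
    and act: "\<And>w b. w \<in> carrier W \<Longrightarrow> b \<in> carrier B \<Longrightarrow> \<kappa> (w \<triangleleft>\<^bsub>W\<^esub> b) = \<sigma> b *\<^sub>v \<kappa> w"
    and N: "N = {w \<in> carrier W. \<kappa> w = 0\<^sub>v d}"
  defines "Q \<equiv> quotient_module W N"
  obtains \<psi> where "vectorspace class_ring Q" "coordinate_iso Q d \<psi>"
    "\<And>w. w \<in> carrier W \<Longrightarrow> N +>\<^bsub>W\<^esub> w \<in> carrier Q"
    "\<And>w. w \<in> carrier W \<Longrightarrow> \<psi> (N +>\<^bsub>W\<^esub> w) = \<kappa> w"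
    "\<And>q b. q \<in> carrier Q \<Longrightarrow> b \<in> carrier B \<Longrightarrow> q \<triangleleft>\<^bsub>Q\<^esub> b \<in> carrier Q"
    "\<And>q b. q \<in> carrier Q \<Longrightarrow> b \<in> carrier B \<Longrightarrow> \<psi> (q \<triangleleft>\<^bsub>Q\<^esub> b) = \<sigma> b *\<^sub>v \<psi> q"
proof -
  interpret M: right_module B W by (rule W)
  interpret W: vectorspace class_ring W by (rule M.vectorspace)
  let ?\<pi> = "\<lambda>w. N +>\<^bsub>W\<^esub> w"
  have fibre: "?\<pi> w = {v \<in> carrier W. \<kappa> v = \<kappa> w}" if "w \<in> carrier W" for w
    unfolding N using coset_eq_fibre[OF M.vectorspace \<kappa> that] .
  have \<kappa>_closed: "\<kappa> v \<in> carrier_vec d" and \<kappa>_smult: "\<kappa> (c \<odot>\<^bsub>W\<^esub> v) = c \<cdot>\<^sub>v \<kappa> v"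
    if "v \<in> carrier W" for v c
    using \<kappa> that by (auto simp: linear_maps_iff module_vec_simps)
  have \<kappa>_add: "\<kappa> (v \<oplus>\<^bsub>W\<^esub> v') = \<kappa> v + \<kappa> v'" if "v \<in> carrier W" "v' \<in> carrier W" for v v'
    using \<kappa> that by (auto simp: linear_maps_iff module_vec_simps)
  have smult_closed: "c \<odot>\<^bsub>W\<^esub> v \<in> carrier W" if "v \<in> carrier W" for c v
    using W.smult_closed[of c v] that by simp
  have \<pi>_eq: "?\<pi> v = ?\<pi> w" if "v \<in> carrier W" "w \<in> carrier W" "\<kappa> v = \<kappa> w" for v w
    using that by (simp add: fibre)
  have Q_carrier: "carrier Q = ?\<pi> ` carrier W"
    by (auto simp: Q_def quotient_module_def A_RCOSETS_def')
  have in_Q: "\<exists>w \<in> carrier W. q = ?\<pi> w" if "q \<in> carrier Q" for q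
    using that by (auto simp: Q_carrier)
  have \<kappa>_zero: "\<kappa> \<zero>\<^bsub>W\<^esub> = 0\<^sub>v d" by (rule linear_map_zero[OF M.vectorspace \<kappa>])
  have zero: "\<zero>\<^bsub>Q\<^esub> = ?\<pi> \<zero>\<^bsub>W\<^esub>"
    by (simp add: Q_def quotient_module_def fibre \<kappa>_zero) (simp add: N)
  have add: "?\<pi> v \<oplus>\<^bsub>Q\<^esub> ?\<pi> w = ?\<pi> (v \<oplus>\<^bsub>W\<^esub> w)" if v: "v \<in> carrier W" and w: "w \<in> carrier W" for v w
  proof -
    have "x \<in> ?\<pi> v <+>\<^bsub>W\<^esub> ?\<pi> w" if x: "x \<in> carrier W" "\<kappa> x = \<kappa> (v \<oplus>\<^bsub>W\<^esub> w)" for x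
    proof -
      let ?u = "x \<ominus>\<^bsub>W\<^esub> w"
      have u: "?u \<in> carrier W" "x = ?u \<oplus>\<^bsub>W\<^esub> w"
        using x(1) w by (simp_all add: W.M.minus_eq W.M.add.m_assoc W.M.l_neg)
      have "\<kappa> ?u + \<kappa> w = \<kappa> v + \<kappa> w"
        using \<kappa>_add[OF u(1) w] \<kappa>_add[OF v w] u(2) x(2) by simp
      then have "\<kappa> ?u = \<kappa> v"
        by (rule vec_add_right_cancel[OF _ \<kappa>_closed[OF u(1)] \<kappa>_closed[OF v] \<kappa>_closed[OF w]])
      then show ?thesis
        unfolding set_add_def' fibre[OF v] fibre[OF w] using u w by blast
    qed
    moreover have "x \<in> carrier W \<and> \<kappa> x = \<kappa> (v \<oplus>\<^bsub>W\<^esub> w)" if "x \<in> ?\<pi> v <+>\<^bsub>W\<^esub> ?\<pi> w" for x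
      using that v w unfolding set_add_def' fibre[OF v] fibre[OF w] by (auto simp: \<kappa>_add)
    moreover have "?\<pi> (v \<oplus>\<^bsub>W\<^esub> w) = {x \<in> carrier W. \<kappa> x = \<kappa> (v \<oplus>\<^bsub>W\<^esub> w)}"
      using v w by (intro fibre) simp
    ultimately have "?\<pi> v <+>\<^bsub>W\<^esub> ?\<pi> w = ?\<pi> (v \<oplus>\<^bsub>W\<^esub> w)" by blast
    then show ?thesis by (simp add: Q_def quotient_module_def)
  qed
  have smult: "c \<odot>\<^bsub>Q\<^esub> ?\<pi> v = ?\<pi> (c \<odot>\<^bsub>W\<^esub> v)" if v: "v \<in> carrier W" for c v
  proof -
    have "?\<pi> (c \<odot>\<^bsub>W\<^esub> u) = ?\<pi> (c \<odot>\<^bsub>W\<^esub> v)" if "u \<in> ?\<pi> v" for u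
    proof (rule \<pi>_eq)
      have u: "u \<in> carrier W" "\<kappa> u = \<kappa> v" using that unfolding fibre[OF v] by auto
      show "c \<odot>\<^bsub>W\<^esub> u \<in> carrier W" "c \<odot>\<^bsub>W\<^esub> v \<in> carrier W"
        using smult_closed u(1) v by auto
      show "\<kappa> (c \<odot>\<^bsub>W\<^esub> u) = \<kappa> (c \<odot>\<^bsub>W\<^esub> v)"
        unfolding \<kappa>_smult[OF u(1)] \<kappa>_smult[OF v] u(2) ..
    qed
    moreover have "v \<in> ?\<pi> v" using v unfolding fibre[OF v] by simp
    ultimately have "(\<Union>u \<in> ?\<pi> v. ?\<pi> (c \<odot>\<^bsub>W\<^esub> u)) = ?\<pi> (c \<odot>\<^bsub>W\<^esub> v)" by blast
    then show ?thesis by (simp add: Q_def quotient_module_def)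
  qed
  have Q_act: "?\<pi> v \<triangleleft>\<^bsub>Q\<^esub> b = ?\<pi> (v \<triangleleft>\<^bsub>W\<^esub> b)" if v: "v \<in> carrier W" and b: "b \<in> carrier B" for v b
  proof -
    have "?\<pi> (u \<triangleleft>\<^bsub>W\<^esub> b) = ?\<pi> (v \<triangleleft>\<^bsub>W\<^esub> b)" if "u \<in> ?\<pi> v" for u
    proof (rule \<pi>_eq)
      have u: "u \<in> carrier W" "\<kappa> u = \<kappa> v" using that unfolding fibre[OF v] by auto
      show "u \<triangleleft>\<^bsub>W\<^esub> b \<in> carrier W" "v \<triangleleft>\<^bsub>W\<^esub> b \<in> carrier W"
        using M.act_closed u(1) v b by auto
      show "\<kappa> (u \<triangleleft>\<^bsub>W\<^esub> b) = \<kappa> (v \<triangleleft>\<^bsub>W\<^esub> b)"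
        unfolding act[OF u(1) b] act[OF v b] u(2) ..
    qed
    moreover have "v \<in> ?\<pi> v" using v unfolding fibre[OF v] by simp
    ultimately have "(\<Union>u \<in> ?\<pi> v. ?\<pi> (u \<triangleleft>\<^bsub>W\<^esub> b)) = ?\<pi> (v \<triangleleft>\<^bsub>W\<^esub> b)" by blast
    then show ?thesis by (simp add: Q_def quotient_module_def)
  qed
  \<comment> \<open>All members of a coset have the same value under \<open>\<kappa>\<close>, so the choice does not matter.\<close>
  define \<psi> where "\<psi> = (\<lambda>q. \<kappa> (SOME w. w \<in> q))"
  have \<psi>: "\<psi> (?\<pi> w) = \<kappa> w" if "w \<in> carrier W" for w
  proof -
    have "w \<in> ?\<pi> w" using that unfolding fibre[OF that] by simp
    then have "(SOME v. v \<in> ?\<pi> w) \<in> ?\<pi> w" by (rule someI)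
    then have "\<kappa> (SOME v. v \<in> ?\<pi> w) = \<kappa> w" unfolding fibre[OF that] by simp
    then show ?thesis by (simp only: \<psi>_def)
  qed
  have "bij_betw \<psi> (carrier Q) (carrier_vec d)"
    unfolding bij_betw_def
  proof
    show "inj_on \<psi> (carrier Q)"
    proof (rule inj_onI)
      fix p q assume "p \<in> carrier Q" "q \<in> carrier Q" and eq: "\<psi> p = \<psi> q"
      then obtain v w where v: "v \<in> carrier W" "p = ?\<pi> v" and w: "w \<in> carrier W" "q = ?\<pi> w"
        using in_Q by blast
      then have "\<kappa> v = \<kappa> w" using eq \<psi> by simp
      then show "p = q" unfolding v(2) w(2) by (rule \<pi>_eq[OF v(1) w(1)])
    qed
    show "\<psi> ` carrier Q = carrier_vec d"
      unfolding Q_carrier image_image surj[symmetric] by (rule image_cong) (simp_all add: \<psi>)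
  qed
  moreover have "\<psi> \<in> linear_maps Q (column_space d)"
    unfolding linear_maps_iff module_vec_simps Q_carrier
    by (auto simp: \<psi> add smult \<kappa>_add \<kappa>_smult \<kappa>_closed smult_closed)
  ultimately have coord: "coordinate_iso Q d \<psi>" by (simp add: coordinate_iso_def)
  have "vectorspace class_ring Q"
    by (rule vectorspace_coordinate_iso[OF coord])
      (auto simp: Q_carrier zero \<psi> \<kappa>_zero add smult smult_closed)
  then show thesis
    by (rule that[OF _ coord]) (auto simp: Q_carrier \<psi> Q_act M.act_closed act)
qed

text \<open>
  The matrix \<open>K\<close> embeds the coordinates of the subspace and \<open>E\<close> is a left inverse of it, so the
  hypothesis on \<open>N\<close> says that \<open>N\<close> corresponds to the column space of \<open>K\<close>.
\<close>
lemma kernel_coordinates: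
  fixes V :: "('b, 'x) rmodule"
  assumes V: "right_module B V" and \<phi>: "coordinate_iso V n \<phi>"
    and K: "K \<in> carrier_mat n d" and E: "E \<in> carrier_mat d n" and EK: "E * K = 1\<^sub>m d"
    and N: "N \<subseteq> carrier V" "\<And>v. v \<in> carrier V \<Longrightarrow> v \<in> N \<longleftrightarrow> K *\<^sub>v (E *\<^sub>v \<phi> v) = \<phi> v"
    and N_act: "\<And>v b. v \<in> N \<Longrightarrow> b \<in> carrier B \<Longrightarrow> v \<triangleleft>\<^bsub>V\<^esub> b \<in> N"
  shows "coordinate_iso (V\<lparr>carrier := N\<rparr>) d (\<lambda>v. E *\<^sub>v \<phi> v)" "right_module B (V\<lparr>carrier := N\<rparr>)"
proof -
  interpret M: right_module B V by (rule V)
  interpret V: vectorspace class_ring V by (rule M.vectorspace)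
  have bij: "bij_betw \<phi> (carrier V) (carrier_vec n)"
    and lin: "\<phi> \<in> linear_maps V (column_space n)"
    using \<phi> by (auto simp: coordinate_iso_def)
  have \<phi>_closed: "\<phi> v \<in> carrier_vec n" and \<phi>_smult: "\<phi> (c \<odot>\<^bsub>V\<^esub> v) = c \<cdot>\<^sub>v \<phi> v"
    if "v \<in> carrier V" for v c
    using lin that by (auto simp: linear_maps_iff module_vec_simps)
  have \<phi>_add: "\<phi> (v \<oplus>\<^bsub>V\<^esub> v') = \<phi> v + \<phi> v'" if "v \<in> carrier V" "v' \<in> carrier V" for v v'
    using lin that by (auto simp: linear_maps_iff module_vec_simps)
  have smult_closed: "c \<odot>\<^bsub>V\<^esub> v \<in> carrier V" if "v \<in> carrier V" for c v
    using V.smult_closed[of c v] that by simp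
  have NV: "v \<in> carrier V" if "v \<in> N" for v using N(1) that by blast
  have K_E: "K *\<^sub>v (E *\<^sub>v \<phi> v) = \<phi> v" if "v \<in> N" for v using N(2)[OF NV[OF that]] that by blast
  have \<phi>_zero: "\<phi> \<zero>\<^bsub>V\<^esub> = 0\<^sub>v n" by (rule linear_map_zero[OF M.vectorspace lin])
  let ?\<chi> = "\<lambda>v. E *\<^sub>v \<phi> v"
  have \<chi>_add: "?\<chi> (v \<oplus>\<^bsub>V\<^esub> w) = ?\<chi> v + ?\<chi> w" if "v \<in> carrier V" "w \<in> carrier V" for v w
    using that by (simp add: \<phi>_add mult_add_distrib_mat_vec[OF E \<phi>_closed \<phi>_closed])
  have \<chi>_smult: "?\<chi> (c \<odot>\<^bsub>V\<^esub> v) = c \<cdot>\<^sub>v ?\<chi> v" if "v \<in> carrier V" for c v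
    using that by (simp add: \<phi>_smult mult_mat_vec[OF E \<phi>_closed])
  have \<chi>_closed: "?\<chi> v \<in> carrier_vec d" if "v \<in> carrier V" for v
    using mult_mat_vec_carrier[OF E \<phi>_closed] that by blast
  have N_add: "v \<oplus>\<^bsub>V\<^esub> w \<in> N" if "v \<in> N" "w \<in> N" for v w
  proof -
    have "K *\<^sub>v ?\<chi> (v \<oplus>\<^bsub>V\<^esub> w) = K *\<^sub>v ?\<chi> v + K *\<^sub>v ?\<chi> w"
      unfolding \<chi>_add[OF NV NV, OF that]
      using that by (intro mult_add_distrib_mat_vec[OF K] \<chi>_closed NV)
    then show ?thesis using that NV by (simp add: N(2) K_E \<phi>_add)
  qed
  have N_smult: "c \<odot>\<^bsub>V\<^esub> v \<in> N" if "v \<in> N" for c v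
  proof -
    have "K *\<^sub>v ?\<chi> (c \<odot>\<^bsub>V\<^esub> v) = c \<cdot>\<^sub>v (K *\<^sub>v ?\<chi> v)"
      unfolding \<chi>_smult[OF NV, OF that]
      using that by (intro mult_mat_vec[OF K] \<chi>_closed NV)
    then show ?thesis using that NV by (simp add: N(2) K_E \<phi>_smult smult_closed)
  qed
  have zeros: "E *\<^sub>v 0\<^sub>v n = 0\<^sub>v d" "K *\<^sub>v 0\<^sub>v d = 0\<^sub>v n"
    using E K by (auto intro!: eq_vecI)
  have N_zero: "\<zero>\<^bsub>V\<^esub> \<in> N" by (simp add: N(2) \<phi>_zero zeros)
  let ?N = "V\<lparr>carrier := N\<rparr>"
  have "bij_betw ?\<chi> N (carrier_vec d)"
    unfolding bij_betw_def
  proof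
    show "inj_on ?\<chi> N"
    proof (rule inj_onI)
      fix v w assume v: "v \<in> N" "w \<in> N" "?\<chi> v = ?\<chi> w"
      then have "\<phi> v = \<phi> w" using K_E by metis
      then show "v = w" using v bij NV by (auto simp: bij_betw_def inj_on_def)
    qed
    show "?\<chi> ` N = carrier_vec d"
    proof (intro equalityI subsetI)
      fix x assume "x \<in> ?\<chi> ` N"
      then show "x \<in> carrier_vec d" using \<chi>_closed NV by blast
    next
      fix x :: "complex vec" assume x: "x \<in> carrier_vec d"
      have "K *\<^sub>v x \<in> carrier_vec n" using K x by simp
      then have "K *\<^sub>v x \<in> \<phi> ` carrier V" using bij by (simp add: bij_betw_def)
      then obtain v where v: "v \<in> carrier V" "\<phi> v = K *\<^sub>v x" by auto
      have "?\<chi> v = x"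
        unfolding v(2) using assoc_mult_mat_vec[OF E K x] EK x by simp
      moreover from this have "v \<in> N" using v by (simp add: N(2))
      ultimately show "x \<in> ?\<chi> ` N" by blast
    qed
  qed
  then show coord: "coordinate_iso ?N d ?\<chi>"
    using \<chi>_add \<chi>_smult \<chi>_closed NV
    by (auto simp: coordinate_iso_def linear_maps_iff module_vec_simps)
  have "vectorspace class_ring ?N"
    by (rule vectorspace_coordinate_iso[OF coord])
      (auto simp: N_zero \<phi>_zero zeros N_add N_smult)
  then show "right_module B ?N"
    by (rule right_module.intro)
      (auto simp: N_act NV M.act_add_left M.act_add_right M.act_smult_left M.act_smult_right
        M.act_mult M.act_one)
qed

section \<open>Lifting cokernels and kernels to representation varieties\<close>

lemma rational_on_mat_mult:
  assumes M: "\<And>y. y \<in> S \<Longrightarrow> M y \<in> carrier_mat p q" and N: "\<And>y. y \<in> S \<Longrightarrow> N y \<in> carrier_mat q r"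
    and M_rat: "\<And>i j. i < p \<Longrightarrow> j < q \<Longrightarrow> rational_on G S (\<lambda>y. M y $$ (i, j))"
    and N_rat: "\<And>i j. i < q \<Longrightarrow> j < r \<Longrightarrow> rational_on G S (\<lambda>y. N y $$ (i, j))"
    and ij: "i < p" "j < r"
  shows "rational_on G S (\<lambda>y. (M y * N y) $$ (i, j))"
proof (rule rational_on_cong)
  show "rational_on G S (\<lambda>y. \<Sum>k<q. M y $$ (i, k) * N y $$ (k, j))"
    using ij by (intro rational_on_sum rational_on_mult M_rat N_rat) auto
  show "(\<Sum>k<q. M y $$ (i, k) * N y $$ (k, j)) = (M y * N y) $$ (i, j)" if "y \<in> S" for y
    using mult_mat_index_sum[OF M[OF that] N[OF that] ij] by simp
qed

definition A2_point ::
    "('b \<Rightarrow> complex mat) \<Rightarrow> ('b \<Rightarrow> complex mat) \<Rightarrow> complex mat \<Rightarrow> (nat, unit, 'b) rep_point" where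
  "A2_point \<rho> \<sigma> A = (\<lambda>i \<in> {1, 2}. if i = 1 then \<rho> else \<sigma>, \<lambda>_. A)"

text \<open>
  On each piece the dimension vector is constant, so the map goes into a single component of the coproduct, and
  all coordinates of the image point are entries of its three families of matrices.
\<close>
lemma constructible_map_to_representations:
  fixes \<rho> \<sigma> :: "'a \<Rightarrow> 'b \<Rightarrow> complex mat"
  assumes \<S>: "finite \<S>" "disjoint \<S>" "\<Union>\<S> = X" "\<And>S. S \<in> \<S> \<Longrightarrow> locally_closedin (zariski X G) S"
    and \<delta>: "\<And>S x y. S \<in> \<S> \<Longrightarrow> x \<in> S \<Longrightarrow> y \<in> S \<Longrightarrow> \<delta> x = \<delta> y" "\<And>x. x \<in> X \<Longrightarrow> \<delta> x \<in> I"
    and point: "\<And>x. x \<in> X \<Longrightarrow> A2_point (\<rho> x) (\<sigma> x) (F x) \<in> rep_points B A2 (A2_dim (p (\<delta> x)) (q (\<delta> x)))"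
    and \<rho>: "\<And>S x b i j. S \<in> \<S> \<Longrightarrow> x \<in> S \<Longrightarrow> b \<in> carrier B \<Longrightarrow> i < p (\<delta> x) \<Longrightarrow> j < p (\<delta> x) \<Longrightarrow>
      rational_on G S (\<lambda>y. \<rho> y b $$ (i, j))"
    and \<sigma>: "\<And>S x b i j. S \<in> \<S> \<Longrightarrow> x \<in> S \<Longrightarrow> b \<in> carrier B \<Longrightarrow> i < q (\<delta> x) \<Longrightarrow> j < q (\<delta> x) \<Longrightarrow>
      rational_on G S (\<lambda>y. \<sigma> y b $$ (i, j))"
    and F: "\<And>S x i j. S \<in> \<S> \<Longrightarrow> x \<in> S \<Longrightarrow> i < q (\<delta> x) \<Longrightarrow> j < p (\<delta> x) \<Longrightarrow>
      rational_on G S (\<lambda>y. F y $$ (i, j))"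
  shows "constructible_map (affine_variety X G)
    (coproduct_variety I (\<lambda>d. rep_variety B A2 (A2_dim (p d) (q d))))
    (\<lambda>x. (\<delta> x, A2_point (\<rho> x) (\<sigma> x) (F x)))"
proof -
  let ?D = "\<lambda>d. A2_dim (p d) (q d)" and ?r = "\<lambda>x. A2_point (\<rho> x) (\<sigma> x) (F x)"
  have morphism: "variety_morphism (subvariety (affine_variety X G) S)
      (coproduct_variety I (\<lambda>d. affine_variety (rep_points B A2 (?D d)) (rep_coordinates B A2 (?D d))))
      (\<lambda>x. (\<delta> x, ?r x))" if S: "S \<in> \<S>" for S
  proof (cases "S = {}")
    case True
    then show ?thesis
      by (auto simp: variety_morphism_def subvariety_def)
  next
    case False
    then obtain x0 where x0: "x0 \<in> S" by blast
    have SX: "S \<subseteq> X" using S \<S>(3) by blast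
    show ?thesis
    proof (rule rational_imp_morphism_to_component[where i = "\<delta> x0" and \<phi> = ?r])
      show "S \<subseteq> X" by (rule SX)
      show "\<delta> x0 \<in> I" using \<delta>(2) SX x0 by blast
      fix x assume x: "x \<in> S"
      have \<delta>x: "\<delta> x = \<delta> x0" by (rule \<delta>(1)[OF S x x0])
      then show "(\<delta> x, ?r x) = (\<delta> x0, ?r x)" by simp
      show "?r x \<in> rep_points B A2 (?D (\<delta> x0))"
        using point[of x] SX x \<delta>x by auto
    next
      fix c assume "c \<in> rep_coordinates B A2 (?D (\<delta> x0))"
      then consider
        (module) i b j k where "c = (\<lambda>(\<rho>, f). \<rho> i b $$ (j, k))" "i \<in> {1, 2}" "b \<in> carrier B"
          "j < ?D (\<delta> x0) i" "k < ?D (\<delta> x0) i"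
        | (map) j k where "c = (\<lambda>(\<rho>, f). f () $$ (j, k))" "j < q (\<delta> x0)" "k < p (\<delta> x0)"
        unfolding rep_coordinates_def by (auto simp: A2_def A2_dim_def)
      then show "rational_on G S (\<lambda>x. c (?r x))"
      proof cases
        case module
        then show ?thesis
          using \<rho>[OF S x0] \<sigma>[OF S x0] by (auto simp: A2_point_def A2_dim_def)
      next
        case map
        then show ?thesis using F[OF S x0] by (simp add: A2_point_def)
      qed
    qed
  qed
  show ?thesis
    unfolding constructible_map_def rep_variety_def
    using \<S> morphism by (intro exI[of _ \<S>]) auto
qed

lemma right_module_coordinates:
  assumes B: "fin_dim_algebra B" and V: "right_module B V" and gen: "finitely_generated B V"
    and dim: "vectorspace.dim class_ring V = n"
  obtains \<phi> \<rho> where "coordinate_iso V n \<phi>" "\<rho> \<in> module_structures B n"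
    "\<And>v b. v \<in> carrier V \<Longrightarrow> b \<in> carrier B \<Longrightarrow> \<phi> (v \<triangleleft>\<^bsub>V\<^esub> b) = \<rho> b *\<^sub>v \<phi> v"
proof -
  interpret M: right_module B V by (rule V)
  obtain \<phi> where \<phi>: "coordinate_iso V n \<phi>"
    using coordinate_iso_exists[OF M.vectorspace finitely_generated_fin_dim[OF B V gen]] dim by blast
  define \<rho> where "\<rho> = (\<lambda>b \<in> carrier B. coord_matrix V n \<phi> n \<phi> (\<lambda>v. v \<triangleleft>\<^bsub>V\<^esub> b))"
  have lin: "\<phi> \<in> linear_maps V (column_space n)" and range: "\<phi> ` carrier V = carrier_vec n"
    using \<phi> by (auto simp: coordinate_iso_def bij_betw_def)
  have act: "\<phi> (v \<triangleleft>\<^bsub>V\<^esub> b) = \<rho> b *\<^sub>v \<phi> v" if "v \<in> carrier V" "b \<in> carrier B" for v b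
  proof -
    have "(\<lambda>v. v \<triangleleft>\<^bsub>V\<^esub> b) \<in> linear_maps V V"
      using that by (simp add: linear_maps_iff M.act_closed M.act_add_left M.act_smult_left)
    from coord_matrix_mult_vec[OF M.vectorspace \<phi> this lin that(1)] show ?thesis
      using that by (simp add: \<rho>_def)
  qed
  have "\<rho> \<in> module_structures B n"
    by (rule module_structures_of_linear_image[OF B V lin range _ act]) (auto simp: \<rho>_def)
  then show thesis using that \<phi> act by blast
qed

lemma hom_matrix_entry_linear:
  fixes L :: "('b, 'l) rmodule" and M :: "('b, 'm) rmodule"
  assumes \<phi>: "coordinate_iso L n \<phi>" and \<psi>: "coordinate_iso M m \<psi>" and i: "i < m" and j: "j < n"
  shows "(\<lambda>l. coord_matrix L n \<phi> m \<psi> l $$ (i, j)) \<in>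
    {\<xi>. (\<forall>f \<in> carrier (Hom B L M). \<forall>g \<in> carrier (Hom B L M).
           \<xi> (f \<oplus>\<^bsub>Hom B L M\<^esub> g) = \<xi> f + \<xi> g) \<and>
        (\<forall>c. \<forall>f \<in> carrier (Hom B L M). \<xi> (c \<odot>\<^bsub>Hom B L M\<^esub> f) = c * \<xi> f)}"
proof -
  define v where "v = inv_into (carrier L) \<phi> (unit_vec n j)"
  have "unit_vec n j \<in> \<phi> ` carrier L"
    using \<phi> by (auto simp: coordinate_iso_def bij_betw_def)
  then have v: "v \<in> carrier L" unfolding v_def by (rule inv_into_into)
  have \<psi>: "\<psi> w \<in> carrier_vec m" "\<psi> (w \<oplus>\<^bsub>M\<^esub> w') = \<psi> w + \<psi> w'" "\<psi> (c \<odot>\<^bsub>M\<^esub> w) = c \<cdot>\<^sub>v \<psi> w"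
    if "w \<in> carrier M" "w' \<in> carrier M" for w w' c
    using \<psi> that by (auto simp: coordinate_iso_def linear_maps_iff module_vec_simps)
  have entry: "coord_matrix L n \<phi> m \<psi> l $$ (i, j) = \<psi> (l v) $ i" for l
    using i j by (simp add: coord_matrix_def v_def)
  have closed: "f v \<in> carrier M" if "f \<in> carrier (Hom B L M)" for f
    using that v by (auto simp: Hom_def rmodule_hom_def)
  show ?thesis
    unfolding entry
  proof (rule CollectI, intro conjI ballI allI)
    fix f g assume "f \<in> carrier (Hom B L M)" "g \<in> carrier (Hom B L M)"
    then have f: "f v \<in> carrier M" and g: "g v \<in> carrier M" using closed by auto
    have "(f \<oplus>\<^bsub>Hom B L M\<^esub> g) v = f v \<oplus>\<^bsub>M\<^esub> g v" using v by (simp add: Hom_def)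
    then show "\<psi> ((f \<oplus>\<^bsub>Hom B L M\<^esub> g) v) $ i = \<psi> (f v) $ i + \<psi> (g v) $ i"
      using \<psi>[OF f g] \<psi>(1)[OF g f] i by simp
  next
    fix c f assume "f \<in> carrier (Hom B L M)"
    then have f: "f v \<in> carrier M" using closed by auto
    have "(c \<odot>\<^bsub>Hom B L M\<^esub> f) v = c \<odot>\<^bsub>M\<^esub> f v" using v by (simp add: Hom_def)
    then show "\<psi> ((c \<odot>\<^bsub>Hom B L M\<^esub> f) v) $ i = c * \<psi> (f v) $ i"
      using \<psi>[OF f f] i by simp
  qed
qed

text \<open>
  The relation \<open>E * C + A * U = 1\<close> writes the coordinates of an element of \<open>M\<close> as \<open>E\<close> applied to
  its class plus the coordinates of an element of the image of \<open>l\<close>.  This identifies the image of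
  \<open>l\<close> with the kernel of \<open>\<kappa>\<close>, and shows that \<open>C * \<rho> b * E\<close> is the action induced on classes.
\<close>
lemma cokernel_point:
  fixes L :: "('b, 'l) rmodule" and M :: "('b, 'm) rmodule"
  assumes B: "fin_dim_algebra B" and L: "right_module B L" and M: "right_module B M"
    and \<phi>: "coordinate_iso L n \<phi>" and \<psi>: "coordinate_iso M m \<psi>"
    and \<rho>: "\<rho> \<in> module_structures B m"
    and \<rho>_act: "\<And>w b. w \<in> carrier M \<Longrightarrow> b \<in> carrier B \<Longrightarrow> \<psi> (w \<triangleleft>\<^bsub>M\<^esub> b) = \<rho> b *\<^sub>v \<psi> w"
    and l: "l \<in> carrier (Hom B L M)"
    and split: "split_cokernel (coord_matrix L n \<phi> m \<psi> l) C E"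
  defines "x \<equiv> A2_point \<rho> (\<lambda>b \<in> carrier B. C * \<rho> b * E) C"
  shows "x \<in> rep_points B A2 (A2_dim m (dim_row C))"
    and "orbit_projection B (\<lambda>d. A2_dim m d) (dim_row C, x) = coker_orbit B L M l"
proof -
  interpret L: right_module B L by (rule L)
  interpret M: right_module B M by (rule M)
  define A where "A = coord_matrix L n \<phi> m \<psi> l"
  define d where "d = dim_row C"
  have A: "A \<in> carrier_mat m n" by (simp add: A_def)
  note split = split_cokernelD[OF split[folded A_def] A]
  have C: "C \<in> carrier_mat d m" and E: "E \<in> carrier_mat m d" and CE: "C * E = 1\<^sub>m d"
    and CA: "C * A = 0\<^sub>m d n"
    unfolding d_def by (rule split)+
  obtain U where U: "U \<in> carrier_mat n m" and ECAU: "E * C + A * U = 1\<^sub>m m"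
    using split(5) by blast
  have l_lin: "l \<in> linear_maps L M" and l_act: "\<And>v b. v \<in> carrier L \<Longrightarrow> b \<in> carrier B \<Longrightarrow>
      l (v \<triangleleft>\<^bsub>L\<^esub> b) = l v \<triangleleft>\<^bsub>M\<^esub> b"
    using l by (auto simp: Hom_def rmodule_hom_def)
  have l_closed: "l v \<in> carrier M" if "v \<in> carrier L" for v
    using l_lin that by (simp add: linear_maps_iff)
  have \<phi>_bij: "bij_betw \<phi> (carrier L) (carrier_vec n)"
    using \<phi> by (auto simp: coordinate_iso_def)
  have \<psi>_lin: "\<psi> \<in> linear_maps M (column_space m)" and \<psi>_bij: "bij_betw \<psi> (carrier M) (carrier_vec m)"
    using \<psi> by (auto simp: coordinate_iso_def)
  have \<phi>_closed: "\<phi> v \<in> carrier_vec n" if "v \<in> carrier L" for v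
    using \<phi>_bij that by (auto simp: bij_betw_def)
  have \<psi>_closed: "\<psi> w \<in> carrier_vec m" if "w \<in> carrier M" for w
    using \<psi>_bij that by (auto simp: bij_betw_def)
  have A_l: "A *\<^sub>v \<phi> v = \<psi> (l v)" if "v \<in> carrier L" for v
    unfolding A_def by (rule coord_matrix_mult_vec[OF L.vectorspace \<phi> l_lin \<psi>_lin that])
  have \<rho>_mat: "\<rho> b \<in> carrier_mat m m" if "b \<in> carrier B" for b
    using \<rho> that by (auto simp: module_structures_def)
  define \<kappa> where "\<kappa> = (\<lambda>w. C *\<^sub>v \<psi> w)"
  have \<kappa>_lin: "\<kappa> \<in> linear_maps M (column_space d)"
    using \<psi>_lin C by (auto simp: linear_maps_iff module_vec_simps \<kappa>_def
        mult_add_distrib_mat_vec[of _ d m] mult_mat_vec[of _ d m])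
  have \<kappa>_closed: "\<kappa> w \<in> carrier_vec d" if "w \<in> carrier M" for w
    using \<kappa>_lin that by (simp add: linear_maps_iff module_vec_simps)
  have \<kappa>_l: "\<kappa> (l v) = 0\<^sub>v d" if v: "v \<in> carrier L" for v
  proof -
    have "\<kappa> (l v) = (C * A) *\<^sub>v \<phi> v"
      unfolding \<kappa>_def A_l[OF v, symmetric]
      by (rule assoc_mult_mat_vec[OF C A \<phi>_closed[OF v], symmetric])
    then show ?thesis
      unfolding CA using \<phi>_closed[OF v] by (auto intro!: eq_vecI)
  qed
  have decompose: "\<exists>v \<in> carrier L. \<psi> w = E *\<^sub>v \<kappa> w + \<psi> (l v)" if w: "w \<in> carrier M" for w
  proof -
    have "U *\<^sub>v \<psi> w \<in> carrier_vec n" using U \<psi>_closed[OF w] by simp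
    then have "U *\<^sub>v \<psi> w \<in> \<phi> ` carrier L" using \<phi>_bij by (simp add: bij_betw_def)
    then obtain v where v: "v \<in> carrier L" "U *\<^sub>v \<psi> w = \<phi> v" by auto
    have "\<psi> w = (E * C + A * U) *\<^sub>v \<psi> w" using \<psi>_closed[OF w] by (simp add: ECAU)
    also have "\<dots> = (E * C) *\<^sub>v \<psi> w + (A * U) *\<^sub>v \<psi> w"
      by (rule add_mult_distrib_mat_vec[OF mult_carrier_mat[OF E C] mult_carrier_mat[OF A U]
            \<psi>_closed[OF w]])
    also have "(E * C) *\<^sub>v \<psi> w = E *\<^sub>v \<kappa> w"
      unfolding \<kappa>_def by (rule assoc_mult_mat_vec[OF E C \<psi>_closed[OF w]])
    also have "(A * U) *\<^sub>v \<psi> w = \<psi> (l v)"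
      unfolding assoc_mult_mat_vec[OF A U \<psi>_closed[OF w]] v(2) by (rule A_l[OF v(1)])
    finally show ?thesis using v(1) by blast
  qed
  have surj: "\<kappa> ` carrier M = carrier_vec d"
  proof (intro equalityI subsetI)
    fix y assume "y \<in> \<kappa> ` carrier M"
    then show "y \<in> carrier_vec d" using \<kappa>_closed by blast
  next
    fix y :: "complex vec" assume y: "y \<in> carrier_vec d"
    have "E *\<^sub>v y \<in> carrier_vec m" using E y by simp
    then have "E *\<^sub>v y \<in> \<psi> ` carrier M" using \<psi>_bij by (simp add: bij_betw_def)
    then obtain w where w: "w \<in> carrier M" "\<psi> w = E *\<^sub>v y" by auto
    have "\<kappa> w = y"
      unfolding \<kappa>_def w(2) using assoc_mult_mat_vec[OF C E y] CE y by simp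
    then show "y \<in> \<kappa> ` carrier M" using w(1) by blast
  qed
  have image: "l ` carrier L = {w \<in> carrier M. \<kappa> w = 0\<^sub>v d}"
  proof (intro equalityI subsetI)
    fix w assume "w \<in> l ` carrier L"
    then show "w \<in> {w \<in> carrier M. \<kappa> w = 0\<^sub>v d}" using \<kappa>_l l_closed by blast
  next
    fix w assume w: "w \<in> {w \<in> carrier M. \<kappa> w = 0\<^sub>v d}"
    then obtain v where v: "v \<in> carrier L" "\<psi> w = E *\<^sub>v 0\<^sub>v d + \<psi> (l v)"
      using decompose[of w] by auto
    have "E *\<^sub>v 0\<^sub>v d = 0\<^sub>v m" using E by (auto intro!: eq_vecI)
    then have "\<psi> w = \<psi> (l v)" using v \<psi>_closed[OF l_closed[OF v(1)]] by simp
    then have "w = l v"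
      using \<psi>_bij w l_closed[OF v(1)] by (auto simp: bij_betw_def inj_on_def)
    then show "w \<in> l ` carrier L" using v(1) by blast
  qed
  define \<sigma> where "\<sigma> = (\<lambda>b \<in> carrier B. C * \<rho> b * E)"
  have \<sigma>_mat: "\<sigma> b \<in> carrier_mat d d" if "b \<in> carrier B" for b
    using mult_carrier_mat[OF mult_carrier_mat[OF C \<rho>_mat[OF that]] E] that by (simp add: \<sigma>_def)
  have \<kappa>_act: "\<kappa> (w \<triangleleft>\<^bsub>M\<^esub> b) = \<sigma> b *\<^sub>v \<kappa> w" if w: "w \<in> carrier M" and b: "b \<in> carrier B" for w b
  proof -
    obtain v where v: "v \<in> carrier L" and decomp: "\<psi> w = E *\<^sub>v \<kappa> w + \<psi> (l v)"
      using decompose[OF w] by blast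
    have C\<rho>: "C * \<rho> b \<in> carrier_mat d m" using mult_carrier_mat[OF C \<rho>_mat[OF b]] .
    have lv: "\<psi> (l v) \<in> carrier_vec m" using \<psi>_closed[OF l_closed[OF v]] .
    have E\<kappa>: "E *\<^sub>v \<kappa> w \<in> carrier_vec m" using E \<kappa>_closed[OF w] by simp
    have act: "\<kappa> (u \<triangleleft>\<^bsub>M\<^esub> b) = (C * \<rho> b) *\<^sub>v \<psi> u" if "u \<in> carrier M" for u
      using assoc_mult_mat_vec[OF C \<rho>_mat[OF b] \<psi>_closed[OF that]] by (simp add: \<kappa>_def \<rho>_act that b)
    have "\<kappa> (w \<triangleleft>\<^bsub>M\<^esub> b) = (C * \<rho> b) *\<^sub>v (E *\<^sub>v \<kappa> w + \<psi> (l v))"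
      using act[OF w] decomp by simp
    also have "\<dots> = (C * \<rho> b) *\<^sub>v (E *\<^sub>v \<kappa> w) + (C * \<rho> b) *\<^sub>v \<psi> (l v)"
      by (rule mult_add_distrib_mat_vec[OF C\<rho> E\<kappa> lv])
    also have "(C * \<rho> b) *\<^sub>v (E *\<^sub>v \<kappa> w) = \<sigma> b *\<^sub>v \<kappa> w"
      using assoc_mult_mat_vec[OF C\<rho> E \<kappa>_closed[OF w]] b by (simp add: \<sigma>_def)
    \<comment> \<open>The image of \<open>l\<close> is a submodule, so \<open>\<kappa>\<close> also kills the products of its elements with \<open>b\<close>.\<close>
    also have "(C * \<rho> b) *\<^sub>v \<psi> (l v) = \<kappa> (l (v \<triangleleft>\<^bsub>L\<^esub> b))"
      using act[OF l_closed[OF v]] l_act[OF v b] by simp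
    also have "\<dots> = 0\<^sub>v d" by (rule \<kappa>_l[OF L.act_closed[OF v b]])
    also have "\<sigma> b *\<^sub>v \<kappa> w + 0\<^sub>v d = \<sigma> b *\<^sub>v \<kappa> w"
      using mult_mat_vec_carrier[OF \<sigma>_mat[OF b] \<kappa>_closed[OF w]] by simp
    finally show ?thesis .
  qed
  have "\<sigma> \<in> module_structures B d"
    by (rule module_structures_of_linear_image[OF B M \<kappa>_lin surj _ \<kappa>_act])
      (use \<sigma>_mat in \<open>auto simp: \<sigma>_def\<close>)
  moreover have "C * \<rho> b = \<sigma> b * C" if b: "b \<in> carrier B" for b
  proof (rule mat_eq_on_vecI)
    show "C * \<rho> b \<in> carrier_mat d m" using mult_carrier_mat[OF C \<rho>_mat[OF b]] .
    show "\<sigma> b * C \<in> carrier_mat d m" using mult_carrier_mat[OF \<sigma>_mat[OF b] C] .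
    fix y :: "complex vec" assume y: "y \<in> carrier_vec m"
    then have "y \<in> \<psi> ` carrier M" using \<psi>_bij by (simp add: bij_betw_def)
    then obtain w where w: "w \<in> carrier M" "y = \<psi> w" by auto
    show "(C * \<rho> b) *\<^sub>v y = (\<sigma> b * C) *\<^sub>v y"
      using \<kappa>_act[OF w(1) b] assoc_mult_mat_vec[OF C \<rho>_mat[OF b] y]
        assoc_mult_mat_vec[OF \<sigma>_mat[OF b] C y] by (simp add: \<kappa>_def \<rho>_act w b)
  qed
  ultimately show x_point: "x \<in> rep_points B A2 (A2_dim m (dim_row C))"
    using \<rho> C by (simp add: x_def A2_point_def rep_points_A2_iff flip: \<sigma>_def d_def)
  obtain \<chi> where \<chi>: "vectorspace class_ring (Coker L M l)" "coordinate_iso (Coker L M l) d \<chi>"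
    "\<And>w. w \<in> carrier M \<Longrightarrow> l ` carrier L +>\<^bsub>M\<^esub> w \<in> carrier (Coker L M l)"
    "\<And>w. w \<in> carrier M \<Longrightarrow> \<chi> (l ` carrier L +>\<^bsub>M\<^esub> w) = \<kappa> w"
    "\<And>q b. q \<in> carrier (Coker L M l) \<Longrightarrow> b \<in> carrier B \<Longrightarrow> q \<triangleleft>\<^bsub>Coker L M l\<^esub> b \<in> carrier (Coker L M l)"
    "\<And>q b. q \<in> carrier (Coker L M l) \<Longrightarrow> b \<in> carrier B \<Longrightarrow>
       \<chi> (q \<triangleleft>\<^bsub>Coker L M l\<^esub> b) = \<sigma> b *\<^sub>v \<chi> q"
    using quotient_coordinates[OF M \<kappa>_lin surj \<sigma>_mat \<kappa>_act image] unfolding Coker_def by blast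
  have "orbit_of_representation B M (Coker L M l) (Coker_proj L M l) = GL_orbit B A2 (A2_dim m d) x"
    unfolding x_def A2_point_def
  proof (rule orbit_of_representation_eq_GL_orbit[OF B M.vectorspace \<chi>(1) M.act_closed \<chi>(5) _ _ \<psi> \<chi>(2)])
    show "((\<lambda>i\<in>{1, 2}. if i = 1 then \<rho> else (\<lambda>b \<in> carrier B. C * \<rho> b * E)), (\<lambda>_. C))
        \<in> rep_points B A2 (A2_dim m d)"
      using x_point by (simp add: x_def A2_point_def d_def)
  qed (auto simp: Coker_proj_def \<chi> \<rho>_act \<sigma>_def \<kappa>_def)
  moreover have "vectorspace.dim class_ring (Coker L M l) = d"
    by (rule dim_eq_coordinate_iso[OF \<chi>(1,2)])
  ultimately show "orbit_projection B (\<lambda>d. A2_dim m d) (dim_row C, x) = coker_orbit B L M l"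
    by (simp add: orbit_projection_def coker_orbit_def d_def)
qed

text \<open>
  After transposition the relations read \<open>R * K = 1\<close>, \<open>A * K = 0\<close> and \<open>K * R + U\<^sup>T * A = 1\<close> with
  \<open>K = C\<^sup>T\<close> and \<open>R = E\<^sup>T\<close>.  They identify the kernel of \<open>A\<close> with the vectors fixed by \<open>K * R\<close>.
\<close>
lemma kernel_point:
  fixes L :: "('b, 'l) rmodule" and M :: "('b, 'm) rmodule"
  assumes B: "fin_dim_algebra B" and L: "right_module B L" and M: "right_module B M"
    and \<phi>: "coordinate_iso L n \<phi>" and \<psi>: "coordinate_iso M m \<psi>"
    and \<rho>: "\<rho> \<in> module_structures B n"
    and \<rho>_act: "\<And>v b. v \<in> carrier L \<Longrightarrow> b \<in> carrier B \<Longrightarrow> \<phi> (v \<triangleleft>\<^bsub>L\<^esub> b) = \<rho> b *\<^sub>v \<phi> v"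
    and l: "l \<in> carrier (Hom B L M)"
    and split: "split_cokernel (transpose_mat (coord_matrix L n \<phi> m \<psi> l)) C E"
  defines "x \<equiv> A2_point (\<lambda>b \<in> carrier B. transpose_mat E * \<rho> b * transpose_mat C) \<rho> (transpose_mat C)"
  shows "x \<in> rep_points B A2 (A2_dim (dim_row C) n)"
    and "orbit_projection B (\<lambda>d. A2_dim d n) (dim_row C, x) = ker_orbit B L M l"
proof -
  interpret L: right_module B L by (rule L)
  interpret M: right_module B M by (rule M)
  interpret LV: vectorspace class_ring L by (rule L.vectorspace)
  interpret MV: vectorspace class_ring M by (rule M.vectorspace)
  define A where "A = coord_matrix L n \<phi> m \<psi> l"
  define d where "d = dim_row C"
  define K where "K = transpose_mat C"
  define R where "R = transpose_mat E"
  have A: "A \<in> carrier_mat m n" by (simp add: A_def)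
  then have AT: "transpose_mat A \<in> carrier_mat n m" by simp
  note split = split_cokernelD[OF split[folded A_def] AT]
  have C: "C \<in> carrier_mat d n" and E: "E \<in> carrier_mat n d" and CE: "C * E = 1\<^sub>m d"
    and CA: "C * transpose_mat A = 0\<^sub>m d m"
    unfolding d_def by (rule split)+
  obtain U where U: "U \<in> carrier_mat m n" and ECAU: "E * C + transpose_mat A * U = 1\<^sub>m n"
    using split(5) by blast
  have K: "K \<in> carrier_mat n d" and R: "R \<in> carrier_mat d n" and UT: "transpose_mat U \<in> carrier_mat n m"
    using C E A U by (simp_all add: K_def R_def)
  have RK: "R * K = 1\<^sub>m d"
    using arg_cong[OF CE, of transpose_mat] by (simp add: transpose_mult[OF C E] K_def R_def)
  have AK: "A * K = 0\<^sub>m m d"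
  proof -
    have "transpose_mat (0\<^sub>m d m) = (0\<^sub>m m d :: complex mat)" by (intro eq_matI) auto
    then show ?thesis
      using arg_cong[OF CA, of transpose_mat] by (simp add: transpose_mult[OF C AT] K_def)
  qed
  have KRUA: "K * R + transpose_mat U * A = 1\<^sub>m n"
    using arg_cong[OF ECAU, of transpose_mat] A
    by (simp add: transpose_add[OF mult_carrier_mat[OF E C] mult_carrier_mat[OF AT U]]
        transpose_mult[OF E C] transpose_mult[OF AT U] K_def R_def)
  have l_lin: "l \<in> linear_maps L M" and l_act: "\<And>v b. v \<in> carrier L \<Longrightarrow> b \<in> carrier B \<Longrightarrow>
      l (v \<triangleleft>\<^bsub>L\<^esub> b) = l v \<triangleleft>\<^bsub>M\<^esub> b"
    using l by (auto simp: Hom_def rmodule_hom_def)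
  have l_closed: "l v \<in> carrier M" if "v \<in> carrier L" for v
    using l_lin that by (simp add: linear_maps_iff)
  have \<phi>_bij: "bij_betw \<phi> (carrier L) (carrier_vec n)"
    using \<phi> by (auto simp: coordinate_iso_def)
  have \<psi>_lin: "\<psi> \<in> linear_maps M (column_space m)" and \<psi>_bij: "bij_betw \<psi> (carrier M) (carrier_vec m)"
    using \<psi> by (auto simp: coordinate_iso_def)
  have \<phi>_closed: "\<phi> v \<in> carrier_vec n" if "v \<in> carrier L" for v
    using \<phi>_bij that by (auto simp: bij_betw_def)
  have A_l: "A *\<^sub>v \<phi> v = \<psi> (l v)" if "v \<in> carrier L" for v
    unfolding A_def by (rule coord_matrix_mult_vec[OF L.vectorspace \<phi> l_lin \<psi>_lin that])
  have \<psi>_zero: "\<psi> \<zero>\<^bsub>M\<^esub> = 0\<^sub>v m" by (rule linear_map_zero[OF M.vectorspace \<psi>_lin])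
  have \<rho>_mat: "\<rho> b \<in> carrier_mat n n" if "b \<in> carrier B" for b
    using \<rho> that by (auto simp: module_structures_def)
  define N where "N = a_kernel L M l"
  have N_iff: "v \<in> N \<longleftrightarrow> v \<in> carrier L \<and> l v = \<zero>\<^bsub>M\<^esub>" for v
    by (simp add: N_def a_kernel_def')
  have N_fixed: "v \<in> N \<longleftrightarrow> K *\<^sub>v (R *\<^sub>v \<phi> v) = \<phi> v" if v: "v \<in> carrier L" for v
  proof
    note \<phi>v = \<phi>_closed[OF v]
    assume "v \<in> N"
    then have A\<phi>: "A *\<^sub>v \<phi> v = 0\<^sub>v m" using A_l[OF v] by (simp add: N_iff \<psi>_zero)
    have "\<phi> v = (K * R + transpose_mat U * A) *\<^sub>v \<phi> v" using \<phi>v by (simp add: KRUA)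
    also have "\<dots> = (K * R) *\<^sub>v \<phi> v + (transpose_mat U * A) *\<^sub>v \<phi> v"
      by (rule add_mult_distrib_mat_vec[OF mult_carrier_mat[OF K R] mult_carrier_mat[OF UT A] \<phi>v])
    also have "(transpose_mat U * A) *\<^sub>v \<phi> v = 0\<^sub>v n"
      unfolding assoc_mult_mat_vec[OF UT A \<phi>v] A\<phi> using UT by (auto intro!: eq_vecI)
    also have "(K * R) *\<^sub>v \<phi> v = K *\<^sub>v (R *\<^sub>v \<phi> v)" by (rule assoc_mult_mat_vec[OF K R \<phi>v])
    also have "K *\<^sub>v (R *\<^sub>v \<phi> v) + 0\<^sub>v n = K *\<^sub>v (R *\<^sub>v \<phi> v)"
      using mult_mat_vec_carrier[OF K mult_mat_vec_carrier[OF R \<phi>v]] by simp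
    finally show "K *\<^sub>v (R *\<^sub>v \<phi> v) = \<phi> v" by (rule sym)
  next
    note R\<phi> = mult_mat_vec_carrier[OF R \<phi>_closed[OF v]]
    assume "K *\<^sub>v (R *\<^sub>v \<phi> v) = \<phi> v"
    then have "\<psi> (l v) = (A * K) *\<^sub>v (R *\<^sub>v \<phi> v)"
      using A_l[OF v] assoc_mult_mat_vec[OF A K R\<phi>] by simp
    also have "\<dots> = \<psi> \<zero>\<^bsub>M\<^esub>"
      unfolding AK \<psi>_zero using R\<phi> by (auto intro!: eq_vecI)
    finally have "l v = \<zero>\<^bsub>M\<^esub>"
      using \<psi>_bij l_closed[OF v] MV.zero_closed unfolding bij_betw_def inj_on_def by blast
    then show "v \<in> N" using v by (simp add: N_iff)
  qed
  have N_sub: "N \<subseteq> carrier L" by (auto simp: N_iff)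
  have N_act: "v \<triangleleft>\<^bsub>L\<^esub> b \<in> N" if v: "v \<in> N" and b: "b \<in> carrier B" for v b
  proof -
    have "\<zero>\<^bsub>M\<^esub> \<triangleleft>\<^bsub>M\<^esub> b = (0 \<odot>\<^bsub>M\<^esub> \<zero>\<^bsub>M\<^esub>) \<triangleleft>\<^bsub>M\<^esub> b"
      using MV.smult_l_null[OF MV.zero_closed] by simp
    also have "\<dots> = 0 \<odot>\<^bsub>M\<^esub> (\<zero>\<^bsub>M\<^esub> \<triangleleft>\<^bsub>M\<^esub> b)"
      by (rule M.act_smult_left[OF MV.zero_closed b])
    also have "\<dots> = \<zero>\<^bsub>M\<^esub>"
      using MV.smult_l_null[OF M.act_closed[OF MV.zero_closed b]] by simp
    finally show ?thesis
      using v b by (simp add: N_iff L.act_closed l_act)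
  qed
  have Ker_eq: "Ker L M l = L\<lparr>carrier := N\<rparr>" by (simp add: Ker_def N_def)
  let ?\<chi> = "\<lambda>v. R *\<^sub>v \<phi> v"
  have \<chi>: "coordinate_iso (Ker L M l) d ?\<chi>" and Ker: "right_module B (Ker L M l)"
    unfolding Ker_eq using kernel_coordinates[OF L \<phi> K R RK N_sub N_fixed N_act] by auto
  have Ker_sel: "carrier (Ker L M l) = N" "act (Ker L M l) = act L"
    by (simp_all add: Ker_eq)
  have \<chi>_lin: "?\<chi> \<in> linear_maps (Ker L M l) (column_space d)" and \<chi>_surj: "?\<chi> ` N = carrier_vec d"
    using \<chi> by (auto simp: coordinate_iso_def bij_betw_def Ker_sel)
  have K\<chi>: "K *\<^sub>v ?\<chi> v = \<phi> v" if "v \<in> N" for v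
    using N_fixed[of v] N_sub that by blast
  define \<sigma> where "\<sigma> = (\<lambda>b \<in> carrier B. R * \<rho> b * K)"
  have \<sigma>_mat: "\<sigma> b \<in> carrier_mat d d" if "b \<in> carrier B" for b
    using mult_carrier_mat[OF mult_carrier_mat[OF R \<rho>_mat[OF that]] K] that by (simp add: \<sigma>_def)
  have \<chi>_act: "?\<chi> (v \<triangleleft>\<^bsub>L\<^esub> b) = \<sigma> b *\<^sub>v ?\<chi> v" if v: "v \<in> N" and b: "b \<in> carrier B" for v b
  proof -
    have vL: "v \<in> carrier L" using v N_sub by blast
    note R\<phi> = mult_mat_vec_carrier[OF R \<phi>_closed[OF vL]]
    have "\<sigma> b *\<^sub>v ?\<chi> v = (R * \<rho> b) *\<^sub>v (K *\<^sub>v ?\<chi> v)"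
      using assoc_mult_mat_vec[OF mult_carrier_mat[OF R \<rho>_mat[OF b]] K R\<phi>] b by (simp add: \<sigma>_def)
    also have "\<dots> = R *\<^sub>v (\<rho> b *\<^sub>v \<phi> v)"
      unfolding K\<chi>[OF v] by (rule assoc_mult_mat_vec[OF R \<rho>_mat[OF b] \<phi>_closed[OF vL]])
    finally show ?thesis by (simp add: \<rho>_act[OF vL b])
  qed
  have "\<sigma> \<in> module_structures B d"
    by (rule module_structures_of_linear_image[OF B Ker \<chi>_lin])
      (use \<sigma>_mat \<chi>_surj \<chi>_act in \<open>auto simp: \<sigma>_def Ker_sel\<close>)
  moreover have "K * \<sigma> b = \<rho> b * K" if b: "b \<in> carrier B" for b
  proof (rule mat_eq_on_vecI)
    show "K * \<sigma> b \<in> carrier_mat n d" using mult_carrier_mat[OF K \<sigma>_mat[OF b]] .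
    show "\<rho> b * K \<in> carrier_mat n d" using mult_carrier_mat[OF \<rho>_mat[OF b] K] .
    fix y :: "complex vec" assume y: "y \<in> carrier_vec d"
    then obtain v where v: "v \<in> N" "y = ?\<chi> v" using \<chi>_surj by blast
    have "(K * \<sigma> b) *\<^sub>v y = K *\<^sub>v (\<sigma> b *\<^sub>v y)"
      by (rule assoc_mult_mat_vec[OF K \<sigma>_mat[OF b] y])
    also have "\<dots> = K *\<^sub>v ?\<chi> (v \<triangleleft>\<^bsub>L\<^esub> b)"
      unfolding v(2) \<chi>_act[OF v(1) b] ..
    also have "\<dots> = \<rho> b *\<^sub>v \<phi> v"
      unfolding K\<chi>[OF N_act[OF v(1) b]] using v N_sub b by (intro \<rho>_act) auto
    also have "\<dots> = \<rho> b *\<^sub>v (K *\<^sub>v y)"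
      unfolding v(2) K\<chi>[OF v(1)] ..
    also have "\<dots> = (\<rho> b * K) *\<^sub>v y"
      by (rule assoc_mult_mat_vec[OF \<rho>_mat[OF b] K y, symmetric])
    finally show "(K * \<sigma> b) *\<^sub>v y = (\<rho> b * K) *\<^sub>v y" .
  qed
  ultimately have point: "A2_point \<sigma> \<rho> K \<in> rep_points B A2 (A2_dim d n)"
    using \<rho> K by (simp add: A2_point_def rep_points_A2_iff)
  have x: "x = A2_point \<sigma> \<rho> K" by (simp add: x_def \<sigma>_def K_def R_def)
  show "x \<in> rep_points B A2 (A2_dim (dim_row C) n)" using point by (simp add: x d_def)
  interpret Ker: right_module B "Ker L M l" by (rule Ker)
  have "orbit_of_representation B (Ker L M l) L (\<lambda>v. v) = GL_orbit B A2 (A2_dim d n) x"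
    unfolding x A2_point_def
  proof (rule orbit_of_representation_eq_GL_orbit[OF B Ker.vectorspace L.vectorspace
        Ker.act_closed L.act_closed _ _ \<chi> \<phi>])
    show "((\<lambda>i\<in>{1, 2}. if i = 1 then \<sigma> else \<rho>), (\<lambda>_. K)) \<in> rep_points B A2 (A2_dim d n)"
      using point by (simp add: A2_point_def)
  qed (use N_sub in \<open>auto simp: Ker_sel \<chi>_act \<rho>_act K\<chi>\<close>)
  moreover have "vectorspace.dim class_ring (Ker L M l) = d"
    by (rule dim_eq_coordinate_iso[OF Ker.vectorspace \<chi>])
  ultimately show "orbit_projection B (\<lambda>d. A2_dim d n) (dim_row C, x) = ker_orbit B L M l"
    by (simp add: orbit_projection_def ker_orbit_def d_def)
qed

lemma cokernel_lift:
  fixes B :: "(complex, 'b) module"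
    and L :: "('b, 'l) rmodule" and M :: "('b, 'm) rmodule"
  assumes B: "fin_dim_algebra B"
    and L: "right_module B L" "finitely_generated B L" "vectorspace.dim class_ring L = n"
    and M: "right_module B M" "finitely_generated B M" "vectorspace.dim class_ring M = m"
  shows "\<exists>\<Phi>. constructible_map (affine_space (Hom B L M))
        (coproduct_variety {..m} (\<lambda>d. rep_variety B A2 (A2_dim m d))) \<Phi> \<and>
      (\<forall>l \<in> carrier (Hom B L M).
        orbit_projection B (\<lambda>d. A2_dim m d) (\<Phi> l) = coker_orbit B L M l)"
proof -
  obtain \<phi> where \<phi>: "coordinate_iso L n \<phi>"
    using right_module_coordinates[OF B L] by blast
  obtain \<psi> \<rho> where \<psi>: "coordinate_iso M m \<psi>" and \<rho>: "\<rho> \<in> module_structures B m"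
    and \<rho>_act: "\<And>w b. w \<in> carrier M \<Longrightarrow> b \<in> carrier B \<Longrightarrow> \<psi> (w \<triangleleft>\<^bsub>M\<^esub> b) = \<rho> b *\<^sub>v \<psi> w"
    using right_module_coordinates[OF B M] by blast
  let ?X = "carrier (Hom B L M)" and ?A = "coord_matrix L n \<phi> m \<psi>"
  let ?G = "{\<xi>. (\<forall>f \<in> ?X. \<forall>g \<in> ?X. \<xi> (f \<oplus>\<^bsub>Hom B L M\<^esub> g) = \<xi> f + \<xi> g) \<and>
      (\<forall>c. \<forall>f \<in> ?X. \<xi> (c \<odot>\<^bsub>Hom B L M\<^esub> f) = c * \<xi> f)}"
  have entries: "(\<lambda>l. ?A l $$ (i, j)) \<in> polynomial_functions ?G" if "i < m" "j < n" for i j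
    using hom_matrix_entry_linear[OF \<phi> \<psi> that] by (rule polynomial_functions.coordinate)
  obtain \<S> C E where \<S>: "finite \<S>" "disjoint \<S>" "\<Union>\<S> = ?X"
      "\<And>S. S \<in> \<S> \<Longrightarrow> locally_closedin (zariski ?X ?G) S"
    and split: "\<And>l. l \<in> ?X \<Longrightarrow> split_cokernel (?A l) (C l) (E l)"
    and le: "\<And>l. l \<in> ?X \<Longrightarrow> dim_row (C l) \<le> m"
    and const: "\<And>S l l'. S \<in> \<S> \<Longrightarrow> l \<in> S \<Longrightarrow> l' \<in> S \<Longrightarrow> dim_row (C l) = dim_row (C l') \<and> E l = E l'"
    and rational: "\<And>S l i j. S \<in> \<S> \<Longrightarrow> l \<in> S \<Longrightarrow> i < dim_row (C l) \<Longrightarrow> j < m \<Longrightarrow>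
       rational_on ?G S (\<lambda>l'. C l' $$ (i, j))"
    by (rule constructible_split_cokernel[OF coord_matrix_carrier entries];
        ((assumption) | (rule that; assumption)))
  let ?\<sigma> = "\<lambda>l. \<lambda>b \<in> carrier B. C l * \<rho> b * E l"
  let ?\<Phi> = "\<lambda>l. (dim_row (C l), A2_point \<rho> (?\<sigma> l) (C l))"
  have point: "A2_point \<rho> (?\<sigma> l) (C l) \<in> rep_points B A2 (A2_dim m (dim_row (C l)))"
      "orbit_projection B (\<lambda>d. A2_dim m d) (?\<Phi> l) = coker_orbit B L M l" if "l \<in> ?X" for l
    by (rule cokernel_point[OF B L(1) M(1) \<phi> \<psi> \<rho> _ that split[OF that]];
        rule \<rho>_act; assumption)+
  have "constructible_map (affine_variety ?X ?G)
      (coproduct_variety {..m} (\<lambda>d. rep_variety B A2 (A2_dim m d))) ?\<Phi>"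
  proof (rule constructible_map_to_representations[OF \<S>])
    fix S l b i j assume S: "S \<in> \<S>" "l \<in> S" and b: "b \<in> carrier B"
      and ij: "i < dim_row (C l)" "j < dim_row (C l)"
    have dims: "C l' \<in> carrier_mat (dim_row (C l)) m" "E l' \<in> carrier_mat m (dim_row (C l))"
      if "l' \<in> S" for l'
    proof -
      have "l' \<in> ?X" using S(1) that \<S>(3) by blast
      moreover have "dim_row (C l) = dim_row (C l')" using const[OF S that] by (rule conjunct1)
      ultimately
      show "C l' \<in> carrier_mat (dim_row (C l)) m" "E l' \<in> carrier_mat m (dim_row (C l))"
        using split_cokernelD(1,2)[OF split coord_matrix_carrier] by simp_all
    qed
    have \<rho>b: "\<rho> b \<in> carrier_mat m m" using \<rho> b by (auto simp: module_structures_def)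
    have "rational_on ?G S (\<lambda>l'. (C l' * \<rho> b * E l) $$ (i, j))"
      using dims \<rho>b mult_carrier_mat[OF dims(1) \<rho>b] rational[OF S] S(2) ij
      by (intro rational_on_mat_mult[where p = "dim_row (C l)" and q = m and r = "dim_row (C l)"]
          rational_on_mat_mult[where p = "dim_row (C l)" and q = m and r = m] rational_on_const)
        auto
    then show "rational_on ?G S (\<lambda>l'. ?\<sigma> l' b $$ (i, j))"
    proof (rule rational_on_cong)
      fix l' assume "l' \<in> S"
      then have "E l' = E l" using const[OF S(1) _ S(2)] by blast
      then show "(C l' * \<rho> b * E l) $$ (i, j) = ?\<sigma> l' b $$ (i, j)"
        using b by simp
    qed
  next
    show "dim_row (C l) = dim_row (C l')" if "S \<in> \<S>" "l \<in> S" "l' \<in> S" for S l l'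
      using const[OF that] by (rule conjunct1)
    show "dim_row (C l) \<in> {..m}" if "l \<in> ?X" for l using le[OF that] by simp
    show "A2_point \<rho> (?\<sigma> l) (C l) \<in> rep_points B A2 (A2_dim m (dim_row (C l)))"
      if "l \<in> ?X" for l
      using that by (rule point(1))
  qed (assumption | rule rational_on_const | (rule rational, assumption+))+
  moreover have "affine_variety ?X ?G = affine_space (Hom B L M)"
    by (simp add: affine_space_def)
  ultimately show ?thesis
    using point(2) by (intro exI[of _ ?\<Phi>]) simp
qed

lemma kernel_lift:
  fixes B :: "(complex, 'b) module"
    and L :: "('b, 'l) rmodule" and M :: "('b, 'm) rmodule"
  assumes B: "fin_dim_algebra B"
    and L: "right_module B L" "finitely_generated B L" "vectorspace.dim class_ring L = n"
    and M: "right_module B M" "finitely_generated B M" "vectorspace.dim class_ring M = m"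
  shows "\<exists>\<Phi>. constructible_map (affine_space (Hom B L M))
        (coproduct_variety {..n} (\<lambda>d. rep_variety B A2 (A2_dim d n))) \<Phi> \<and>
      (\<forall>l \<in> carrier (Hom B L M).
        orbit_projection B (\<lambda>d. A2_dim d n) (\<Phi> l) = ker_orbit B L M l)"
proof -
  obtain \<psi> where \<psi>: "coordinate_iso M m \<psi>"
    using right_module_coordinates[OF B M] by blast
  obtain \<phi> \<rho> where \<phi>: "coordinate_iso L n \<phi>" and \<rho>: "\<rho> \<in> module_structures B n"
    and \<rho>_act: "\<And>v b. v \<in> carrier L \<Longrightarrow> b \<in> carrier B \<Longrightarrow> \<phi> (v \<triangleleft>\<^bsub>L\<^esub> b) = \<rho> b *\<^sub>v \<phi> v"
    using right_module_coordinates[OF B L] by blast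
  let ?X = "carrier (Hom B L M)" and ?A = "\<lambda>l. transpose_mat (coord_matrix L n \<phi> m \<psi> l)"
  let ?G = "{\<xi>. (\<forall>f \<in> ?X. \<forall>g \<in> ?X. \<xi> (f \<oplus>\<^bsub>Hom B L M\<^esub> g) = \<xi> f + \<xi> g) \<and>
      (\<forall>c. \<forall>f \<in> ?X. \<xi> (c \<odot>\<^bsub>Hom B L M\<^esub> f) = c * \<xi> f)}"
  have A: "?A l \<in> carrier_mat n m" for l by simp
  have entries: "(\<lambda>l. ?A l $$ (i, j)) \<in> polynomial_functions ?G" if "i < n" "j < m" for i j
  proof -
    have "?A l $$ (i, j) = coord_matrix L n \<phi> m \<psi> l $$ (j, i)" for l
      using that carrier_matD[OF coord_matrix_carrier[of L n \<phi> m \<psi> l]] by simp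
    then show ?thesis
      using polynomial_functions.coordinate[OF hom_matrix_entry_linear[OF \<phi> \<psi> that(2,1)]] by simp
  qed
  obtain \<S> C E where \<S>: "finite \<S>" "disjoint \<S>" "\<Union>\<S> = ?X"
      "\<And>S. S \<in> \<S> \<Longrightarrow> locally_closedin (zariski ?X ?G) S"
    and split: "\<And>l. l \<in> ?X \<Longrightarrow> split_cokernel (?A l) (C l) (E l)"
    and le: "\<And>l. l \<in> ?X \<Longrightarrow> dim_row (C l) \<le> n"
    and const: "\<And>S l l'. S \<in> \<S> \<Longrightarrow> l \<in> S \<Longrightarrow> l' \<in> S \<Longrightarrow> dim_row (C l) = dim_row (C l') \<and> E l = E l'"
    and rational: "\<And>S l i j. S \<in> \<S> \<Longrightarrow> l \<in> S \<Longrightarrow> i < dim_row (C l) \<Longrightarrow> j < n \<Longrightarrow>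
       rational_on ?G S (\<lambda>l'. C l' $$ (i, j))"
    by (rule constructible_split_cokernel[OF A entries]; ((assumption) | (rule that; assumption)))
  let ?\<sigma> = "\<lambda>l. \<lambda>b \<in> carrier B. transpose_mat (E l) * \<rho> b * transpose_mat (C l)"
  let ?\<Phi> = "\<lambda>l. (dim_row (C l), A2_point (?\<sigma> l) \<rho> (transpose_mat (C l)))"
  have point:
      "A2_point (?\<sigma> l) \<rho> (transpose_mat (C l)) \<in> rep_points B A2 (A2_dim (dim_row (C l)) n)"
      "orbit_projection B (\<lambda>d. A2_dim d n) (?\<Phi> l) = ker_orbit B L M l" if "l \<in> ?X" for l
    by (rule kernel_point[OF B L(1) M(1) \<phi> \<psi> \<rho> _ that split[OF that]];
        rule \<rho>_act; assumption)+
  have dims: "C l' \<in> carrier_mat (dim_row (C l)) n" "E l' \<in> carrier_mat n (dim_row (C l))"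
    if "S \<in> \<S>" "l \<in> S" "l' \<in> S" for S l l'
  proof -
    have "l' \<in> ?X" using that \<S>(3) by blast
    moreover have "dim_row (C l) = dim_row (C l')" using const[OF that] by (rule conjunct1)
    ultimately
    show "C l' \<in> carrier_mat (dim_row (C l)) n" "E l' \<in> carrier_mat n (dim_row (C l))"
      using split_cokernelD(1,2)[OF split A] by simp_all
  qed
  have K_rational: "rational_on ?G S (\<lambda>l'. transpose_mat (C l') $$ (i, j))"
    if S: "S \<in> \<S>" "l \<in> S" and ij: "i < n" "j < dim_row (C l)" for S l i j
  proof (rule rational_on_cong[OF rational[OF S ij(2,1)]])
    show "C l' $$ (j, i) = transpose_mat (C l') $$ (i, j)" if "l' \<in> S" for l'
      using dims(1)[OF S that] ij by auto
  qed
  have "constructible_map (affine_variety ?X ?G)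
      (coproduct_variety {..n} (\<lambda>d. rep_variety B A2 (A2_dim d n))) ?\<Phi>"
  proof (rule constructible_map_to_representations[OF \<S>])
    fix S l b i j assume S: "S \<in> \<S>" "l \<in> S" and b: "b \<in> carrier B"
      and ij: "i < dim_row (C l)" "j < dim_row (C l)"
    have \<rho>b: "\<rho> b \<in> carrier_mat n n" using \<rho> b by (auto simp: module_structures_def)
    have R\<rho>: "transpose_mat (E l) * \<rho> b \<in> carrier_mat (dim_row (C l)) n"
      using mult_carrier_mat[OF _ \<rho>b] dims(2)[OF S S(2)] by simp
    have "rational_on ?G S (\<lambda>l'. (transpose_mat (E l) * \<rho> b * transpose_mat (C l')) $$ (i, j))"
      using R\<rho> dims(1)[OF S] K_rational[OF S] ij
      by (intro rational_on_mat_mult[where p = "dim_row (C l)" and q = n and r = "dim_row (C l)"]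
          rational_on_const) auto
    then show "rational_on ?G S (\<lambda>l'. ?\<sigma> l' b $$ (i, j))"
    proof (rule rational_on_cong)
      fix l' assume "l' \<in> S"
      then have "E l' = E l" using const[OF S(1) _ S(2)] by blast
      then show "(transpose_mat (E l) * \<rho> b * transpose_mat (C l')) $$ (i, j) = ?\<sigma> l' b $$ (i, j)"
        using b by simp
    qed
  next
    show "dim_row (C l) = dim_row (C l')" if "S \<in> \<S>" "l \<in> S" "l' \<in> S" for S l l'
      using const[OF that] by (rule conjunct1)
    show "dim_row (C l) \<in> {..n}" if "l \<in> ?X" for l using le[OF that] by simp
    show "A2_point (?\<sigma> l) \<rho> (transpose_mat (C l)) \<in> rep_points B A2 (A2_dim (dim_row (C l)) n)"
      if "l \<in> ?X" for l
      using that by (rule point(1))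
  qed (assumption | rule rational_on_const | (rule K_rational, assumption+))+
  moreover have "affine_variety ?X ?G = affine_space (Hom B L M)"
    by (simp add: affine_space_def)
  ultimately show ?thesis
    using point(2) by (intro exI[of _ ?\<Phi>]) simp
qed

theorem lemma2p3:
  fixes B :: "(complex, 'b) module"
    and L :: "('b, 'l) rmodule" and M :: "('b, 'm) rmodule"
    and n m :: nat
  assumes "fin_dim_algebra B"
    and "right_module B L" and "finitely_generated B L" and "vectorspace.dim class_ring L = n"
    and "right_module B M" and "finitely_generated B M" and "vectorspace.dim class_ring M = m"
  shows
    "(\<exists>\<Phi>. constructible_map (affine_space (Hom B L M))
          (coproduct_variety {..m} (\<lambda>d. rep_variety B A2 (A2_dim m d))) \<Phi> \<and>
        (\<forall>l \<in> carrier (Hom B L M).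
          orbit_projection B (\<lambda>d. A2_dim m d) (\<Phi> l) = coker_orbit B L M l)) \<and>
     (\<exists>\<Phi>. constructible_map (affine_space (Hom B L M))
          (coproduct_variety {..n} (\<lambda>d. rep_variety B A2 (A2_dim d n))) \<Phi> \<and>
        (\<forall>l \<in> carrier (Hom B L M).
          orbit_projection B (\<lambda>d. A2_dim d n) (\<Phi> l) = ker_orbit B L M l))"
  using cokernel_lift[OF assms] kernel_lift[OF assms] by (rule conjI)

end
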